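(* Let $M=\mathbb{R}^4$ with coordinates $(t,x,y,z)$ and the Lorentzian metric $g = dt\,(dz+\tfrac12 y\,dx-\tfrac12 x\,dy)+dx^2+dy^2$, and let $N$ be the $2$-step nilpotent Lie group with underlying manifold $\mathbb{R}^4$ and multiplication $(t_1,v_1,z_1)\cdot(t_2,v_2,z_2)=(t_1+t_2,\,v_1+v_2,\,z_1+z_2+\tfrac12 v_1^{t}Jv_2)$, where $v_i=(x_i,y_i)\in\mathbb{R}^2$ and $J=\begin{pmatrix}0&1\\-1&0\end{pmatrix}$. The metric $g$ is left-invariant on $N$, and $N$ is regarded as a subgroup of $\mathrm{Iso}(M)$ via left-translations. Then: \begin{itemize} \item $N$ acts transitively on $M$, but $N$ is not a normal subgroup of $\mathrm{Iso}_0(M)$. \item The maximal connected normal nilpotent Lie subgroup of $\mathrm{Iso}(M)$ (the nilradical) does not contain $N$, and its action on $M$ is not transitive. \item $\mathrm{Iso}^{aut}(N)\subsetneq \mathrm{Iso}(M)$, where $\mathrm{Iso}^{aut}(N)=N\rtimes H^{aut_N}$ and $\mathrm{Iso}(M)=N\cdot H$. \item $H^{aut_N}$ is not connected. \end{itemize}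
   Context: In the metric, the mixed products of $1$-forms are symmetric products normalized so that $g(\partial_t,\partial_z)=1$ (i.e. for the first term, $\alpha\beta=\alpha\otimes\beta+\beta\otimes\alpha$), while $dx^2=dx\otimes dx$, $dy^2=dy\otimes dy$. $\mathrm{Iso}(M)$ is the full isometry group of $(M,g)$, a Lie group with the compact-open topology, and $\mathrm{Iso}_0(M)$ is its identity component. $H$ is the subgroup of isometries fixing the identity element $e=(0,0,0,0)$ of $N$. $H^{aut_N}=\mathrm{Aut}(N)\cap\mathrm{Iso}(M)$ is the group of isometric automorphisms of $N$. $\mathrm{Iso}^{aut}(N)=N\cdot H^{aut_N}$ is the group of isometries of the form $L_n\circ\varphi$ with $n\in N$, $L_n$ the left-translation by $n$, and $\varphi\in H^{aut_N}$. *)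

theory Defs
  imports "HOL-Analysis.Analysis" "HOL-Algebra.Coset" "HOL-Algebra.Generated_Groups"
begin

section \<open>Smooth manifolds and Lie groups\<close>

text \<open>The model space of dimension \<open>n\<close> is \<^term>\<open>topspace (Euclidean_space n)\<close>, i.e. the
  sequences that vanish from index \<open>n\<close> on; in this way the dimension can be quantified over. For
  \<open>W\<close> relatively open in it, \<open>Ck_on n W f k\<close> says that all iterated partial derivatives
  of \<open>f\<close> of order at most \<open>k\<close> exist and are continuous on \<open>W\<close>.\<close>

definition has_partials :: "nat \<Rightarrow> (nat \<Rightarrow> real) set \<Rightarrow> ((nat \<Rightarrow> real) \<Rightarrow> real) \<Rightarrow> bool" where
  "has_partials n W f \<longleftrightarrow> (\<forall>i<n. \<forall>x\<in>W. (\<lambda>s. f (x(i := s))) differentiable (at (x i)))"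

definition partial :: "nat \<Rightarrow> ((nat \<Rightarrow> real) \<Rightarrow> real) \<Rightarrow> (nat \<Rightarrow> real) \<Rightarrow> real" where
  "partial i f x = deriv (\<lambda>s. f (x(i := s))) (x i)"

fun Ck_on :: "nat \<Rightarrow> (nat \<Rightarrow> real) set \<Rightarrow> ((nat \<Rightarrow> real) \<Rightarrow> real) \<Rightarrow> nat \<Rightarrow> bool" where
  "Ck_on n W f 0 \<longleftrightarrow> continuous_on W f"
| "Ck_on n W f (Suc k) \<longleftrightarrow>
     continuous_on W f \<and> has_partials n W f \<and> (\<forall>i<n. Ck_on n W (partial i f) k)"

definition smooth_on :: "nat \<Rightarrow> (nat \<Rightarrow> real) set \<Rightarrow> ((nat \<Rightarrow> real) \<Rightarrow> real) \<Rightarrow> bool" where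
  "smooth_on n W f \<longleftrightarrow> (\<forall>k. Ck_on n W f k)"

type_synonym 'a chart = "'a set \<times> ('a \<Rightarrow> nat \<Rightarrow> real)"

text \<open>The function \<open>f\<close> read in the charts \<open>(U, \<phi>)\<close> of the source (dimension \<open>n\<close>) and
  \<open>(V, \<psi>)\<close> of the target (dimension \<open>m\<close>) is smooth where it is defined.\<close>

definition smooth_in_charts ::
    "nat \<Rightarrow> 'a chart \<Rightarrow> nat \<Rightarrow> 'b chart \<Rightarrow> ('a \<Rightarrow> 'b) \<Rightarrow> bool" where
  "smooth_in_charts n c m d f \<longleftrightarrow>
     (\<forall>j<m. smooth_on n (snd c ` {p \<in> fst c. f p \<in> fst d})
              (\<lambda>u. snd d (f (inv_into (fst c) (snd c) u)) j))"

definition smooth_manifold :: "'a topology \<Rightarrow> nat \<Rightarrow> 'a chart set \<Rightarrow> bool" where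
  "smooth_manifold X n A \<longleftrightarrow>
     Hausdorff_space X \<and> second_countable X \<and>
     topspace X = (\<Union>c\<in>A. fst c) \<and>
     (\<forall>(U, \<phi>)\<in>A. openin X U \<and> openin (Euclidean_space n) (\<phi> ` U) \<and>
        homeomorphic_map (subtopology X U) (subtopology (Euclidean_space n) (\<phi> ` U)) \<phi>) \<and>
     (\<forall>c\<in>A. \<forall>d\<in>A. smooth_in_charts n c n d (\<lambda>p. p))"

definition smooth_map ::
    "'a topology \<Rightarrow> nat \<Rightarrow> 'a chart set \<Rightarrow> 'b topology \<Rightarrow> nat \<Rightarrow> 'b chart set \<Rightarrow> ('a \<Rightarrow> 'b) \<Rightarrow> bool" where
  "smooth_map X n A Y m B f \<longleftrightarrow>
     continuous_map X Y f \<and> (\<forall>c\<in>A. \<forall>d\<in>B. smooth_in_charts n c m d f)"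

definition prod_chart :: "nat \<Rightarrow> 'a chart \<Rightarrow> 'b chart \<Rightarrow> ('a \<times> 'b) chart" where
  "prod_chart n c d =
     (fst c \<times> fst d, \<lambda>(p, q) i. if i < n then snd c p i else snd d q (i - n))"

definition prod_atlas :: "nat \<Rightarrow> 'a chart set \<Rightarrow> 'b chart set \<Rightarrow> ('a \<times> 'b) chart set" where
  "prod_atlas n A B = {prod_chart n c d | c d. c \<in> A \<and> d \<in> B}"

definition lie_group :: "('a, 'r) monoid_scheme \<Rightarrow> 'a topology \<Rightarrow> nat \<Rightarrow> 'a chart set \<Rightarrow> bool" where
  "lie_group G X n A \<longleftrightarrow>
     group G \<and> topspace X = carrier G \<and> smooth_manifold X n A \<and>
     smooth_map (prod_topology X X) (n + n) (prod_atlas n A A) X n A (\<lambda>(a, b). a \<otimes>\<^bsub>G\<^esub> b) \<and>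
     smooth_map X n A X n A (\<lambda>a. inv\<^bsub>G\<^esub> a)"

section \<open>Group theory\<close>

fun lower_central :: "('a, 'r) monoid_scheme \<Rightarrow> nat \<Rightarrow> 'a set" where
  "lower_central G 0 = carrier G"
| "lower_central G (Suc k) =
     generate G {x \<otimes>\<^bsub>G\<^esub> y \<otimes>\<^bsub>G\<^esub> inv\<^bsub>G\<^esub> x \<otimes>\<^bsub>G\<^esub> inv\<^bsub>G\<^esub> y | x y. x \<in> carrier G \<and> y \<in> lower_central G k}"

definition nilpotent_group :: "('a, 'r) monoid_scheme \<Rightarrow> bool" where
  "nilpotent_group G \<longleftrightarrow> group G \<and> (\<exists>k. lower_central G k = {\<one>\<^bsub>G\<^esub>})"

definition internal_semidirect :: "('a, 'r) monoid_scheme \<Rightarrow> 'a set \<Rightarrow> 'a set \<Rightarrow> bool" where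
  "internal_semidirect G A B \<longleftrightarrow>
     A \<lhd> G \<and> subgroup B G \<and> A \<inter> B = {\<one>\<^bsub>G\<^esub>} \<and> A <#>\<^bsub>G\<^esub> B = carrier G"

definition transitive :: "('p \<Rightarrow> 'p) set \<Rightarrow> bool" where
  "transitive S \<longleftrightarrow> (\<forall>p q. \<exists>f\<in>S. f p = q)"

section \<open>The Lorentzian manifold \<open>M\<close> and the group \<open>N\<close>\<close>

text \<open>Points and tangent vectors are quadruples \<open>(t, x, y, z)\<close>.\<close>

type_synonym point = "real \<times> real \<times> real \<times> real"

fun coords :: "point \<Rightarrow> nat \<Rightarrow> real" where
  "coords (t, x, y, z) =
     (\<lambda>i. if i = 0 then t else if i = 1 then x else if i = 2 then y else if i = 3 then z else 0)"

definition M_atlas :: "point chart set" where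
  "M_atlas = {(UNIV, coords)}"

text \<open>The 1-form \<open>dz + y dx / 2 - x dy / 2\<close> at a point, evaluated on a tangent vector.\<close>

fun eta :: "point \<Rightarrow> point \<Rightarrow> real" where
  "eta (t, x, y, z) (vt, vx, vy, vz) = vz + y * vx / 2 - x * vy / 2"

fun metric :: "point \<Rightarrow> point \<Rightarrow> point \<Rightarrow> real" where
  "metric p (vt, vx, vy, vz) (wt, wx, wy, wz) =
     vt * eta p (wt, wx, wy, wz) + eta p (vt, vx, vy, vz) * wt + vx * wx + vy * wy"

fun nmult :: "point \<Rightarrow> point \<Rightarrow> point" where
  "nmult (t1, x1, y1, z1) (t2, x2, y2, z2) =
     (t1 + t2, x1 + x2, y1 + y2, z1 + z2 + (x1 * y2 - y1 * x2) / 2)"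

definition N_group :: "point monoid" where
  "N_group = \<lparr>carrier = UNIV, mult = nmult, one = (0, 0, 0, 0)\<rparr>"

lemma group_N_group: "group N_group"
proof (rule groupI)
  fix p assume "p \<in> carrier N_group"
  obtain t x y z where p: "p = (t, x, y, z)" by (cases p)
  have "nmult (- t, - x, - y, - z) p = (0, 0, 0, 0)" by (simp add: p)
  then show "\<exists>q\<in>carrier N_group. q \<otimes>\<^bsub>N_group\<^esub> p = \<one>\<^bsub>N_group\<^esub>"
    unfolding N_group_def by auto
qed (auto simp: N_group_def field_simps)

section \<open>Isometry groups\<close>

definition diffeo_M :: "(point \<Rightarrow> point) \<Rightarrow> bool" where
  "diffeo_M f \<longleftrightarrow> bij f \<and>
     smooth_map euclidean 4 M_atlas euclidean 4 M_atlas f \<and>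
     smooth_map euclidean 4 M_atlas euclidean 4 M_atlas (inv_into UNIV f)"

definition Isometries :: "(point \<Rightarrow> point) set" where
  "Isometries = {f. diffeo_M f \<and>
     (\<forall>p v w. metric (f p) (frechet_derivative f (at p) v) (frechet_derivative f (at p) w)
              = metric p v w)}"

definition Iso_M :: "(point \<Rightarrow> point) monoid" where
  "Iso_M = \<lparr>carrier = Isometries, mult = (\<circ>), one = id\<rparr>"

definition compact_open_topology :: "(point \<Rightarrow> point) topology" where
  "compact_open_topology =
     topology_generated_by {{f. f ` C \<subseteq> U} | C U. compact C \<and> open U}"

definition Iso_top :: "(point \<Rightarrow> point) topology" where
  "Iso_top = subtopology compact_open_topology Isometries"

definition Iso0 :: "(point \<Rightarrow> point) set" where
  "Iso0 = connected_component_of_set Iso_top id"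

abbreviation Iso0_group :: "(point \<Rightarrow> point) monoid" where
  "Iso0_group \<equiv> Iso_M\<lparr>carrier := Iso0\<rparr>"

text \<open>\<open>N\<close> as a set of transformations of \<open>M\<close>.\<close>

definition N_trans :: "(point \<Rightarrow> point) set" where
  "N_trans = range nmult"

definition H_stab :: "(point \<Rightarrow> point) set" where
  "H_stab = {f \<in> Isometries. f (0, 0, 0, 0) = (0, 0, 0, 0)}"

definition Aut_N :: "(point \<Rightarrow> point) set" where
  "Aut_N = {f \<in> iso N_group N_group. diffeo_M f}"

definition H_aut :: "(point \<Rightarrow> point) set" where
  "H_aut = Aut_N \<inter> Isometries"

definition Iso_aut :: "(point \<Rightarrow> point) set" where
  "Iso_aut = {nmult n \<circ> \<phi> | n \<phi>. \<phi> \<in> H_aut}"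

text \<open>A connected Lie subgroup of \<open>Iso(M)\<close> is a subgroup that carries the structure of a connected
  Lie group, possibly with a topology finer than the one induced by \<open>Iso(M)\<close>, such that the
  inclusion is smooth. As \<open>Iso(M)\<close> is a Lie transformation group, a continuous map
  into it is smooth iff the associated action on \<open>M\<close> is smooth. An injective smooth homomorphism
  of Lie groups is an immersion, so this is not required separately.\<close>

definition connected_lie_subgroup :: "(point \<Rightarrow> point) set \<Rightarrow> bool" where
  "connected_lie_subgroup K \<longleftrightarrow>
     subgroup K Iso_M \<and>
     (\<exists>X n A. lie_group (Iso_M\<lparr>carrier := K\<rparr>) X n A \<and> connected_space X \<and>
        continuous_map X Iso_top (\<lambda>f. f) \<and>
        smooth_map (prod_topology X euclidean) (n + 4) (prod_atlas n A M_atlas)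
                   euclidean 4 M_atlas (\<lambda>(f, p). f p))"

definition connected_normal_nilpotent :: "(point \<Rightarrow> point) set \<Rightarrow> bool" where
  "connected_normal_nilpotent K \<longleftrightarrow>
     connected_lie_subgroup K \<and> K \<lhd> Iso_M \<and> nilpotent_group (Iso_M\<lparr>carrier := K\<rparr>)"

definition is_nilradical :: "(point \<Rightarrow> point) set \<Rightarrow> bool" where
  "is_nilradical R \<longleftrightarrow> connected_normal_nilpotent R \<and>
     (\<forall>K. connected_normal_nilpotent K \<longrightarrow> K \<subseteq> R)"

end

theory Submission
  imports Defs
begin

text \<open>With \<open>w = x + i y\<close>, the geodesics of \<open>M\<close> satisfy \<open>t'' = 0\<close> and \<open>w'' = i t' w'\<close> and can be solved
  explicitly. An isometry \<open>f\<close> with \<open>f 0 = 0\<close> and derivative \<open>A\<close> at \<open>0\<close> maps geodesics to geodesics, hence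
  \<open>f (expo u) = expo (A u)\<close>. The points \<open>(2 \<pi>, w, z)\<close> of the tangent space have images under \<open>expo\<close> that
  depend on \<open>z + \<bar>w\<bar>\<^sup>2 / (4 \<pi>)\<close> only; linearity of \<open>A\<close> then forces \<open>dt \<circ> A = r dt\<close> with an integer \<open>r\<close>, and
  \<open>r = \<plusminus>1\<close> as the inverse of \<open>f\<close> has the same property. As \<open>f\<close> is determined by \<open>A\<close>, every isometry is
  a product \<open>heis a b c d k \<circ> rot s \<theta> \<circ> g \<circ> g'\<close> with \<open>g\<close>, \<open>g'\<close> trivial or one of two reflections.

  The maps \<open>heis a b c d k\<close> form a normal Heisenberg group \<open>Heis\<close> of dimension 5 that preserves \<open>t\<close>.
  Modulo its centre, \<open>rot s \<theta>\<close> acts on it by conjugation as the diagonal matrix with entries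
  \<open>exp(i \<theta>)\<close> and \<open>exp(i (\<theta> - s))\<close>. If \<open>heis a b c d k \<circ> rot s \<theta>\<close> lies in a normal nilpotent subgroup,
  iterated commutators with \<open>Heis\<close> must vanish, so both entries are \<open>1\<close> and \<open>s \<in> 2 \<pi> \<int>\<close>; if the
  subgroup is also connected, then \<open>s = 0\<close>. Hence \<open>Heis\<close> is the nilradical.\<close>

section \<open>Functions of class \<open>C\<^sup>k\<close>\<close>

text \<open>All smooth isometries have to be classified, with no finite-dimensional group given
  beforehand. Geodesics provide the rigidity: isometries preserve them, and here they have closed
  formulas. For this, smoothness, defined by iterated partial derivatives in charts, must be turned
  into Frechet derivatives whose second derivatives are symmetric. The class \<open>Cd\<close> is
  the bridge; it asks for derivatives in fixed directions only and so avoids operator-valued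
  functions. The integer \<open>r\<close> comes from conjugate points. The metric at the origin
  alone would allow every boost that scales \<open>dt\<close> by \<open>r\<close> and
  \<open>dz\<close> by \<open>1 / r\<close>. But geodesics with \<open>t' = 2 \<pi>\<close> and
  different \<open>w'\<close> refocus at parameter \<open>1\<close>, their images must refocus as
  well, and this forces \<open>exp(2 \<pi> i r) = 1\<close>. A connected Lie subgroup may carry a
  topology finer than that of \<open>Iso_top\<close>. Its continuous inclusion makes it connected in
  \<open>Iso_top\<close>, and the arguments with signs and with multiples of \<open>2 \<pi>\<close>
  take place there. Conversely, \<open>Heis\<close> gets its Lie structure from explicit coordinates
  in R^5.\<close>

fun Cd :: "nat \<Rightarrow> ('a::real_normed_vector \<Rightarrow> 'b::real_normed_vector) \<Rightarrow> bool" where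
  "Cd 0 F \<longleftrightarrow> continuous_on UNIV F"
| "Cd (Suc k) F \<longleftrightarrow> (\<exists>D. (\<forall>p. (F has_derivative D p) (at p)) \<and> (\<forall>v. Cd k (\<lambda>p. D p v)))"

lemma Cd_continuous: "Cd k F \<Longrightarrow> continuous_on UNIV F"
  by (cases k) (auto intro!: continuous_at_imp_continuous_on dest: has_derivative_continuous)

lemma Cd_Suc_D: "Cd (Suc k) F \<Longrightarrow> Cd k F"
proof (induction k arbitrary: F)
  case 0
  then show ?case using Cd_continuous Cd.simps(1) by blast
next
  case (Suc k)
  then show ?case by (metis Cd.simps(2))
qed

lemma Cd_const [intro]: "Cd k (\<lambda>p. c)"
proof (induction k arbitrary: c)
  case (Suc k)
  have "((\<lambda>p. c) has_derivative (\<lambda>v. 0)) (at p)" for p by simp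
  with Suc show ?case by (auto intro!: exI[of _ "\<lambda>p v. 0"])
qed auto

lemma Cd_bounded_linear:
  assumes "bounded_linear L"
  shows "Cd k L"
proof (cases k)
  case 0
  then show ?thesis using assms by (simp add: linear_continuous_on)
next
  case (Suc m)
  have "(L has_derivative L) (at p)" for p
    using assms by (rule bounded_linear_imp_has_derivative)
  then show ?thesis using Cd_const by (auto simp: Suc intro!: exI[of _ "\<lambda>p. L"])
qed

lemma Cd_linear_compose:
  assumes "bounded_linear L" "Cd k F"
  shows "Cd k (\<lambda>p. L (F p))"
  using assms(2)
proof (induction k arbitrary: F)
  case 0
  then show ?case using assms(1) by (auto intro: bounded_linear.continuous_on)
next
  case (Suc k)
  then obtain D where D: "\<And>p. (F has_derivative D p) (at p)" "\<And>v. Cd k (\<lambda>p. D p v)"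
    by auto
  have "((\<lambda>p. L (F p)) has_derivative (\<lambda>v. L (D p v))) (at p)" for p
    using bounded_linear.has_derivative[OF assms(1) D(1)] .
  with Suc.IH[OF D(2)] show ?case by (auto intro!: exI[of _ "\<lambda>p v. L (D p v)"])
qed

lemma Cd_add [intro]: "Cd k F \<Longrightarrow> Cd k G \<Longrightarrow> Cd k (\<lambda>p. F p + G p)"
proof (induction k arbitrary: F G)
  case 0
  then show ?case by (auto intro: continuous_intros)
next
  case (Suc k)
  then obtain D E where D: "\<And>p. (F has_derivative D p) (at p)" "\<And>v. Cd k (\<lambda>p. D p v)"
    and E: "\<And>p. (G has_derivative E p) (at p)" "\<And>v. Cd k (\<lambda>p. E p v)"
    by auto
  have "((\<lambda>p. F p + G p) has_derivative (\<lambda>v. D p v + E p v)) (at p)" for p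
    by (intro has_derivative_add D E)
  with Suc.IH[OF D(2) E(2)] show ?case by (auto intro!: exI[of _ "\<lambda>p v. D p v + E p v"])
qed

lemma Cd_sum [intro]: "(\<And>i. i \<in> I \<Longrightarrow> Cd k (F i)) \<Longrightarrow> Cd k (\<lambda>p. \<Sum>i\<in>I. F i p)"
  by (induction I rule: infinite_finite_induct) (auto intro: Cd_const Cd_add)

lemma Cd_minus [intro]: "Cd k F \<Longrightarrow> Cd k (\<lambda>p. - F p)"
  by (rule Cd_linear_compose) (auto intro: bounded_linear_minus bounded_linear_ident)

lemma Cd_diff [intro]: "Cd k F \<Longrightarrow> Cd k G \<Longrightarrow> Cd k (\<lambda>p. F p - G p)"
  using Cd_add[of k F "\<lambda>p. - G p"] Cd_minus[of k G] by simp

lemma Cd_scaleR [intro]: "Cd k F \<Longrightarrow> Cd k G \<Longrightarrow> Cd k (\<lambda>p. F p *\<^sub>R G p)"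
proof (induction k arbitrary: F G)
  case 0
  then show ?case by (auto intro: continuous_intros)
next
  case (Suc k)
  then obtain D E where D: "\<And>p. (F has_derivative D p) (at p)" "\<And>v. Cd k (\<lambda>p. D p v)"
    and E: "\<And>p. (G has_derivative E p) (at p)" "\<And>v. Cd k (\<lambda>p. E p v)"
    by auto
  have "((\<lambda>p. F p *\<^sub>R G p) has_derivative (\<lambda>v. F p *\<^sub>R E p v + D p v *\<^sub>R G p)) (at p)" for p
    by (intro has_derivative_scaleR D E)
  moreover have "Cd k (\<lambda>p. F p *\<^sub>R E p v + D p v *\<^sub>R G p)" for v
    using Suc.prems[THEN Cd_Suc_D] D(2) E(2) by (intro Cd_add Suc.IH)
  ultimately show ?case by (auto intro!: exI[of _ "\<lambda>p v. F p *\<^sub>R E p v + D p v *\<^sub>R G p"])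
qed

lemma Cd_mult [intro]: "Cd k F \<Longrightarrow> Cd k G \<Longrightarrow> Cd k (\<lambda>p. F p * G p :: real)"
  using Cd_scaleR[of k F G] by simp

text \<open>Differentiation exchanges sine and cosine, so the induction carries both claims at
  once.\<close>

lemma Cd_sin_cos: "Cd k F \<Longrightarrow> Cd k (\<lambda>p. sin (F p :: real)) \<and> Cd k (\<lambda>p. cos (F p))"
proof (induction k arbitrary: F)
  case 0
  then show ?case by (auto intro: continuous_intros)
next
  case (Suc k)
  then obtain D where D: "\<And>p. (F has_derivative D p) (at p)" "\<And>v. Cd k (\<lambda>p. D p v)"
    by auto
  have F: "Cd k F" using Suc.prems Cd_Suc_D by blast
  have "((\<lambda>p. sin (F p)) has_derivative (\<lambda>v. D p v * cos (F p))) (at p)"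
       "((\<lambda>p. cos (F p)) has_derivative (\<lambda>v. D p v * - sin (F p))) (at p)" for p
    by (auto intro!: derivative_eq_intros D simp: mult.commute)
  moreover have "Cd k (\<lambda>p. D p v * cos (F p))" "Cd k (\<lambda>p. D p v * - sin (F p))" for v
    using Suc.IH[OF F] D(2) by (intro Cd_mult Cd_minus; simp)+
  ultimately show ?case
    unfolding Cd.simps
    by (intro conjI exI[of _ "\<lambda>p v. D p v * cos (F p)"] exI[of _ "\<lambda>p v. D p v * - sin (F p)"] allI)
qed

lemmas Cd_sin [intro] = Cd_sin_cos[THEN conjunct1] and Cd_cos [intro] = Cd_sin_cos[THEN conjunct2]

lemma Cd_fst [intro]: "Cd k F \<Longrightarrow> Cd k (\<lambda>p. fst (F p))"
  and Cd_snd [intro]: "Cd k F \<Longrightarrow> Cd k (\<lambda>p. snd (F p))"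
  by (auto intro: Cd_linear_compose bounded_linear_fst bounded_linear_snd bounded_linear_ident)

lemma Cd_ident [intro]: "Cd k (\<lambda>p. p)"
  by (rule Cd_bounded_linear) (rule bounded_linear_ident)

lemma Cd_Pair [intro]: "Cd k F \<Longrightarrow> Cd k G \<Longrightarrow> Cd k (\<lambda>p. (F p, G p))"
proof (induction k arbitrary: F G)
  case 0
  then show ?case by (auto intro: continuous_intros)
next
  case (Suc k)
  then obtain D E where D: "\<And>p. (F has_derivative D p) (at p)" "\<And>v. Cd k (\<lambda>p. D p v)"
    and E: "\<And>p. (G has_derivative E p) (at p)" "\<And>v. Cd k (\<lambda>p. E p v)"
    by auto
  have "((\<lambda>p. (F p, G p)) has_derivative (\<lambda>v. (D p v, E p v))) (at p)" for p
    by (intro has_derivative_Pair D E)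
  with Suc.IH[OF D(2) E(2)] show ?case by (auto intro!: exI[of _ "\<lambda>p v. (D p v, E p v)"])
qed

text \<open>The derivative of the composite is \<open>D (G p) (E p v)\<close>, whose direction
  varies with \<open>p\<close>, while \<open>Cd\<close> speaks of fixed directions. Expanding the
  direction in the finite basis of the middle space leaves sums of products to which the induction
  hypothesis applies.\<close>

lemma Cd_compose:
  fixes F :: "'b::euclidean_space \<Rightarrow> 'c::real_normed_vector"
    and G :: "'a::real_normed_vector \<Rightarrow> 'b"
  shows "Cd k F \<Longrightarrow> Cd k G \<Longrightarrow> Cd k (\<lambda>p. F (G p))"
proof (induction k arbitrary: F)
  case 0
  then show ?case by (auto intro: continuous_on_compose2)
next
  case (Suc k)
  then obtain D E where D: "\<And>p. (F has_derivative D p) (at p)" "\<And>v. Cd k (\<lambda>p. D p v)"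
    and E: "\<And>p. (G has_derivative E p) (at p)" "\<And>v. Cd k (\<lambda>p. E p v)"
    by auto
  have G: "Cd k G" using Suc.prems Cd_Suc_D by blast
  have eq: "D q v = (\<Sum>b\<in>Basis. (v \<bullet> b) *\<^sub>R D q b)" for q v
  proof -
    interpret linear "D q" using D(1) has_derivative_linear by blast
    show ?thesis by (subst euclidean_representation[of v, symmetric]) (simp only: sum scale)
  qed
  have "((\<lambda>p. F (G p)) has_derivative (\<lambda>v. D (G p) (E p v))) (at p)" for p
    by (rule has_derivative_compose[OF E(1) D(1)])
  moreover have "Cd k (\<lambda>p. D (G p) (E p v))" for v
    unfolding eq[of _ "E _ v"] using Suc.IH[OF D(2) G] E(2)
    by (intro Cd_sum Cd_scaleR Cd_linear_compose[of "\<lambda>x. x \<bullet> _"] bounded_linear_inner_left) auto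
  ultimately show ?case by (auto intro!: exI[of _ "\<lambda>p v. D (G p) (E p v)"])
qed

section \<open>Total derivatives from partial ones, and symmetry of second derivatives\<close>

lemma has_derivative_real_prod:
  fixes f :: "real \<times> 'b::real_normed_vector \<Rightarrow> real"
  assumes d: "\<And>x y. ((\<lambda>s. f (s, y)) has_real_derivative d (x, y)) (at x)"
    and cont: "continuous_on UNIV d"
    and D: "((\<lambda>y. f (x0, y)) has_derivative D) (at y0)"
  shows "(f has_derivative (\<lambda>(h, k). d (x0, y0) * h + D k)) (at (x0, y0))"
proof -
  define e where "e = (\<lambda>y x. blinfun_scaleR_left (d (x, y)))"
  have d': "((\<lambda>s. f (s, y)) has_derivative blinfun_apply (e y x)) (at x)" for x y
    using has_field_derivative_imp_has_derivative[OF d, of y x] by (simp add: e_def mult.commute[of _ "d (x, y)"])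
  have "continuous_on UNIV (\<lambda>q. blinfun_scaleR_left (d (snd q, fst q)) :: real \<Rightarrow>\<^sub>L real)"
    by (rule bounded_linear.continuous_on[OF bounded_linear_blinfun_scaleR_left])
      (rule continuous_on_compose2[OF cont]; auto intro!: continuous_intros)
  then have "isCont (\<lambda>q. blinfun_scaleR_left (d (snd q, fst q)) :: real \<Rightarrow>\<^sub>L real) (y0, x0)"
    by (metis UNIV_I continuous_on_eq_continuous_at open_UNIV)
  then have c: "continuous (at (y0, x0) within UNIV \<times> UNIV) (\<lambda>(y, x). e y x)"
    by (simp add: e_def case_prod_unfold)
  \<comment> \<open>The rule for partial derivatives wants a continuous derivative in the second
    variable. The real variable, whose derivative \<open>d\<close> is continuous, is therefore put
    second, and \<open>sw\<close> swaps back afterwards.\<close>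
  have "((\<lambda>(y, x). f (x, y)) has_derivative (\<lambda>(ty, tx). D ty + blinfun_apply (e y0 x0) tx))
      (at (y0, x0) within UNIV \<times> UNIV)"
    using d' D c by (intro has_derivative_partialsI) auto
  then have *: "((\<lambda>q. f (snd q, fst q)) has_derivative (\<lambda>q. D (fst q) + d (x0, y0) * snd q)) (at (y0, x0))"
    by (simp add: case_prod_unfold e_def mult.commute)
  have sw: "((\<lambda>q. (snd q, fst q)) has_derivative (\<lambda>q. (snd q, fst q))) (at (x0, y0))"
    by (auto intro!: derivative_eq_intros)
  have "((\<lambda>q. f (snd (snd q, fst q), fst (snd q, fst q))) has_derivative
      (\<lambda>q. D (fst (snd q, fst q)) + d (x0, y0) * snd (snd q, fst q))) (at (x0, y0))"
    by (rule has_derivative_compose[OF sw]) (use * in simp)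
  then show ?thesis by (simp add: case_prod_unfold add.commute)
qed

text \<open>Write \<open>F (q s e) = F (q s 0) + (\<integral>r\<in>{0..e}. D (q s r) w)\<close>, differentiate in \<open>s\<close> under the
  integral sign and then in \<open>e\<close>.\<close>

lemma symmetric_second_derivative:
  fixes F :: "'a::real_normed_vector \<Rightarrow> real"
  assumes D: "\<And>p. (F has_derivative D p) (at p)"
    and E: "\<And>v p. ((\<lambda>p. D p v) has_derivative E v p) (at p)"
    and cont: "\<And>v w. continuous_on UNIV (\<lambda>p. E v p w)"
  shows "E v p w = E w p v"
proof -
  define q where "q = (\<lambda>s e. p + s *\<^sub>R v + e *\<^sub>R w)"
  have q1: "((\<lambda>s. q s e) has_derivative (\<lambda>h. h *\<^sub>R v)) (at s)" for s e
    unfolding q_def by (auto intro!: derivative_eq_intros)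
  have q2: "((\<lambda>e. q s e) has_derivative (\<lambda>h. h *\<^sub>R w)) (at e)" for s e
    unfolding q_def by (auto intro!: derivative_eq_intros)
  have lin: "linear (D p)" "linear (E v p)" for p v
    using D E has_derivative_linear by blast+
  have 1: "((\<lambda>s. F (q s e)) has_real_derivative D (q s e) v) (at s)" for s e
    using has_derivative_compose[OF q1 D] by (rule has_derivative_imp_has_field_derivative) (simp add: linear_cmul[OF lin(1)])
  have 2: "((\<lambda>e. F (q s e)) has_real_derivative D (q s e) w) (at e)" for s e
    using has_derivative_compose[OF q2 D] by (rule has_derivative_imp_has_field_derivative) (simp add: linear_cmul[OF lin(1)])
  have 21: "((\<lambda>s. D (q s e) w) has_real_derivative E w (q s e) v) (at s)" for s e
    using has_derivative_compose[OF q1 E] by (rule has_derivative_imp_has_field_derivative) (simp add: linear_cmul[OF lin(2)])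
  have 12: "((\<lambda>e. D (q s e) v) has_real_derivative E v (q s e) w) (at e)" for s e
    using has_derivative_compose[OF q2 E] by (rule has_derivative_imp_has_field_derivative) (simp add: linear_cmul[OF lin(2)])
  have qc: "continuous_on A (\<lambda>(s, e). q s e)" for A
    unfolding q_def case_prod_unfold by (auto intro!: continuous_intros)
  have cE: "continuous_on A (\<lambda>(s, e). E u (q s e) u')" for u u' A
    using continuous_on_compose2[OF cont qc] by (simp add: case_prod_unfold)
  have cD: "continuous_on A (\<lambda>e. D (q s e) u)" for u A s
    by (rule continuous_on_compose2[of UNIV "\<lambda>p. D p u" A "\<lambda>e. q s e"])
      (auto intro!: continuous_at_imp_continuous_on has_derivative_continuous[OF E] has_derivative_continuous[OF q2])
  have I: "F (q s e) = F (q s 0) + integral (cbox 0 e) (\<lambda>e. D (q s e) w)" if "0 \<le> e" for s e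
  proof -
    have "((\<lambda>e. D (q s e) w) has_integral (F (q s e) - F (q s 0))) {0..e}"
      by (rule fundamental_theorem_of_calculus[OF that])
        (intro has_field_derivative_at_within[OF 2, THEN has_real_derivative_iff_has_vector_derivative[THEN iffD1]])
    then show ?thesis by (simp add: integral_unique)
  qed
  have J: "D (q 0 e) v = D (q 0 0) v + integral {0..e} (\<lambda>e. E w (q 0 e) v)" if "0 \<le> e" for e
  proof -
    have "((\<lambda>s. integral (cbox 0 e) (\<lambda>e. D (q s e) w)) has_real_derivative
        integral (cbox 0 e) (\<lambda>e. E w (q 0 e) v)) (at 0 within UNIV)"
    proof (rule leibniz_rule_field_derivative)
      show "((\<lambda>s. D (q s t) w) has_real_derivative E w (q s t) v) (at s within UNIV)" for s t
        using 21 by simp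
      show "(\<lambda>e. D (q s e) w) integrable_on cbox 0 e" for s
        by (intro integrable_continuous cD)
    qed (use cE in auto)
    then have "((\<lambda>s. F (q s 0) + integral (cbox 0 e) (\<lambda>e. D (q s e) w)) has_real_derivative
        D (q 0 0) v + integral (cbox 0 e) (\<lambda>e. E w (q 0 e) v)) (at 0)"
      by (intro DERIV_add 1) simp
    then have "((\<lambda>s. F (q s e)) has_real_derivative
        D (q 0 0) v + integral (cbox 0 e) (\<lambda>e. E w (q 0 e) v)) (at 0)"
      using I[OF that] by simp
    from DERIV_unique[OF this 1] show ?thesis by simp
  qed
  \<comment> \<open>Formula \<open>J\<close> holds for \<open>0 \<le> e\<close> only, so the
    derivatives in \<open>e\<close> are compared one-sidedly at the left end of
    \<open>{0..1}\<close>, where they are still unique.\<close>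
  have "continuous_on {0..1} (\<lambda>e. E w (q 0 e) v)"
    by (rule continuous_on_compose2[OF cont, of _ "q 0"])
      (auto intro!: continuous_at_imp_continuous_on has_derivative_continuous[OF q2])
  then have "((\<lambda>e. integral {0..e} (\<lambda>e. E w (q 0 e) v)) has_real_derivative E w (q 0 0) v) (at 0 within {0..1})"
    by (rule integral_has_real_derivative) simp
  then have "((\<lambda>e. D (q 0 0) v + integral {0..e} (\<lambda>e. E w (q 0 e) v)) has_real_derivative E w (q 0 0) v) (at 0 within {0..1})"
    by (rule DERIV_cong[OF DERIV_add[OF DERIV_const]]) simp
  then have "((\<lambda>e. D (q 0 e) v) has_real_derivative E w (q 0 0) v) (at 0 within {0..1})"
    by (rule has_field_derivative_transform_within[where d = 1]) (auto intro: J[symmetric])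
  moreover have "((\<lambda>e. D (q 0 e) v) has_real_derivative E v (q 0 0) w) (at 0 within {0..1})"
    by (rule has_field_derivative_at_within[OF 12])
  ultimately have "E w (q 0 0) v = E v (q 0 0) w"
    by (rule has_field_derivative_unique) (simp add: at_within_Icc_at_right trivial_limit_at_right_real)
  then show ?thesis by (simp add: q_def)
qed

section \<open>Smoothness in charts\<close>

abbreviation Rn :: "nat \<Rightarrow> (nat \<Rightarrow> real) set" where
  "Rn n \<equiv> topspace (Euclidean_space n)"

lemma fun_upd_Rn: "x \<in> Rn n \<Longrightarrow> i < n \<Longrightarrow> x(i := s) \<in> Rn n"
  by (auto simp: topspace_Euclidean_space)

text \<open>Varying a coordinate below \<open>n\<close> does not leave \<open>Rn n\<close>, so
  functions that agree there also have the same partial derivatives there. This permits replacing an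
  expression with \<open>inv_into\<close> by an explicit formula.\<close>

lemma Ck_on_cong:
  assumes "\<And>x. x \<in> Rn n \<Longrightarrow> f x = g x"
  shows "Ck_on n (Rn n) f k \<longleftrightarrow> Ck_on n (Rn n) g k"
  using assms
proof (induction k arbitrary: f g)
  case 0
  then show ?case by (auto cong: continuous_on_cong)
next
  case (Suc k)
  have eq: "(\<lambda>s. f (x(i := s))) = (\<lambda>s. g (x(i := s)))" if "x \<in> Rn n" "i < n" for x i
    using Suc.prems fun_upd_Rn[OF that] by auto
  have "Ck_on n (Rn n) (partial i f) k \<longleftrightarrow> Ck_on n (Rn n) (partial i g) k" if "i < n" for i
    by (rule Suc.IH) (simp add: partial_def eq that)
  moreover have "has_partials n (Rn n) f \<longleftrightarrow> has_partials n (Rn n) g"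
    by (simp add: has_partials_def eq)
  moreover have "continuous_on (Rn n) f \<longleftrightarrow> continuous_on (Rn n) g"
    using Suc.prems by (auto cong: continuous_on_cong)
  ultimately show ?case by auto
qed

lemma smooth_on_cong:
  "(\<And>x. x \<in> Rn n \<Longrightarrow> f x = g x) \<Longrightarrow> smooth_on n (Rn n) f \<longleftrightarrow> smooth_on n (Rn n) g"
  using Ck_on_cong unfolding smooth_on_def by blast

text \<open>The class is closed under partial derivatives and contains the coordinate expressions of
  the product, the inverse and the action of the Heisenberg group. Single coordinates suffice as
  arguments of sine and cosine, because only \<open>t\<close> occurs there.\<close>

inductive trig_poly :: "((nat \<Rightarrow> real) \<Rightarrow> real) \<Rightarrow> bool" where
  const: "trig_poly (\<lambda>u. c)"
| coord: "trig_poly (\<lambda>u. u i)"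
| sin: "trig_poly (\<lambda>u. sin (u i))"
| cos: "trig_poly (\<lambda>u. cos (u i))"
| add: "trig_poly f \<Longrightarrow> trig_poly g \<Longrightarrow> trig_poly (\<lambda>u. f u + g u)"
| mult: "trig_poly f \<Longrightarrow> trig_poly g \<Longrightarrow> trig_poly (\<lambda>u. f u * g u)"

lemma trig_poly_minus: "trig_poly f \<Longrightarrow> trig_poly (\<lambda>u. - f u)"
  using trig_poly.mult[OF trig_poly.const[of "-1"], of f] by simp

lemma trig_poly_diff: "trig_poly f \<Longrightarrow> trig_poly g \<Longrightarrow> trig_poly (\<lambda>u. f u - g u)"
  using trig_poly.add[OF _ trig_poly_minus, of f g] by simp

lemma trig_poly_divide: "trig_poly f \<Longrightarrow> trig_poly (\<lambda>u. f u / c)"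
  using trig_poly.mult[OF _ trig_poly.const[of "1 / c"], of f] by simp

lemmas trig_poly_intros =
  trig_poly.intros trig_poly_minus trig_poly_diff trig_poly_divide

lemma trig_poly_continuous:
  assumes "trig_poly f"
  shows "continuous_on W f"
  using assms
proof induction
  case (coord i)
  show ?case by (rule continuous_on_subset[OF continuous_on_product_coordinates]) simp
next
  case (sin i)
  show ?case
    by (intro continuous_on_sin continuous_on_subset[OF continuous_on_product_coordinates]) simp
next
  case (cos i)
  show ?case
    by (intro continuous_on_cos continuous_on_subset[OF continuous_on_product_coordinates]) simp
qed (auto intro: continuous_intros)

lemma trig_poly_derivative:
  assumes "trig_poly f"
  obtains g where "trig_poly g" "\<And>x. ((\<lambda>s. f (x(i := s))) has_real_derivative g x) (at (x i))"
proof -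
  have "\<exists>g. trig_poly g \<and> (\<forall>x. ((\<lambda>s. f (x(i := s))) has_real_derivative g x) (at (x i)))"
    using assms
  proof induction
    case (const c)
    show ?case by (rule exI[of _ "\<lambda>u. 0"]) (auto intro: trig_poly.intros)
  next
    case (coord j)
    show ?case
      by (rule exI[of _ "\<lambda>u. if j = i then 1 else 0"]) (cases "j = i"; auto intro: trig_poly.intros)
  next
    case (sin j)
    show ?case
    proof (cases "j = i")
      case True
      then show ?thesis
        by (intro exI[of _ "\<lambda>u. cos (u j)"]) (auto intro: trig_poly.intros intro!: derivative_eq_intros)
    next
      case False
      then show ?thesis by (intro exI[of _ "\<lambda>u. 0"]) (auto intro: trig_poly.intros)
    qed
  next
    case (cos j)
    show ?case
    proof (cases "j = i")
      case True
      then show ?thesis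
        by (intro exI[of _ "\<lambda>u. - sin (u j)"])
          (auto intro: trig_poly_intros intro!: derivative_eq_intros)
    next
      case False
      then show ?thesis by (intro exI[of _ "\<lambda>u. 0"]) (auto intro: trig_poly.intros)
    qed
  next
    case (add f g)
    then obtain f' g' where *: "trig_poly f'" "trig_poly g'"
      "\<forall>x. ((\<lambda>s. f (x(i := s))) has_real_derivative f' x) (at (x i))"
      "\<forall>x. ((\<lambda>s. g (x(i := s))) has_real_derivative g' x) (at (x i))" by blast
    have "((\<lambda>s. f (x(i := s)) + g (x(i := s))) has_real_derivative f' x + g' x) (at (x i))" for x
      using *(3,4) by (intro DERIV_add) auto
    with * show ?case
      by (intro exI[of _ "\<lambda>u. f' u + g' u"] conjI trig_poly.add allI)
  next
    case (mult f g)
    then obtain f' g' where *: "trig_poly f'" "trig_poly g'"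
      "\<forall>x. ((\<lambda>s. f (x(i := s))) has_real_derivative f' x) (at (x i))"
      "\<forall>x. ((\<lambda>s. g (x(i := s))) has_real_derivative g' x) (at (x i))" by blast
    have "((\<lambda>s. f (x(i := s)) * g (x(i := s))) has_real_derivative f' x * g x + g' x * f x) (at (x i))" for x
      using DERIV_mult[OF *(3)[rule_format] *(4)[rule_format], of x x] by simp
    with * mult.hyps show ?case
      by (intro exI[of _ "\<lambda>u. f' u * g u + g' u * f u"] conjI trig_poly.add trig_poly.mult allI)
  qed
  then show ?thesis using that by blast
qed

text \<open>\<open>W\<close> can be any set: the partial derivatives are again trigonometric
  polynomials, given by one formula on all sequences.\<close>

lemma trig_poly_Ck_on: "trig_poly f \<Longrightarrow> Ck_on n W f k"
proof (induction k arbitrary: f)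
  case 0
  then show ?case by (simp add: trig_poly_continuous)
next
  case (Suc k)
  have "has_partials n W f"
    unfolding has_partials_def real_differentiable_def
    using trig_poly_derivative[OF Suc.prems] by metis
  moreover have "Ck_on n W (partial i f) k" for i
  proof -
    obtain g where g: "trig_poly g" "\<And>x. ((\<lambda>s. f (x(i := s))) has_real_derivative g x) (at (x i))"
      using trig_poly_derivative[OF Suc.prems] by blast
    have "partial i f = g"
      using g(2) by (auto simp: partial_def fun_eq_iff intro!: DERIV_imp_deriv)
    with Suc.IH[OF g(1)] show ?thesis by simp
  qed
  ultimately show ?case using trig_poly_continuous[OF Suc.prems] by simp
qed

lemma smooth_on_trig_poly:
  assumes "trig_poly g" "\<And>x. x \<in> Rn n \<Longrightarrow> f x = g x"
  shows "smooth_on n (Rn n) f"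
  using smooth_on_cong[of n f g] assms trig_poly_Ck_on unfolding smooth_on_def by blast

section \<open>The global chart of \<open>M\<close> and the comparison of the two notions of
  smoothness\<close>

definition of_coords :: "(nat \<Rightarrow> real) \<Rightarrow> point" where
  "of_coords u = (u 0, u 1, u 2, u 3)"

lemma of_coords_coords [simp]: "of_coords (coords p) = p"
  by (cases p) (simp add: of_coords_def)

lemma less_4: "i < 4 \<longleftrightarrow> i = 0 \<or> i = 1 \<or> i = 2 \<or> i = (3::nat)"
  by auto

lemma sum_less_4: "(\<Sum>i<4. f i) = f 0 + f 1 + f 2 + f (3::nat)"
  by (simp add: eval_nat_numeral)

lemma coords_of_coords: "u \<in> Rn 4 \<Longrightarrow> coords (of_coords u) = u"
  by (auto simp: of_coords_def topspace_Euclidean_space fun_eq_iff)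

lemma coords_in_Rn [simp]: "coords p \<in> Rn 4"
  by (cases p) (auto simp: topspace_Euclidean_space)

lemma range_coords: "range coords = Rn 4"
proof
  show "Rn 4 \<subseteq> range coords"
    by (rule subsetI) (rule range_eqI, erule coords_of_coords[symmetric])
qed (rule image_subsetI, rule coords_in_Rn)

lemma inj_coords: "inj coords"
  by (rule inj_on_inverseI[of _ of_coords]) simp

lemma inv_coords: "u \<in> Rn 4 \<Longrightarrow> inv_into UNIV coords u = of_coords u"
  by (rule inv_into_f_eq[OF inj_coords UNIV_I coords_of_coords])

lemma coords_expand:
  "coords p = (\<lambda>i. if i = 0 then fst p else if i = 1 then fst (snd p) else
    if i = 2 then fst (snd (snd p)) else if i = 3 then snd (snd (snd p)) else 0)"
  by (cases p) (auto simp: fun_eq_iff)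

lemma continuous_on_coords: "continuous_on A coords"
  unfolding coords_expand
proof (rule continuous_on_coordinatewise_then_product)
  fix i :: nat
  show "continuous_on A (\<lambda>p. if i = 0 then fst p else if i = 1 then fst (snd p) else
      if i = 2 then fst (snd (snd p)) else if i = 3 then snd (snd (snd p)) else 0)"
    by (cases "i = 0"; cases "i = 1"; cases "i = 2"; cases "i = 3"; auto intro!: continuous_intros)
qed

lemma continuous_on_of_coords: "continuous_on A of_coords"
  unfolding of_coords_def
  by (intro continuous_on_Pair continuous_on_subset[OF continuous_on_product_coordinates]) auto

definition unit_vec :: "nat \<Rightarrow> point" where
  "unit_vec i = of_coords (\<lambda>j. if j = i then 1 else 0)"

lemma of_coords_upd: "i < 4 \<Longrightarrow> of_coords (u(i := s)) = of_coords u + (s - u i) *\<^sub>R unit_vec i"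
  by (auto simp: less_4 of_coords_def unit_vec_def)

lemma of_coords_upd_derivative:
  assumes "\<And>p. (F has_derivative D p) (at p)" "i < 4"
  shows "((\<lambda>s. F (of_coords (u(i := s)))) has_real_derivative D (of_coords u) (unit_vec i)) (at (u i))"
proof -
  have "((\<lambda>s. of_coords (u(i := s))) has_derivative (\<lambda>h. h *\<^sub>R unit_vec i)) (at (u i))"
    unfolding of_coords_upd[OF assms(2)] by (auto intro!: derivative_eq_intros)
  from has_derivative_compose[OF this assms(1)] show ?thesis
    using linear_cmul[OF has_derivative_linear[OF assms(1)]]
    by (intro has_derivative_imp_has_field_derivative) auto
qed

lemma Cd_imp_Ck_on: "\<forall>k. Cd k F \<Longrightarrow> Ck_on 4 (Rn 4) (\<lambda>u. F (of_coords u)) k"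
proof -
  assume "\<forall>k. Cd k F"
  then have "Cd (Suc k) F" by blast
  then show ?thesis
  proof (induction k arbitrary: F)
    case 0
    then show ?case
      by (auto intro!: continuous_on_compose2[OF Cd_continuous[OF 0] continuous_on_of_coords])
  next
    case (Suc k)
    then obtain D where D: "\<And>p. (F has_derivative D p) (at p)" "\<And>v. Cd (Suc k) (\<lambda>p. D p v)"
      by (metis Cd.simps(2))
    have "continuous_on (Rn 4) (\<lambda>u. F (of_coords u))"
      by (auto intro!: continuous_on_compose2[OF Cd_continuous[OF Suc.prems] continuous_on_of_coords])
    moreover have "has_partials 4 (Rn 4) (\<lambda>u. F (of_coords u))"
      unfolding has_partials_def real_differentiable_def
      using of_coords_upd_derivative[OF D(1)] by blast
    moreover have "Ck_on 4 (Rn 4) (partial i (\<lambda>u. F (of_coords u))) k" if "i < 4" for i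
    proof -
      have "partial i (\<lambda>u. F (of_coords u)) = (\<lambda>u. D (of_coords u) (unit_vec i))"
        using of_coords_upd_derivative[OF D(1) that]
        by (auto simp: partial_def fun_eq_iff intro!: DERIV_imp_deriv)
      with Suc.IH[OF D(2)] show ?thesis by simp
    qed
    ultimately show ?case by simp
  qed
qed

text \<open>The coordinates are added one at a time, from the last to the first: the derivative in
  the later variables is already known, and \<open>has_derivative_real_prod\<close> joins the next
  partial derivative to it.\<close>

lemma has_derivative_of_partials:
  fixes F :: "point \<Rightarrow> real"
  assumes d: "\<And>i u. i < 4 \<Longrightarrow> ((\<lambda>s. F (of_coords (u(i := s)))) has_real_derivative d i (of_coords u)) (at (u i))"
    and c: "\<And>i. i < 4 \<Longrightarrow> continuous_on UNIV (d i)"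
  shows "(F has_derivative (\<lambda>v. \<Sum>i<4. d i p * coords v i)) (at p)"
proof -
  obtain t x y z where p: "p = (t, x, y, z)" by (cases p)
  note D = d[of _ "coords (_, _, _, _)"]
  have 0: "((\<lambda>s. F (s, x, y, z)) has_real_derivative d 0 (t, x, y, z)) (at t)" for t x y z
    using D[of 0 t x y z] by (simp add: of_coords_def)
  have 1: "((\<lambda>s. F (t, s, y, z)) has_real_derivative d 1 (t, x, y, z)) (at x)" for t x y z
    using D[of 1 t x y z] by (simp add: of_coords_def)
  have 2: "((\<lambda>s. F (t, x, s, z)) has_real_derivative d 2 (t, x, y, z)) (at y)" for t x y z
    using D[of 2 t x y z] by (simp add: of_coords_def)
  have 3: "((\<lambda>s. F (t, x, y, s)) has_real_derivative d 3 (t, x, y, z)) (at z)" for t x y z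
    using D[of 3 t x y z] by (simp add: of_coords_def)
  have cc: "continuous_on UNIV (\<lambda>q. d i (f q))" if "i < 4" "continuous_on UNIV f" for i and f :: "'b::topological_space \<Rightarrow> point"
    by (rule continuous_on_compose2[OF c[OF that(1)] that(2)]) simp
  have e1: "((\<lambda>s. F (t, s, q)) has_real_derivative d 1 (t, s, q)) (at s)" for s q
    by (cases q) (simp only: 1)
  have e0: "((\<lambda>s. F (s, q)) has_real_derivative d 0 (s, q)) (at s)" for s q
    by (cases q) (simp only: 0)
  have c2: "continuous_on UNIV (\<lambda>q. d 2 (t, x, q))" and c1: "continuous_on UNIV (\<lambda>q. d 1 (t, q))"
    by (rule cc; simp add: continuous_on_Pair)+
  have d2: "((\<lambda>q. F (t, x, q)) has_derivative (\<lambda>(h, k). d 2 (t, x, y, z) * h + d 3 (t, x, y, z) * k)) (at (y, z))"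
    by (rule has_derivative_real_prod[of "\<lambda>q. F (t, x, q)" "\<lambda>q. d 2 (t, x, q)",
          OF 2 c2 has_field_derivative_imp_has_derivative[OF 3]])
  have d1: "((\<lambda>q. F (t, q)) has_derivative (\<lambda>(h, k). d 1 (t, x, y, z) * h +
      (case k of (h, k) \<Rightarrow> d 2 (t, x, y, z) * h + d 3 (t, x, y, z) * k))) (at (x, y, z))"
    by (rule has_derivative_real_prod[of "\<lambda>q. F (t, q)" "\<lambda>q. d 1 (t, q)", OF e1 c1 d2])
  have "(F has_derivative (\<lambda>(h, k). d 0 (t, x, y, z) * h + (case k of (h, k) \<Rightarrow> d 1 (t, x, y, z) * h +
      (case k of (h, k) \<Rightarrow> d 2 (t, x, y, z) * h + d 3 (t, x, y, z) * k)))) (at (t, x, y, z))"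
    by (rule has_derivative_real_prod[of F "d 0", OF e0 c d1]) simp
  then show ?thesis
    unfolding p by (rule has_derivative_eq_rhs) (simp add: fun_eq_iff sum_less_4)
qed

lemma Ck_on_imp_Cd: "Ck_on 4 (Rn 4) (\<lambda>u. F (of_coords u)) k \<Longrightarrow> Cd k F"
proof (induction k arbitrary: F)
  case 0
  have "continuous_on UNIV (\<lambda>p. F (of_coords (coords p)))"
    by (rule continuous_on_compose2[of "Rn 4" "\<lambda>u. F (of_coords u)"]) (use 0 in \<open>simp_all add: continuous_on_coords image_subset_iff\<close>)
  then show ?case by simp
next
  case (Suc k)
  define d where "d = (\<lambda>i p. partial i (\<lambda>u. F (of_coords u)) (coords p))"
  \<comment> \<open>\<open>of_coords\<close> reads the entries \<open>0\<close> to \<open>3\<close>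
    only, so the partial derivatives are functions of the point, even at sequences outside
    \<open>Rn 4\<close>.\<close>
  have pd: "partial i (\<lambda>u. F (of_coords u)) u = d i (of_coords u)" if "i < 4" for i u
    using that unfolding d_def partial_def
    by (auto simp: less_4 of_coords_def)
  have "Ck_on 4 (Rn 4) (\<lambda>u. d i (of_coords u)) k" if "i < 4" for i
    using Suc.prems that by (simp add: pd[symmetric, OF that])
  then have C: "Cd k (d i)" if "i < 4" for i
    using Suc.IH that by blast
  have D: "((\<lambda>s. F (of_coords (u(i := s)))) has_real_derivative d i (of_coords u)) (at (u i))" if i: "i < 4" for i u
  proof -
    have "coords (of_coords u) \<in> Rn 4" by simp
    with Suc.prems i have "(\<lambda>s. F (of_coords ((coords (of_coords u))(i := s)))) differentiable at (coords (of_coords u) i)"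
      unfolding Ck_on.simps has_partials_def by blast
    moreover have "(\<lambda>s. F (of_coords ((coords (of_coords u))(i := s)))) = (\<lambda>s. F (of_coords (u(i := s))))"
      "coords (of_coords u) i = u i"
      using i by (auto simp: less_4 of_coords_def)
    ultimately have "(\<lambda>s. F (of_coords (u(i := s)))) differentiable at (u i)" by simp
    then show ?thesis
      unfolding pd[OF i, symmetric] partial_def
      by (simp add: DERIV_deriv_iff_real_differentiable)
  qed
  have "(F has_derivative (\<lambda>v. \<Sum>i<4. d i p * coords v i)) (at p)" for p
    by (rule has_derivative_of_partials[OF D]) (use C Cd_continuous in blast)+
  moreover have "Cd k (\<lambda>p. \<Sum>i<4. d i p * coords v i)" for v
    using C by (intro Cd_sum Cd_mult Cd_const) auto
  ultimately show ?case
    unfolding Cd.simps by (intro exI[of _ "\<lambda>p v. \<Sum>i<4. d i p * coords v i"] conjI allI)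
qed

definition smooth :: "('a::real_normed_vector \<Rightarrow> 'b::real_normed_vector) \<Rightarrow> bool" where
  "smooth f \<longleftrightarrow> (\<forall>k. Cd k f)"

lemma Cd_point_iff:
  fixes f :: "'a::real_normed_vector \<Rightarrow> point"
  shows "Cd k f \<longleftrightarrow> (\<forall>j<4. Cd k (\<lambda>p. coords (f p) j))"
proof
  assume f: "Cd k f"
  show "\<forall>j<4. Cd k (\<lambda>p. coords (f p) j)"
    unfolding less_4 by (auto simp: coords_expand intro!: Cd_fst Cd_snd f)
next
  assume *: "\<forall>j<4. Cd k (\<lambda>p. coords (f p) j)"
  have "f = (\<lambda>p. (coords (f p) 0, coords (f p) 1, coords (f p) 2, coords (f p) 3))"
    by (auto simp: coords_expand)
  moreover have "Cd k \<dots>" using * by (intro Cd_Pair) auto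
  ultimately show "Cd k f" by simp
qed

lemma smooth_map_M_iff: "smooth_map euclidean 4 M_atlas euclidean 4 M_atlas f \<longleftrightarrow> smooth f"
proof -
  have "smooth_on 4 (Rn 4) (\<lambda>u. coords (f (inv_into UNIV coords u)) j) \<longleftrightarrow> (\<forall>k. Cd k (\<lambda>p. coords (f p) j))" for j
  proof -
    have "smooth_on 4 (Rn 4) (\<lambda>u. coords (f (inv_into UNIV coords u)) j)
        \<longleftrightarrow> smooth_on 4 (Rn 4) (\<lambda>u. coords (f (of_coords u)) j)"
      by (rule smooth_on_cong) (simp add: inv_coords)
    then show ?thesis
      using Ck_on_imp_Cd[of "\<lambda>p. coords (f p) j"] Cd_imp_Ck_on[of "\<lambda>p. coords (f p) j"]
      unfolding smooth_on_def by blast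
  qed
  then have "smooth_in_charts 4 (UNIV, coords) 4 (UNIV, coords) f \<longleftrightarrow> smooth f"
    unfolding smooth_in_charts_def smooth_def by (auto simp: range_coords Cd_point_iff[of _ f])
  moreover have "continuous_on UNIV f" if "smooth f"
    using that Cd_continuous unfolding smooth_def by blast
  ultimately show ?thesis
    by (auto simp: smooth_map_def M_atlas_def)
qed

lemma diffeo_M_iff: "diffeo_M f \<longleftrightarrow> bij f \<and> smooth f \<and> smooth (inv_into UNIV f)"
  by (simp add: diffeo_M_def smooth_map_M_iff)

section \<open>The group of isometries\<close>

lemma smooth_has_derivative:
  "smooth f \<Longrightarrow> (f has_derivative frechet_derivative f (at p)) (at p)"
proof -
  assume "smooth f"
  then have "Cd (Suc 0) f" unfolding smooth_def by blast
  then show ?thesis by (auto simp: frechet_derivative_works[symmetric] differentiable_def)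
qed

lemma smooth_compose: "smooth (f :: point \<Rightarrow> point) \<Longrightarrow> smooth g \<Longrightarrow> smooth (f \<circ> g)"
  unfolding smooth_def o_def by (blast intro: Cd_compose)

lemma IsometriesI:
  assumes "bij f" "smooth f" "smooth (inv_into UNIV f)" "\<And>p. (f has_derivative D p) (at p)"
    and "\<And>p v w. metric (f p) (D p v) (D p w) = metric p v w"
  shows "f \<in> Isometries"
  using assms frechet_derivative_at[OF assms(4)] by (simp add: Isometries_def diffeo_M_iff)

lemma IsometriesD:
  assumes "f \<in> Isometries"
  shows "bij f" "smooth f" "smooth (inv_into UNIV f)"
    "(f has_derivative frechet_derivative f (at p)) (at p)"
    "metric (f p) (frechet_derivative f (at p) v) (frechet_derivative f (at p) w) = metric p v w"
  using assms smooth_has_derivative unfolding Isometries_def diffeo_M_iff by blast+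

lemma Isometries_id: "id \<in> Isometries"
  by (rule IsometriesI[where D = "\<lambda>p v. v"])
    (auto simp: smooth_def id_def inv_id[unfolded id_def] intro!: Cd_ident bij_id[unfolded id_def])

lemma Isometries_comp:
  assumes f: "f \<in> Isometries" and g: "g \<in> Isometries"
  shows "f \<circ> g \<in> Isometries"
proof (rule IsometriesI)
  show "bij (f \<circ> g)" using f g IsometriesD by (blast intro: bij_comp)
  show "smooth (f \<circ> g)" using f g IsometriesD by (blast intro: smooth_compose)
  show "smooth (inv_into UNIV (f \<circ> g))"
    using f g IsometriesD by (simp add: o_inv_distrib smooth_compose)
  show "(f \<circ> g has_derivative
      (\<lambda>v. frechet_derivative f (at (g p)) (frechet_derivative g (at p) v))) (at p)" for p
    unfolding o_def by (rule has_derivative_compose[OF IsometriesD(4)[OF g] IsometriesD(4)[OF f]])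
qed (simp add: IsometriesD(5)[OF f] IsometriesD(5)[OF g])

lemma Isometries_inv:
  assumes f: "f \<in> Isometries"
  shows "inv_into UNIV f \<in> Isometries"
proof (rule IsometriesI)
  let ?g = "inv_into UNIV f"
  note b = IsometriesD(1)[OF f]
  show "bij ?g" by (rule bij_imp_bij_inv[OF b])
  show "smooth ?g" "smooth (inv_into UNIV ?g)"
    using IsometriesD[OF f] by (simp_all add: inv_inv_eq)
  show g: "(?g has_derivative frechet_derivative ?g (at p)) (at p)" for p
    by (rule smooth_has_derivative[OF IsometriesD(3)[OF f]])
  have fg: "f (?g p) = p" for p
    using b by (simp add: bij_is_surj surj_f_inv_f)
  \<comment> \<open>The chain rule for \<open>f \<circ> ?g = id\<close>; with it the invariance of
    the metric under \<open>f\<close> at \<open>?g p\<close> can be read backwards.\<close>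
  have "frechet_derivative f (at (?g p)) (frechet_derivative ?g (at p) v) = v" for p v
  proof -
    have "((\<lambda>p. f (?g p)) has_derivative
        (\<lambda>v. frechet_derivative f (at (?g p)) (frechet_derivative ?g (at p) v))) (at p)"
      by (rule has_derivative_compose[OF g IsometriesD(4)[OF f]])
    moreover have "((\<lambda>p. f (?g p)) has_derivative (\<lambda>v. v)) (at p)"
      by (simp add: fg)
    ultimately show ?thesis by (metis has_derivative_unique)
  qed
  then show "metric (?g p) (frechet_derivative ?g (at p) v) (frechet_derivative ?g (at p) w) = metric p v w" for p v w
    using IsometriesD(5)[OF f, of "?g p", symmetric] by (simp add: fg)
qed

lemma group_Iso_M: "group Iso_M"
proof (rule groupI)
  fix f assume "f \<in> carrier Iso_M"
  then have f: "f \<in> Isometries" by (simp add: Iso_M_def)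
  then have "inv_into UNIV f \<circ> f = id" using IsometriesD(1) by (simp add: bij_is_inj)
  then show "\<exists>g\<in>carrier Iso_M. g \<otimes>\<^bsub>Iso_M\<^esub> f = \<one>\<^bsub>Iso_M\<^esub>"
    using Isometries_inv[OF f] by (auto simp: Iso_M_def)
qed (auto simp: Iso_M_def Isometries_id Isometries_comp o_assoc)

lemma Iso_M_simps [simp]:
  "carrier Iso_M = Isometries" "f \<otimes>\<^bsub>Iso_M\<^esub> g = f \<circ> g" "\<one>\<^bsub>Iso_M\<^esub> = id"
  by (simp_all add: Iso_M_def)

lemma Iso_M_inv:
  assumes f: "f \<in> Isometries"
  shows "inv\<^bsub>Iso_M\<^esub> f = inv_into UNIV f"
proof -
  have "inv_into UNIV f \<circ> f = id" using IsometriesD(1)[OF f] by (simp add: bij_is_inj)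
  then show ?thesis
    using group.inv_equality[OF group_Iso_M, of "inv_into UNIV f" f] f Isometries_inv[OF f] by simp
qed

section \<open>Geodesics\<close>

text \<open>The derivative of \<open>p \<mapsto> metric p v w\<close> in direction \<open>h\<close>; it does not depend on \<open>p\<close>.\<close>

fun dmetric :: "point \<Rightarrow> point \<Rightarrow> point \<Rightarrow> real" where
  "dmetric (ht, hx, hy, hz) (vt, vx, vy, vz) (wt, wx, wy, wz) =
     vt * (hy * wx - hx * wy) / 2 + (hy * vx - hx * vy) * wt / 2"

lemma metric_expand:
  "metric p v w = fst v * (snd (snd (snd w)) + fst (snd (snd p)) * fst (snd w) / 2
      - fst (snd p) * fst (snd (snd w)) / 2)
    + (snd (snd (snd v)) + fst (snd (snd p)) * fst (snd v) / 2
      - fst (snd p) * fst (snd (snd v)) / 2) * fst w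
    + fst (snd v) * fst (snd w) + fst (snd (snd v)) * fst (snd (snd w))"
  by (cases p; cases v; cases w) simp

lemma dmetric_expand:
  "dmetric h v w = fst v * (fst (snd (snd h)) * fst (snd w) - fst (snd h) * fst (snd (snd w))) / 2
    + (fst (snd (snd h)) * fst (snd v) - fst (snd h) * fst (snd (snd v))) * fst w / 2"
  by (cases h; cases v; cases w) simp

lemma eta_has_derivative:
  fixes x y vx vy vz :: "'a::real_normed_vector \<Rightarrow> real"
  assumes "(x has_derivative x') (at s)" "(y has_derivative y') (at s)"
    "(vx has_derivative vx') (at s)" "(vy has_derivative vy') (at s)" "(vz has_derivative vz') (at s)"
  shows "((\<lambda>s. vz s + y s * vx s / 2 - x s * vy s / 2) has_derivative
    (\<lambda>h. vz' h + (y s * vx' h + y' h * vx s) / 2 - (x s * vy' h + x' h * vy s) / 2)) (at s)"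
  by (intro has_derivative_add has_derivative_diff has_derivative_mult assms
      bounded_linear.has_derivative[OF bounded_linear_divide])

text \<open>The metric is bilinear in the vectors and affine in the base point, hence a product rule
  with three terms, the first of which does not contain \<open>P s\<close> itself.\<close>

lemma metric_has_derivative:
  assumes "(P has_derivative P') (at s)" "(V has_derivative V') (at s)" "(W has_derivative W') (at s)"
  shows "((\<lambda>s. metric (P s) (V s) (W s)) has_derivative
    (\<lambda>h. dmetric (P' h) (V s) (W s) + metric (P s) (V' h) (W s) + metric (P s) (V s) (W' h))) (at s)"
proof -
  note d1 = assms[THEN has_derivative_fst]
  note d2 = assms[THEN has_derivative_snd, THEN has_derivative_fst]
  note d3 = assms[THEN has_derivative_snd, THEN has_derivative_snd, THEN has_derivative_fst]
  note d4 = assms[THEN has_derivative_snd, THEN has_derivative_snd, THEN has_derivative_snd]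
  note eV = eta_has_derivative[OF d2(1) d3(1) d2(2) d3(2) d4(2)]
  note eW = eta_has_derivative[OF d2(1) d3(1) d2(3) d3(3) d4(3)]
  show ?thesis
    unfolding metric_expand dmetric_expand
    by (rule has_derivative_eq_rhs, rule has_derivative_add[OF has_derivative_add[OF has_derivative_add[OF
          has_derivative_mult[OF d1(2) eW] has_derivative_mult[OF eV d1(3)]]
          has_derivative_mult[OF d2(2,3)]] has_derivative_mult[OF d3(2,3)]])
      (rule ext, simp add: algebra_simps add_divide_distrib diff_divide_distrib)
qed

lemma metric_commute: "metric p v w = metric p w v"
  by (simp add: metric_expand)

lemma metric_add_left: "metric p (v + v') w = metric p v w + metric p v' w"
  by (simp add: metric_expand algebra_simps add_divide_distrib)

lemma metric_nondegenerate:
  assumes "\<And>w. metric p v w = 0"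
  shows "v = 0"
  using assms[of "(1, 0, 0, 0)"] assms[of "(0, 1, 0, 0)"] assms[of "(0, 0, 1, 0)"] assms[of "(0, 0, 0, 1)"]
  by (cases v; cases p) (simp add: zero_prod_def)

text \<open>\<open>a + \<Gamma>(v, v)\<close> at \<open>p\<close>, paired with \<open>w\<close>; here \<open>\<Gamma>\<close> is expressed by the Koszul formula.\<close>

definition geodesic_form :: "point \<Rightarrow> point \<Rightarrow> point \<Rightarrow> point \<Rightarrow> real" where
  "geodesic_form p v a w = metric p a w + dmetric v v w - dmetric w v v / 2"

definition geodesic :: "(real \<Rightarrow> point) \<Rightarrow> (real \<Rightarrow> point) \<Rightarrow> (real \<Rightarrow> point) \<Rightarrow> bool" where
  "geodesic c v a \<longleftrightarrow> (\<forall>s. (c has_vector_derivative v s) (at s) \<and>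
     (v has_vector_derivative a s) (at s) \<and> (\<forall>w. geodesic_form (c s) (v s) (a s) w = 0))"

lemma symmetric_second_derivative_vector:
  fixes F :: "'a::real_normed_vector \<Rightarrow> 'b::euclidean_space"
  assumes D: "\<And>p. (F has_derivative D p) (at p)"
    and E: "\<And>v p. ((\<lambda>p. D p v) has_derivative E v p) (at p)"
    and cont: "\<And>v w. continuous_on UNIV (\<lambda>p. E v p w)"
  shows "E v p w = E w p v"
proof (rule euclidean_eqI)
  fix b :: 'b assume "b \<in> Basis"
  show "E v p w \<bullet> b = E w p v \<bullet> b"
    by (rule symmetric_second_derivative[of "\<lambda>p. F p \<bullet> b" "\<lambda>p v. D p v \<bullet> b" "\<lambda>v p w. E v p w \<bullet> b"])
      (intro has_derivative_inner_left D E continuous_intros cont)+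
qed

text \<open>Differentiating the invariance of the metric in all directions and combining the results
  as in Koszul's formula shows that \<open>f\<close> transports \<open>geodesic_form\<close>. The
  covariant acceleration is thereby natural under isometries, without any connection being set
  up.\<close>

lemma isometry_geodesic:
  assumes f: "f \<in> Isometries" and c: "geodesic c v a"
  obtains b where "geodesic (f \<circ> c) (\<lambda>s. frechet_derivative f (at (c s)) (v s)) b"
proof -
  define D where "D = (\<lambda>p. frechet_derivative f (at p))"
  have D: "(f has_derivative D p) (at p)" for p
    unfolding D_def by (rule IsometriesD(4)[OF f])
  have iso: "metric (f p) (D p v) (D p w) = metric p v w" for p v w
    unfolding D_def by (rule IsometriesD(5)[OF f])
  have "Cd (Suc (Suc 0)) f"
    using IsometriesD(2)[OF f] unfolding smooth_def by blast
  then obtain D' where D': "\<And>p. (f has_derivative D' p) (at p)" "\<And>v. Cd (Suc 0) (\<lambda>p. D' p v)"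
    unfolding Cd.simps(2)[of "Suc 0"] by blast
  have "D' p = D p" for p using has_derivative_unique[OF D'(1) D] .
  then have "Cd (Suc 0) (\<lambda>p. D p v)" for v using D'(2) by simp
  then have "\<And>v. \<exists>E. (\<forall>p. ((\<lambda>p. D p v) has_derivative E p) (at p)) \<and> (\<forall>w. continuous_on UNIV (\<lambda>p. E p w))"
    unfolding Cd.simps .
  then obtain E where E: "\<And>v p. ((\<lambda>p. D p v) has_derivative E v p) (at p)"
    and cE: "\<And>v w. continuous_on UNIV (\<lambda>p. E v p w)" by metis
  have sym: "E v p w = E w p v" for v w p
    by (rule symmetric_second_derivative_vector[OF D E cE])
  have koszul: "dmetric (D p h) (D p v) (D p w) + metric (f p) (E v p h) (D p w)
      + metric (f p) (D p v) (E w p h) = dmetric h v w" for p h v w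
  proof -
    have "((\<lambda>p. metric (f p) (D p v) (D p w)) has_derivative
      (\<lambda>h. dmetric (D p h) (D p v) (D p w) + metric (f p) (E v p h) (D p w)
        + metric (f p) (D p v) (E w p h))) (at p)"
      by (rule metric_has_derivative[OF D E E])
    moreover have "((\<lambda>p. metric p v w) has_derivative (\<lambda>h. dmetric h v w)) (at p)"
      using metric_has_derivative[of "\<lambda>p. p" "\<lambda>h. h" p "\<lambda>p. v" "\<lambda>h. 0" "\<lambda>p. w" "\<lambda>h. 0"]
      by (simp add: metric_expand)
    ultimately have "(\<lambda>h. dmetric (D p h) (D p v) (D p w) + metric (f p) (E v p h) (D p w)
        + metric (f p) (D p v) (E w p h)) = (\<lambda>h. dmetric h v w)"
      unfolding iso by (rule has_derivative_unique)
    then show ?thesis by (rule fun_cong)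
  qed
  \<comment> \<open>\<open>koszul\<close> in direction \<open>h\<close> with the vectors
    \<open>h\<close>, \<open>w\<close>, minus half of \<open>koszul\<close> in direction
    \<open>w\<close> with the vectors \<open>h\<close>, \<open>h\<close>: by the symmetry
    \<open>sym\<close> the mixed second derivatives cancel.\<close>
  have main: "geodesic_form (f p) (D p h) (E h p h + D p a) (D p w) = geodesic_form p h a w" for p h a w
  proof -
    have "metric (f p) (D p h) (E w p h) = metric (f p) (E h p w) (D p h)"
      unfolding sym[of w p h] by (rule metric_commute)
    then show ?thesis
      using koszul[of p h h w] koszul[of p w h h] iso[of p a w] metric_commute[of "f p" "E h p w" "D p h"]
      unfolding geodesic_form_def metric_add_left by linarith
  qed
  have linD: "linear (D p)" and linE: "linear (E v p)" for p v
    using D E has_derivative_linear by blast+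
  \<comment> \<open>Nondegeneracy makes \<open>D p\<close> bijective, so every test vector at
    \<open>f p\<close> is of the form \<open>D p w'\<close>, as \<open>main\<close>
    requires.\<close>
  have "inj (D p)" for p
  proof (rule linear_injective_0[OF linD, THEN iffD2], intro allI impI)
    fix v assume "D p v = 0"
    then have "metric p v w = 0" for w
      using iso[of p v w] by (simp add: metric_expand)
    then show "v = 0" by (rule metric_nondegenerate)
  qed
  then have surj: "surj (D p)" for p
    using linear_injective_imp_surjective[OF linD] by blast
  have expD: "D p v = (\<Sum>b\<in>Basis. (v \<bullet> b) *\<^sub>R D p b)" for p v
    using linear_sum[OF linD, of p "\<lambda>b. (v \<bullet> b) *\<^sub>R b" Basis]
    by (simp add: linear_cmul[OF linD] euclidean_representation)
  have expE: "E u p v = (\<Sum>b\<in>Basis. (v \<bullet> b) *\<^sub>R E u p b)" for u p v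
    using linear_sum[OF linE, of u p "\<lambda>b. (v \<bullet> b) *\<^sub>R b" Basis]
    by (simp add: linear_cmul[OF linE] euclidean_representation)
  define b where "b = (\<lambda>s. E (v s) (c s) (v s) + D (c s) (a s))"
  have cv: "(c has_vector_derivative v s) (at s)" and va: "(v has_vector_derivative a s) (at s)"
    and cg: "geodesic_form (c s) (v s) (a s) w = 0" for s w
    using c unfolding geodesic_def by blast+
  have "geodesic (f \<circ> c) (\<lambda>s. D (c s) (v s)) b"
    unfolding geodesic_def
  proof (intro allI conjI)
    fix s w
    show "(f \<circ> c has_vector_derivative D (c s) (v s)) (at s)"
      by (rule vector_derivative_diff_chain_within[OF cv, simplified]) (use D in \<open>blast intro: has_derivative_at_withinI\<close>)
    \<comment> \<open>Along the curve both the base point and the argument of \<open>D\<close> move;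
      expanding in the basis separates the two dependences.\<close>
    have "((\<lambda>s. (v s \<bullet> b) *\<^sub>R D (c s) b) has_vector_derivative
        ((v s \<bullet> b) *\<^sub>R E b (c s) (v s) + (a s \<bullet> b) *\<^sub>R D (c s) b)) (at s)" for b
    proof -
      have 1: "((\<lambda>s. v s \<bullet> b) has_real_derivative (a s \<bullet> b)) (at s)"
        using bounded_linear.has_vector_derivative[OF bounded_linear_inner_left va]
        by (simp add: has_real_derivative_iff_has_vector_derivative)
      have 2: "((\<lambda>s. D (c s) b) has_vector_derivative E b (c s) (v s)) (at s)"
        using vector_derivative_diff_chain_within[OF cv, of "\<lambda>p. D p b" "E b (c s)"] E[of b "c s"]
        by (auto simp: o_def intro: has_derivative_at_withinI)
      show ?thesis by (rule has_vector_derivative_scaleR[OF 1 2])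
    qed
    then have "((\<lambda>s. \<Sum>b\<in>Basis. (v s \<bullet> b) *\<^sub>R D (c s) b) has_vector_derivative
        (\<Sum>b\<in>Basis. (v s \<bullet> b) *\<^sub>R E b (c s) (v s) + (a s \<bullet> b) *\<^sub>R D (c s) b)) (at s)"
      by (intro has_vector_derivative_sum)
    moreover have "(\<Sum>b\<in>Basis. (v s \<bullet> b) *\<^sub>R E b (c s) (v s) + (a s \<bullet> b) *\<^sub>R D (c s) b) = b s"
    proof -
      have "(\<Sum>b\<in>Basis. (v s \<bullet> b) *\<^sub>R E b (c s) (v s)) = E (v s) (c s) (v s)"
        unfolding expE[of "v s" "c s" "v s"] by (intro sum.cong refl arg_cong[of _ _ "(*\<^sub>R) _"] sym)
      then show ?thesis
        unfolding b_def sum.distrib expD[of "c s" "a s"] by simp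
    qed
    ultimately show "((\<lambda>s. D (c s) (v s)) has_vector_derivative b s) (at s)"
      unfolding expD[of "c _" "v _"] by simp
    obtain w' where "w = D (c s) w'" using surj by (metis surjD)
    then show "geodesic_form ((f \<circ> c) s) (D (c s) (v s)) (b s) w = 0"
      using main cg by (simp add: b_def)
  qed
  then show ?thesis using that unfolding D_def by blast
qed

text \<open>In complex notation these are \<open>t'' = 0\<close>, \<open>w'' = i t' w'\<close>, and
  the statement that \<open>eta\<close> of the velocity is constant, solved for \<open>z''\<close>.
  Testing against the four coordinate vectors extracts them.\<close>

lemma geodesic_form_iff:
  "(\<forall>w. geodesic_form (t, x, y, z) (vt, vx, vy, vz) (a0, ax, ay, az) w = 0) \<longleftrightarrow>
     a0 = 0 \<and> ax = - vt * vy \<and> ay = vt * vx \<and> az = vt * (x * vx + y * vy) / 2"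
  (is "?L \<longleftrightarrow> ?R")
proof
  assume ?L
  then have "geodesic_form (t, x, y, z) (vt, vx, vy, vz) (a0, ax, ay, az) w = 0" for w by blast
  from this[of "(1, 0, 0, 0)"] this[of "(0, 1, 0, 0)"] this[of "(0, 0, 1, 0)"] this[of "(0, 0, 0, 1)"]
  have "a0 = 0" and 1: "ax = - vt * vy" "ay = vt * vx" and "az = x * ay / 2 - y * ax / 2"
    by (simp_all add: geodesic_form_def field_simps)
  then show ?R by (simp add: field_simps)
next
  assume ?R
  then show ?L by (auto simp: geodesic_form_def field_simps)
qed

text \<open>The exponential map at the origin. At \<open>\<tau> = 0\<close>, where the exponential map is the identity, the
  formula gives junk values; they are never used, since the image of the rest is already dense.\<close>

fun expo :: "point \<Rightarrow> point" where
  "expo (\<tau>, a, b, \<zeta>) = (\<tau>, (a * sin \<tau> - b * (1 - cos \<tau>)) / \<tau>, (a * (1 - cos \<tau>) + b * sin \<tau>) / \<tau>,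
     \<zeta> + (a\<^sup>2 + b\<^sup>2) * (\<tau> - sin \<tau>) / (2 * \<tau>\<^sup>2))"

lemma DERIV_zero_const: "(\<And>s. (g has_real_derivative 0) (at s)) \<Longrightarrow> g s = g (0::real)"
  using DERIV_isconst_all by blast

text \<open>Conservation laws take the place of a uniqueness theorem. Constant along the geodesic
  are \<open>t'\<close>, \<open>exp(-i \<tau> s) w'\<close>, \<open>\<tau> w + i w'\<close> and
  \<open>eta\<close> of the velocity; the last is the inner product with the coordinate field of
  \<open>t\<close>, which is a Killing field.\<close>

lemma geodesic_from_origin:
  assumes c: "geodesic c v a" and 0: "c 0 = 0" "v 0 = u"
  shows "fst (c 1) = fst u" "fst u \<noteq> 0 \<Longrightarrow> c 1 = expo u"
proof -
  obtain \<tau> \<alpha> \<beta> \<zeta> where u: "u = (\<tau>, \<alpha>, \<beta>, \<zeta>)" by (cases u)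
  define t x y z where tdef: "t = (\<lambda>s. fst (c s))" "x = (\<lambda>s. fst (snd (c s)))"
    "y = (\<lambda>s. fst (snd (snd (c s))))" "z = (\<lambda>s. snd (snd (snd (c s))))"
  define vt vx vy vz where vdef: "vt = (\<lambda>s. fst (v s))" "vx = (\<lambda>s. fst (snd (v s)))"
    "vy = (\<lambda>s. fst (snd (snd (v s))))" "vz = (\<lambda>s. snd (snd (snd (v s))))"
  have comp: "((\<lambda>s. fst (g s)) has_real_derivative fst g') (at s)"
     "((\<lambda>s. fst (snd (g s))) has_real_derivative fst (snd g')) (at s)"
     "((\<lambda>s. fst (snd (snd (g s)))) has_real_derivative fst (snd (snd g'))) (at s)"
     "((\<lambda>s. snd (snd (snd (g s)))) has_real_derivative snd (snd (snd g'))) (at s)"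
    if "(g has_vector_derivative g') (at s)" for g :: "real \<Rightarrow> point" and g' s
    unfolding has_real_derivative_iff_has_vector_derivative
    by (rule bounded_linear.has_vector_derivative[OF _ that]
        bounded_linear_compose[OF bounded_linear_fst] bounded_linear_compose[OF bounded_linear_snd]
        bounded_linear_fst bounded_linear_snd)+
  have cv: "(c has_vector_derivative v s) (at s)" and va: "(v has_vector_derivative a s) (at s)"
    and g: "\<forall>w. geodesic_form (c s) (v s) (a s) w = 0" for s
    using c unfolding geodesic_def by blast+
  have eqs: "fst (a s) = 0 \<and> fst (snd (a s)) = - vt s * vy s \<and> fst (snd (snd (a s))) = vt s * vx s \<and>
      snd (snd (snd (a s))) = vt s * (x s * vx s + y s * vy s) / 2" for s
    using g[of s] geodesic_form_iff[of "t s" "x s" "y s" "z s" "vt s" "vx s" "vy s" "vz s"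
       "fst (a s)" "fst (snd (a s))" "fst (snd (snd (a s)))" "snd (snd (snd (a s)))"]
    by (simp add: tdef vdef)
  have dt: "(t has_real_derivative vt s) (at s)" and dx: "(x has_real_derivative vx s) (at s)"
    and dy: "(y has_real_derivative vy s) (at s)" and dz: "(z has_real_derivative vz s) (at s)"
    and dvt: "(vt has_real_derivative 0) (at s)" and dvx: "(vx has_real_derivative - vt s * vy s) (at s)"
    and dvy: "(vy has_real_derivative vt s * vx s) (at s)"
    and dvz: "(vz has_real_derivative vt s * (x s * vx s + y s * vy s) / 2) (at s)" for s
    using comp[OF cv, of s] comp[OF va, of s] eqs[of s] by (simp_all add: tdef vdef)
  have i: "t 0 = 0" "x 0 = 0" "y 0 = 0" "z 0 = 0" "vt 0 = \<tau>" "vx 0 = \<alpha>" "vy 0 = \<beta>" "vz 0 = \<zeta>"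
    using 0 by (simp_all add: tdef vdef u)
  have vt: "vt s = \<tau>" for s using DERIV_zero_const[OF dvt, of s] i by simp
  have "((\<lambda>s. t s - \<tau> * s) has_real_derivative 0) (at s)" for s
    by (auto intro!: derivative_eq_intros dt simp: vt)
  from DERIV_zero_const[of "\<lambda>s. t s - \<tau> * s", OF this] have t: "t s = \<tau> * s" for s using i by simp
  then show "fst (c 1) = fst u" by (simp add: u tdef)
  have "((\<lambda>s. vx s * cos (\<tau> * s) + vy s * sin (\<tau> * s)) has_real_derivative 0) (at s)" for s
    by (rule derivative_eq_intros dvx dvy refl | simp)+ (simp add: vt algebra_simps)
  from DERIV_zero_const[of "\<lambda>s. vx s * cos (\<tau> * s) + vy s * sin (\<tau> * s)", OF this]
  have p: "vx s * cos (\<tau> * s) + vy s * sin (\<tau> * s) = \<alpha>" for s using i by simp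
  have "((\<lambda>s. vy s * cos (\<tau> * s) - vx s * sin (\<tau> * s)) has_real_derivative 0) (at s)" for s
    by (rule derivative_eq_intros dvx dvy refl | simp)+ (simp add: vt algebra_simps)
  from DERIV_zero_const[of "\<lambda>s. vy s * cos (\<tau> * s) - vx s * sin (\<tau> * s)", OF this]
  have q: "vy s * cos (\<tau> * s) - vx s * sin (\<tau> * s) = \<beta>" for s using i by simp
  have sc: "cos (\<tau> * s) * cos (\<tau> * s) = 1 - sin (\<tau> * s) * sin (\<tau> * s)" for s
    using sin_cos_squared_add[of "\<tau> * s"] by (simp add: power2_eq_square)
  have vx: "vx s = \<alpha> * cos (\<tau> * s) - \<beta> * sin (\<tau> * s)" for s
    unfolding p[of s, symmetric] q[of s, symmetric] by (simp add: algebra_simps sc)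
  have vy: "vy s = \<alpha> * sin (\<tau> * s) + \<beta> * cos (\<tau> * s)" for s
    unfolding p[of s, symmetric] q[of s, symmetric] by (simp add: algebra_simps sc)
  \<comment> \<open>Multiplied by powers of \<open>\<tau>\<close>, the identities need no case
    distinction; \<open>\<tau> \<noteq> 0\<close> enters only when they are solved at the
    end.\<close>
  have "((\<lambda>s. \<tau> * x s - (\<alpha> * sin (\<tau> * s) + \<beta> * cos (\<tau> * s))) has_real_derivative 0) (at s)" for s
    by (rule derivative_eq_intros dx refl | simp)+ (simp add: vx algebra_simps)
  from DERIV_zero_const[of "\<lambda>s. \<tau> * x s - (\<alpha> * sin (\<tau> * s) + \<beta> * cos (\<tau> * s))", OF this]
  have x: "\<tau> * x s = \<alpha> * sin (\<tau> * s) - \<beta> * (1 - cos (\<tau> * s))" for s using i by (simp add: algebra_simps)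
  have "((\<lambda>s. \<tau> * y s - (\<beta> * sin (\<tau> * s) - \<alpha> * cos (\<tau> * s))) has_real_derivative 0) (at s)" for s
    by (rule derivative_eq_intros dy refl | simp)+ (simp add: vy algebra_simps)
  from DERIV_zero_const[of "\<lambda>s. \<tau> * y s - (\<beta> * sin (\<tau> * s) - \<alpha> * cos (\<tau> * s))", OF this]
  have "\<tau> * y s - (\<beta> * sin (\<tau> * s) - \<alpha> * cos (\<tau> * s)) = \<alpha>" for s using i by simp
  then have y: "\<tau> * y s = \<beta> * sin (\<tau> * s) + \<alpha> * (1 - cos (\<tau> * s))" for s
    unfolding right_diff_distrib mult_1_right by (simp add: diff_eq_eq)
  have "((\<lambda>s. vz s + (y s * vx s - x s * vy s) / 2) has_real_derivative 0) (at s)" for s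
  proof -
    have "((\<lambda>s. vz s + (y s * vx s - x s * vy s) / 2) has_real_derivative
       vt s * (x s * vx s + y s * vy s) / 2 + ((vy s * vx s + (- vt s * vy s) * y s)
         - (vx s * vy s + (vt s * vx s) * x s)) / 2) (at s)"
      by (intro DERIV_add DERIV_cdivide DERIV_diff DERIV_mult dx dy dvx dvy dvz)
    then show ?thesis by (rule DERIV_cong) (simp add: field_simps)
  qed
  from DERIV_zero_const[of "\<lambda>s. vz s + (y s * vx s - x s * vy s) / 2", OF this]
  have e: "vz s = \<zeta> + (x s * vy s - y s * vx s) / 2" for s using i by (simp add: field_simps)
  have "\<tau> * (x s * vy s - y s * vx s) = (\<alpha>\<^sup>2 + \<beta>\<^sup>2) * (1 - cos (\<tau> * s))" for s
  proof -
    have "\<tau> * (x s * vy s - y s * vx s) = (\<tau> * x s) * vy s - (\<tau> * y s) * vx s" by (simp add: algebra_simps)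
    also have "\<dots> = (\<alpha>\<^sup>2 + \<beta>\<^sup>2) * (1 - cos (\<tau> * s))"
      unfolding x y vx vy by (simp add: algebra_simps power2_eq_square sc)
    finally show ?thesis .
  qed
  note m = this
  have vz: "2 * \<tau> * vz s = 2 * \<tau> * \<zeta> + (\<alpha>\<^sup>2 + \<beta>\<^sup>2) * (1 - cos (\<tau> * s))" for s
  proof -
    have "2 * \<tau> * vz s = 2 * \<tau> * \<zeta> + \<tau> * (x s * vy s - y s * vx s)"
      unfolding e by (simp add: distrib_left)
    then show ?thesis using m[of s] by simp
  qed
  have "((\<lambda>s. 2 * \<tau>\<^sup>2 * z s - (2 * \<tau>\<^sup>2 * \<zeta> * s + (\<alpha>\<^sup>2 + \<beta>\<^sup>2) * (\<tau> * s - sin (\<tau> * s)))) has_real_derivative 0) (at s)" for s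
  proof -
    have "((\<lambda>s. 2 * \<tau>\<^sup>2 * z s - (2 * \<tau>\<^sup>2 * \<zeta> * s + (\<alpha>\<^sup>2 + \<beta>\<^sup>2) * (\<tau> * s - sin (\<tau> * s)))) has_real_derivative
        \<tau> * (2 * \<tau> * vz s) - (2 * \<tau>\<^sup>2 * \<zeta> + (\<alpha>\<^sup>2 + \<beta>\<^sup>2) * (\<tau> - \<tau> * cos (\<tau> * s)))) (at s)"
      by (rule derivative_eq_intros dz refl | simp)+ (simp add: power2_eq_square algebra_simps)
    then show ?thesis unfolding vz by (simp add: power2_eq_square algebra_simps)
  qed
  from DERIV_zero_const[of "\<lambda>s. 2 * \<tau>\<^sup>2 * z s - (2 * \<tau>\<^sup>2 * \<zeta> * s + (\<alpha>\<^sup>2 + \<beta>\<^sup>2) * (\<tau> * s - sin (\<tau> * s)))", OF this]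
  have z: "2 * \<tau>\<^sup>2 * z 1 = 2 * \<tau>\<^sup>2 * \<zeta> + (\<alpha>\<^sup>2 + \<beta>\<^sup>2) * (\<tau> - sin \<tau>)" using i by simp
  show "c 1 = expo u" if "fst u \<noteq> 0"
  proof -
    have n: "\<tau> \<noteq> 0" using that u by simp
    have "c 1 = (t 1, x 1, y 1, z 1)" by (simp add: tdef)
    then show ?thesis
      using n t[of 1] x[of 1] y[of 1] z by (simp add: u nonzero_eq_divide_eq) (simp add: field_simps)
  qed
qed

text \<open>The formulas obtained from the conservation laws, taken at time \<open>s\<close> instead
  of \<open>1\<close>, are checked to solve the equations. With the preceding lemma this identifies
  \<open>expo\<close> as the exponential map wherever the first component is nonzero.\<close>

lemma geodesic_exists:
  assumes "fst u \<noteq> 0"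
  obtains c v a where "geodesic c v a" "c 0 = 0" "v 0 = u" "c 1 = expo u"
proof -
  obtain \<tau> \<alpha> \<beta> \<zeta> where u: "u = (\<tau>, \<alpha>, \<beta>, \<zeta>)" by (cases u)
  have n: "\<tau> \<noteq> 0" using assms u by simp
  define x where "x = (\<lambda>s. (\<alpha> * sin (\<tau> * s) - \<beta> * (1 - cos (\<tau> * s))) / \<tau>)"
  define y where "y = (\<lambda>s. (\<alpha> * (1 - cos (\<tau> * s)) + \<beta> * sin (\<tau> * s)) / \<tau>)"
  define z where "z = (\<lambda>s. \<zeta> * s + (\<alpha>\<^sup>2 + \<beta>\<^sup>2) * (\<tau> * s - sin (\<tau> * s)) / (2 * \<tau>\<^sup>2))"
  define vx where "vx = (\<lambda>s. \<alpha> * cos (\<tau> * s) - \<beta> * sin (\<tau> * s))"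
  define vy where "vy = (\<lambda>s. \<alpha> * sin (\<tau> * s) + \<beta> * cos (\<tau> * s))"
  define vz where "vz = (\<lambda>s. \<zeta> + (\<alpha>\<^sup>2 + \<beta>\<^sup>2) * (1 - cos (\<tau> * s)) / (2 * \<tau>))"
  have d: "(x has_real_derivative vx s) (at s)" "(y has_real_derivative vy s) (at s)"
    "(z has_real_derivative vz s) (at s)" "(vx has_real_derivative - \<tau> * vy s) (at s)"
    "(vy has_real_derivative \<tau> * vx s) (at s)"
    "(vz has_real_derivative (\<alpha>\<^sup>2 + \<beta>\<^sup>2) * sin (\<tau> * s) / 2) (at s)" for s
    unfolding x_def y_def z_def vx_def vy_def vz_def
    using n by (auto intro!: derivative_eq_intros simp: field_simps power2_eq_square)
  have pair: "((\<lambda>s. (g1 s, g2 s, g3 s, g4 s)) has_vector_derivative (h1, h2, h3, h4)) (at s)"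
    if "(g1 has_real_derivative h1) (at s)" "(g2 has_real_derivative h2) (at s)"
      "(g3 has_real_derivative h3) (at s)" "(g4 has_real_derivative h4) (at s)"
    for g1 g2 g3 g4 :: "real \<Rightarrow> real" and h1 h2 h3 h4 s
    using that unfolding has_real_derivative_iff_has_vector_derivative
    by (intro has_vector_derivative_Pair)
  have "(\<alpha>\<^sup>2 + \<beta>\<^sup>2) * sin (\<tau> * s) / 2 = \<tau> * (x s * vx s + y s * vy s) / 2" for s
  proof -
    have "\<tau> * (x s * vx s + y s * vy s) = (\<tau> * x s) * vx s + (\<tau> * y s) * vy s" by (simp add: algebra_simps)
    also have "\<dots> = (\<alpha> * sin (\<tau> * s) - \<beta> * (1 - cos (\<tau> * s))) * (\<alpha> * cos (\<tau> * s) - \<beta> * sin (\<tau> * s))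
        + (\<alpha> * (1 - cos (\<tau> * s)) + \<beta> * sin (\<tau> * s)) * (\<alpha> * sin (\<tau> * s) + \<beta> * cos (\<tau> * s))"
      using n by (simp add: x_def y_def vx_def vy_def)
    also have "\<dots> = (\<alpha>\<^sup>2 + \<beta>\<^sup>2) * sin (\<tau> * s)"
      by (simp add: algebra_simps power2_eq_square)
    finally show ?thesis by simp
  qed
  then have "\<forall>w. geodesic_form (\<tau> * s, x s, y s, z s) (\<tau>, vx s, vy s, vz s)
      (0, - \<tau> * vy s, \<tau> * vx s, (\<alpha>\<^sup>2 + \<beta>\<^sup>2) * sin (\<tau> * s) / 2) w = 0" for s
    unfolding geodesic_form_iff by simp
  moreover have "((\<lambda>s. \<tau> * s) has_real_derivative \<tau>) (at s)" "((\<lambda>s. \<tau>) has_real_derivative 0) (at s)" for s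
    by (auto intro!: derivative_eq_intros)
  ultimately have "geodesic (\<lambda>s. (\<tau> * s, x s, y s, z s)) (\<lambda>s. (\<tau>, vx s, vy s, vz s))
      (\<lambda>s. (0, - \<tau> * vy s, \<tau> * vx s, (\<alpha>\<^sup>2 + \<beta>\<^sup>2) * sin (\<tau> * s) / 2))"
    unfolding geodesic_def using d by (intro allI conjI pair) blast+
  then show ?thesis
    by (rule that) (simp_all add: x_def y_def z_def vx_def vy_def vz_def u zero_prod_def)
qed

text \<open>\<open>f\<close> sends the geodesic with initial velocity \<open>u\<close> to the one
  with initial velocity \<open>A u\<close>. The equation for first components carries no condition
  on \<open>fst (A u)\<close>: it is the tool for finding out where \<open>fst (A u)\<close>
  vanishes.\<close>

lemma isometry_expo:
  assumes f: "f \<in> Isometries" "f 0 = 0" "(f has_derivative A) (at 0)" and u: "fst u \<noteq> 0"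
  shows "fst (f (expo u)) = fst (A u)" "fst (A u) \<noteq> 0 \<Longrightarrow> f (expo u) = expo (A u)"
proof -
  obtain c v a where c: "geodesic c v a" "c 0 = 0" "v 0 = u" "c 1 = expo u"
    using geodesic_exists[OF u] .
  obtain b where b: "geodesic (f \<circ> c) (\<lambda>s. frechet_derivative f (at (c s)) (v s)) b"
    using isometry_geodesic[OF f(1) c(1)] .
  have "frechet_derivative f (at (c 0)) (v 0) = A u"
    using frechet_derivative_at[OF f(3)] c by simp
  from geodesic_from_origin[OF b _ this]
  show "fst (f (expo u)) = fst (A u)" "fst (A u) \<noteq> 0 \<Longrightarrow> f (expo u) = expo (A u)"
    using f(2) c by simp_all
qed

section \<open>Explicit isometries\<close>

text \<open>With \<open>w = x + i y\<close>, \<open>\<alpha> = a + i b\<close> and \<open>\<beta> = c + i d\<close>, \<open>heis a b c d k\<close> is the isometry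
  \<open>(t, w, z) \<mapsto> (t, w + \<alpha> + \<beta> exp(i t), z + k + Im (cnj \<alpha> w - cnj \<beta> exp(-i t) w + cnj \<alpha> \<beta> exp(i t)) / 2)\<close>.
  Its parameters are those of the solutions of the geodesic equation \<open>w'' = i w'\<close>.\<close>

definition osc1 :: "real \<Rightarrow> real \<Rightarrow> real \<Rightarrow> real" where
  "osc1 c d t = c * cos t - d * sin t"

definition osc2 :: "real \<Rightarrow> real \<Rightarrow> real \<Rightarrow> real" where
  "osc2 c d t = c * sin t + d * cos t"

fun heis :: "real \<Rightarrow> real \<Rightarrow> real \<Rightarrow> real \<Rightarrow> real \<Rightarrow> point \<Rightarrow> point" where
  "heis a b c d k (t, x, y, z) = (t, x + a + osc1 c d t, y + b + osc2 c d t,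
     z + k + (a * y - b * x) / 2 - (osc1 c d t * y - osc2 c d t * x) / 2
       + (a * osc2 c d t - b * osc1 c d t) / 2)"

fun rot :: "real \<Rightarrow> real \<Rightarrow> point \<Rightarrow> point" where
  "rot s \<theta> (t, x, y, z) = (t + s, x * cos \<theta> - y * sin \<theta>, x * sin \<theta> + y * cos \<theta>, z)"

text \<open>In complex notation \<open>(t, w, z) \<mapsto> (- t, cnj w, - z)\<close>. Conjugation
  reverses \<open>y dx - x dy\<close>, so both factors of \<open>dt * eta\<close> change
  sign.\<close>

fun neg_t :: "point \<Rightarrow> point" where
  "neg_t (t, x, y, z) = (- t, x, - y, - z)"

text \<open>This is \<open>w \<mapsto> exp(i t) cnj w\<close>. Conjugation alone would turn
  \<open>w'' = i w'\<close> into \<open>w'' = - i w'\<close>; the factor \<open>exp(i t)\<close>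
  repairs this.\<close>

fun refl_w :: "point \<Rightarrow> point" where
  "refl_w (t, x, y, z) = (t, x * cos t + y * sin t, x * sin t - y * cos t, z)"

lemma IsometriesI_inverse:
  assumes "f \<circ> g = id" "g \<circ> f = id" "smooth f" "smooth g" "\<And>p. (f has_derivative D p) (at p)"
    and "\<And>p v w. metric (f p) (D p v) (D p w) = metric p v w"
  shows "f \<in> Isometries"
proof (rule IsometriesI[OF _ assms(3) _ assms(5,6)])
  show "bij f" using o_bij assms(1,2) by blast
  show "smooth (inv_into UNIV f)" using inv_unique_comp[OF assms(1,2)] assms(4) by simp
qed

lemma cos_square: "cos t * cos t = 1 - sin t * sin (t::real)"
  using sin_cos_squared_add[of t] by (simp add: power2_eq_square)

lemma osc_add:
  "osc1 (c + c') (d + d') t = osc1 c d t + osc1 c' d' t"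
  "osc2 (c + c') (d + d') t = osc2 c d t + osc2 c' d' t"
  by (simp_all add: osc1_def osc2_def algebra_simps)

text \<open>Multiplication by \<open>exp(i t)\<close> preserves area. For this reason the shift of
  \<open>z\<close> in a product of two \<open>heis\<close> maps is independent of \<open>t\<close>,
  and the family is closed under composition.\<close>

lemma osc_symplectic:
  "osc1 c d t * osc2 c' d' t - osc2 c d t * osc1 c' d' t = c * d' - d * c'"
  by (simp add: osc1_def osc2_def algebra_simps cos_square)

lemma heis_heis:
  "heis a b c d k (heis a' b' c' d' k' p) =
    heis (a + a') (b + b') (c + c') (d + d')
      (k + k' + (a * b' - b * a') / 2 - (c * d' - d * c') / 2) p"
proof (cases p)
  case (fields t x y z)
  show ?thesis
    unfolding fields heis.simps osc_add osc_symplectic[of c d t c' d', symmetric]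
    by (simp add: field_simps)
qed

lemma heis_comp:
  "heis a b c d k \<circ> heis a' b' c' d' k' =
    heis (a + a') (b + b') (c + c') (d + d') (k + k' + (a * b' - b * a') / 2 - (c * d' - d * c') / 2)"
  by (rule ext) (simp only: o_apply heis_heis)

lemma heis_zero: "heis 0 0 0 0 0 = id"
  by (rule ext) (auto simp: osc1_def osc2_def)

lemma heis_inverse: "heis a b c d k \<circ> heis (- a) (- b) (- c) (- d) (- k) = id"
  "heis (- a) (- b) (- c) (- d) (- k) \<circ> heis a b c d k = id"
  unfolding heis_comp by (simp_all add: heis_zero)

lemma heis_inject:
  assumes "heis a b c d k = heis a' b' c' d' k'"
  shows "a = a' \<and> b = b' \<and> c = c' \<and> d = d' \<and> k = k'"
proof -
  \<comment> \<open>At \<open>t = 0\<close> and \<open>t = pi\<close> the point \<open>w = 0\<close>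
    is moved by \<open>\<alpha> + \<beta>\<close> and by \<open>\<alpha> - \<beta>\<close>, which
    determines both parameters; \<open>k\<close> is then read off from the
    \<open>z\<close>-component at \<open>t = 0\<close>.\<close>
  have "heis a b c d k (0, 0, 0, 0) = heis a' b' c' d' k' (0, 0, 0, 0)"
    "heis a b c d k (pi, 0, 0, 0) = heis a' b' c' d' k' (pi, 0, 0, 0)"
    using assms by simp_all
  then have *: "a + c = a' + c'" "b + d = b' + d'" "a - c = a' - c'" "b - d = b' - d'"
    and k: "k + (a * d - b * c) / 2 = k' + (a' * d' - b' * c') / 2"
    by (simp_all add: osc1_def osc2_def)
  from * have "a = a'" "b = b'" "c = c'" "d = d'" by simp_all
  with k show ?thesis by simp
qed

lemma rot_rot: "rot s \<theta> (rot s' \<theta>' p) = rot (s + s') (\<theta> + \<theta>') p"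
  by (cases p) (simp add: cos_add sin_add algebra_simps)

lemma rot_zero: "rot 0 0 = id"
  by (rule ext) auto

lemma rot_inverse: "rot s \<theta> \<circ> rot (- s) (- \<theta>) = id" "rot (- s) (- \<theta>) \<circ> rot s \<theta> = id"
  by (simp_all add: fun_eq_iff rot_rot rot_zero del: rot.simps)

lemma neg_t_inverse: "neg_t \<circ> neg_t = id"
  by (rule ext) auto

lemma refl_w_inverse: "refl_w \<circ> refl_w = id"
proof
  fix p
  show "(refl_w \<circ> refl_w) p = id p"
    by (cases p) (simp add: algebra_simps cos_square)
qed

section \<open>Smoothness, derivatives and metric invariance of the explicit maps\<close>

lemma heis_expand:
  "heis a b c d k = (\<lambda>p. (fst p, fst (snd p) + a + (c * cos (fst p) - d * sin (fst p)),
     fst (snd (snd p)) + b + (c * sin (fst p) + d * cos (fst p)),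
     snd (snd (snd p)) + k + (a * fst (snd (snd p)) - b * fst (snd p)) * (1 / 2)
       - ((c * cos (fst p) - d * sin (fst p)) * fst (snd (snd p))
          - (c * sin (fst p) + d * cos (fst p)) * fst (snd p)) * (1 / 2)
       + (a * (c * sin (fst p) + d * cos (fst p)) - b * (c * cos (fst p) - d * sin (fst p))) * (1 / 2)))"
  by (rule ext) (auto simp: osc1_def osc2_def)

lemma rot_expand:
  "rot s \<theta> = (\<lambda>p. (fst p + s, fst (snd p) * cos \<theta> - fst (snd (snd p)) * sin \<theta>,
     fst (snd p) * sin \<theta> + fst (snd (snd p)) * cos \<theta>, snd (snd (snd p))))"
  by (rule ext) auto

lemma neg_t_expand:
  "neg_t = (\<lambda>p. (- fst p, fst (snd p), - fst (snd (snd p)), - snd (snd (snd p))))"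
  by (rule ext) auto

lemma refl_w_expand:
  "refl_w = (\<lambda>p. (fst p, fst (snd p) * cos (fst p) + fst (snd (snd p)) * sin (fst p),
     fst (snd p) * sin (fst p) - fst (snd (snd p)) * cos (fst p), snd (snd (snd p))))"
  by (rule ext) auto

lemmas Cd_intros = Cd_const Cd_ident Cd_fst Cd_snd Cd_Pair Cd_add Cd_diff Cd_minus Cd_mult Cd_sin Cd_cos

lemma smooth_explicit:
  "smooth (heis a b c d k)" "smooth (rot s \<theta>)" "smooth neg_t" "smooth refl_w"
  unfolding smooth_def heis_expand rot_expand neg_t_expand refl_w_expand
  by (intro allI Cd_intros)+

fun heis_deriv :: "real \<Rightarrow> real \<Rightarrow> real \<Rightarrow> real \<Rightarrow> point \<Rightarrow> point \<Rightarrow> point" where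
  "heis_deriv a b c d (t, x, y, z) (vt, vx, vy, vz) =
    (vt, vx - osc2 c d t * vt, vy + osc1 c d t * vt,
     vz + (a * vy - b * vx) / 2
       - (osc1 c d t * vy - osc2 c d t * vt * y - osc2 c d t * vx - osc1 c d t * vt * x) / 2
       + (a * osc1 c d t + b * osc2 c d t) * vt / 2)"

lemma heis_has_derivative: "(heis a b c d k has_derivative heis_deriv a b c d p) (at p)"
  unfolding heis_expand
  by (cases p) (auto intro!: derivative_eq_intros simp: osc1_def osc2_def field_simps)

fun refl_w_deriv :: "point \<Rightarrow> point \<Rightarrow> point" where
  "refl_w_deriv (t, x, y, z) (vt, vx, vy, vz) =
    (vt, vx * cos t + vy * sin t - (x * sin t - y * cos t) * vt,
     vx * sin t - vy * cos t + (x * cos t + y * sin t) * vt, vz)"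

lemma refl_w_has_derivative: "(refl_w has_derivative refl_w_deriv p) (at p)"
  unfolding refl_w_expand
  by (cases p) (auto intro!: derivative_eq_intros simp: field_simps)

lemma rot_has_derivative: "(rot s \<theta> has_derivative rot 0 \<theta>) (at p)"
  unfolding rot_expand by (auto intro!: derivative_eq_intros simp: field_simps)

lemma neg_t_has_derivative: "(neg_t has_derivative neg_t) (at p)"
  unfolding neg_t_expand by (auto intro!: derivative_eq_intros)

lemma heis_Isometries [simp]: "heis a b c d k \<in> Isometries"
proof (rule IsometriesI_inverse[OF heis_inverse smooth_explicit(1) smooth_explicit(1) heis_has_derivative])
  fix p v w :: point
  obtain t x y z where p: "p = (t, x, y, z)" by (cases p)
  obtain vt vx vy vz where v: "v = (vt, vx, vy, vz)" by (cases v)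
  obtain wt wx wy wz where w: "w = (wt, wx, wy, wz)" by (cases w)
  show "metric (heis a b c d k p) (heis_deriv a b c d p v) (heis_deriv a b c d p w) = metric p v w"
    unfolding p v w heis.simps heis_deriv.simps metric.simps eta.simps
    by (simp add: field_simps)
qed

lemma rot_Isometries [simp]: "rot s \<theta> \<in> Isometries"
proof (rule IsometriesI_inverse[OF rot_inverse smooth_explicit(2) smooth_explicit(2) rot_has_derivative])
  fix p v w :: point
  obtain t x y z where p: "p = (t, x, y, z)" by (cases p)
  obtain vt vx vy vz where v: "v = (vt, vx, vy, vz)" by (cases v)
  obtain wt wx wy wz where w: "w = (wt, wx, wy, wz)" by (cases w)
  \<comment> \<open>Rotations preserve the inner product and the area form. Abstract
    \<open>C\<close> and \<open>S\<close> turn this into polynomial identities.\<close>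
  have r: "(x * C - y * S) * (x' * C - y' * S) + (x * S + y * C) * (x' * S + y' * C) = x * x' + y * y'"
    "(x * S + y * C) * (x' * C - y' * S) - (x * C - y * S) * (x' * S + y' * C) = y * x' - x * y'"
    if "C * C = 1 - S * S" for x x' y y' C S :: real
    using that by (algebra, algebra)
  note r = r[OF cos_square[of \<theta>]]
  have "metric (rot s \<theta> p) (rot 0 \<theta> v) (rot 0 \<theta> w) =
      vt * (wz + (((x * sin \<theta> + y * cos \<theta>) * (wx * cos \<theta> - wy * sin \<theta>)
        - (x * cos \<theta> - y * sin \<theta>) * (wx * sin \<theta> + wy * cos \<theta>)) / 2))
      + (vz + (((x * sin \<theta> + y * cos \<theta>) * (vx * cos \<theta> - vy * sin \<theta>)
        - (x * cos \<theta> - y * sin \<theta>) * (vx * sin \<theta> + vy * cos \<theta>)) / 2)) * wt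
      + ((vx * cos \<theta> - vy * sin \<theta>) * (wx * cos \<theta> - wy * sin \<theta>)
        + (vx * sin \<theta> + vy * cos \<theta>) * (wx * sin \<theta> + wy * cos \<theta>))"
    by (simp add: p v w diff_divide_distrib add_diff_eq)
  also have "\<dots> = metric p v w"
    unfolding r by (simp add: p v w field_simps)
  finally show "metric (rot s \<theta> p) (rot 0 \<theta> v) (rot 0 \<theta> w) = metric p v w" .
qed

lemma neg_t_Isometries [simp]: "neg_t \<in> Isometries"
proof (rule IsometriesI_inverse[OF neg_t_inverse neg_t_inverse smooth_explicit(3) smooth_explicit(3) neg_t_has_derivative])
  show "metric (neg_t p) (neg_t v) (neg_t w) = metric p v w" for p v w
    by (cases p; cases v; cases w) (simp add: algebra_simps)
qed

lemma refl_w_Isometries [simp]: "refl_w \<in> Isometries"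
proof (rule IsometriesI_inverse[OF refl_w_inverse refl_w_inverse smooth_explicit(4) smooth_explicit(4) refl_w_has_derivative])
  fix p v w :: point
  obtain t x y z where p: "p = (t, x, y, z)" by (cases p)
  obtain vt vx vy vz where v: "v = (vt, vx, vy, vz)" by (cases v)
  obtain wt wx wy wz where w: "w = (wt, wx, wy, wz)" by (cases w)
  define S C where "S = sin t" and "C = cos t"
  have SC: "C * C + S * S = 1" by (simp add: S_def C_def flip: power2_eq_square)
  have "2 * metric (refl_w p) (refl_w_deriv p v) (refl_w_deriv p w) = 2 * metric p v w"
    unfolding p v w refl_w.simps refl_w_deriv.simps metric.simps eta.simps S_def[symmetric] C_def[symmetric]
    by (simp add: field_simps) (use SC in algebra)
  then show "metric (refl_w p) (refl_w_deriv p v) (refl_w_deriv p w) = metric p v w" by simp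
qed

section \<open>Left translations, and commutation rules with the Heisenberg maps\<close>

lemma nmult_eq: "nmult n = heis (fst (snd n)) (fst (snd (snd n))) 0 0 (snd (snd (snd n))) \<circ> rot (fst n) 0"
  by (rule ext, cases n) (auto simp: osc1_def osc2_def)

lemma nmult_Isometries [simp]: "nmult n \<in> Isometries"
  unfolding nmult_eq by (intro Isometries_comp) simp_all

text \<open>The oscillating part must be rewritten in the shifted time: \<open>exp(i \<theta>)
  \<beta> exp(i t) = exp(i (\<theta> - s)) \<beta> exp(i (t + s))\<close>. Hence
  \<open>\<alpha>\<close> turns by \<open>\<theta>\<close>, but \<open>\<beta>\<close> by
  \<open>\<theta> - s\<close>.\<close>

lemma rot_heis:
  "rot s \<theta> \<circ> heis a b c d k =
    heis (a * cos \<theta> - b * sin \<theta>) (a * sin \<theta> + b * cos \<theta>)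
      (osc1 c d (\<theta> - s)) (osc2 c d (\<theta> - s)) k \<circ> rot s \<theta>"
proof
  fix p :: point
  obtain t x y z where p: "p = (t, x, y, z)" by (cases p)
  have o: "osc1 (osc1 c d (\<theta> - s)) (osc2 c d (\<theta> - s)) (t + s) = osc1 c d t * cos \<theta> - osc2 c d t * sin \<theta>"
    "osc2 (osc1 c d (\<theta> - s)) (osc2 c d (\<theta> - s)) (t + s) = osc1 c d t * sin \<theta> + osc2 c d t * cos \<theta>"
  proof -
    have "osc1 (osc1 c d u) (osc2 c d u) v = osc1 c d (u + v)" "osc2 (osc1 c d u) (osc2 c d u) v = osc2 c d (u + v)" for u v
      by (simp_all add: osc1_def osc2_def cos_add sin_add algebra_simps)
    moreover have "osc1 c d (t + \<theta>) = osc1 c d t * cos \<theta> - osc2 c d t * sin \<theta>"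
      "osc2 c d (t + \<theta>) = osc1 c d t * sin \<theta> + osc2 c d t * cos \<theta>"
      by (simp_all add: osc1_def osc2_def cos_add sin_add algebra_simps)
    moreover have "\<theta> - s + (t + s) = t + \<theta>" by simp
    ultimately show "osc1 (osc1 c d (\<theta> - s)) (osc2 c d (\<theta> - s)) (t + s) = osc1 c d t * cos \<theta> - osc2 c d t * sin \<theta>"
      "osc2 (osc1 c d (\<theta> - s)) (osc2 c d (\<theta> - s)) (t + s) = osc1 c d t * sin \<theta> + osc2 c d t * cos \<theta>"
      by metis+
  qed
  have r: "(x * C - y * S) * (x' * S + y' * C) - (x * S + y * C) * (x' * C - y' * S) = x * y' - y * x'"
    if "C * C = 1 - S * S" for x x' y y' C S :: real
    using that by algebra
  note r = r[OF cos_square[of \<theta>]]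
  show "(rot s \<theta> \<circ> heis a b c d k) p = (heis (a * cos \<theta> - b * sin \<theta>) (a * sin \<theta> + b * cos \<theta>)
      (osc1 c d (\<theta> - s)) (osc2 c d (\<theta> - s)) k \<circ> rot s \<theta>) p"
    unfolding p o_apply rot.simps heis.simps o r by (simp add: algebra_simps)
qed

lemma neg_t_heis: "neg_t \<circ> heis a b c d k = heis a (- b) c (- d) (- k) \<circ> neg_t"
  by (rule ext) (auto simp: osc1_def osc2_def field_simps)

text \<open>Since \<open>exp(i t) cnj (w + \<alpha> + \<beta> exp(i t)) = exp(i t) cnj w + cnj
  \<beta> + cnj \<alpha> exp(i t)\<close>, the constant and the oscillating solutions change
  places.\<close>

lemma refl_w_heis: "refl_w \<circ> heis a b c d k = heis c (- d) a (- b) k \<circ> refl_w"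
proof
  fix p :: point
  obtain t x y z where p: "p = (t, x, y, z)" by (cases p)
  define S C where "S = sin t" and "C = cos t"
  have SC: "C * C + S * S = 1" by (simp add: S_def C_def flip: power2_eq_square)
  show "(refl_w \<circ> heis a b c d k) p = (heis c (- d) a (- b) k \<circ> refl_w) p"
    unfolding p o_apply refl_w.simps heis.simps osc1_def osc2_def S_def[symmetric] C_def[symmetric]
    using SC by (simp add: field_simps) (intro conjI; algebra)
qed

section \<open>Classification of the isometries\<close>

lemma origin: "(0, 0, 0, 0) = (0 :: point)"
  by (simp add: zero_prod_def)

lemma expo_two_pi: "expo (2 * pi, a, b, \<zeta>) = (2 * pi, 0, 0, \<zeta> + (a\<^sup>2 + b\<^sup>2) / (4 * pi))"
  by (simp add: power2_eq_square field_simps)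

lemma expo_surj:
  assumes "cos t \<noteq> 1"
  shows "\<exists>u. fst u \<noteq> 0 \<and> expo u = (t, x, y, z)"
proof -
  have t: "t \<noteq> 0" using assms by auto
  define S C where "S = sin t" and "C = cos t"
  \<comment> \<open>On \<open>w\<close>, \<open>expo\<close> is multiplication by
    \<open>(S + i (1 - C)) / t\<close>. As \<open>S * S + (1 - C) * (1 - C) = 2 * (1 - C)\<close>,
    its inverse is multiplication by \<open>m * (S - i (1 - C))\<close>; \<open>a\<close> and
    \<open>b\<close> below are the real and imaginary parts.\<close>
  define m where "m = t / (2 * (1 - C))"
  have SC: "S * S = 1 - C * C" using cos_square[of t] by (simp add: S_def C_def)
  have C: "1 - C \<noteq> 0" using assms by (simp add: C_def)
  have m: "m * (2 * (1 - C)) = t" using C by (simp add: m_def)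
  define a b where "a = m * (S * x + (1 - C) * y)" and "b = m * (S * y - (1 - C) * x)"
  have "a * S - b * (1 - C) = t * x"
    unfolding a_def b_def m[symmetric] using SC by algebra
  moreover have "a * (1 - C) + b * S = t * y"
    unfolding a_def b_def m[symmetric] using SC by algebra
  ultimately have "expo (t, a, b, z - (a\<^sup>2 + b\<^sup>2) * (t - sin t) / (2 * t\<^sup>2)) = (t, x, y, z)"
    using t by (simp add: S_def C_def)
  with t show ?thesis by (metis fst_conv)
qed

text \<open>Carrying the derivative along lets maps and derivatives be composed together, so that
  the classification becomes a normalization of \<open>A\<close>.\<close>

definition isometry_at_0 :: "(point \<Rightarrow> point) \<Rightarrow> (point \<Rightarrow> point) \<Rightarrow> bool" where
  "isometry_at_0 f A \<longleftrightarrow> f \<in> Isometries \<and> f 0 = 0 \<and> (f has_derivative A) (at 0)"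

lemma isometry_at_0_metric:
  assumes "isometry_at_0 f A"
  shows "metric 0 (A v) (A w) = metric 0 v w"
  using assms IsometriesD(5)[of f 0 v w] frechet_derivative_at[of f A 0]
  by (simp add: isometry_at_0_def)

lemma isometry_at_0_linear: "isometry_at_0 f A \<Longrightarrow> linear A"
  using has_derivative_linear unfolding isometry_at_0_def by blast

lemma isometry_at_0_comp:
  assumes "isometry_at_0 f A" "isometry_at_0 g B"
  shows "isometry_at_0 (f \<circ> g) (A \<circ> B)"
  using assms Isometries_comp diff_chain_at[of g B 0 f A]
  by (auto simp: isometry_at_0_def)

lemma isometry_at_0_expand:
  assumes "isometry_at_0 f A"
  shows "A (t, x, y, z) = t *\<^sub>R A (1, 0, 0, 0) + x *\<^sub>R A (0, 1, 0, 0) + y *\<^sub>R A (0, 0, 1, 0) + z *\<^sub>R A (0, 0, 0, 1)"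
proof -
  note l = isometry_at_0_linear[OF assms]
  have "(t, x, y, z) = t *\<^sub>R (1, 0, 0, 0) + x *\<^sub>R (0, 1, 0, 0) + y *\<^sub>R (0, 0, 1, 0) + z *\<^sub>R (0, 0, 0, 1::real)"
    by simp
  then show ?thesis
    by (simp only: linear_add[OF l] linear_cmul[OF l])
qed

lemma eta_origin [simp]: "eta 0 v = snd (snd (snd v))"
  by (cases v) (simp add: origin[symmetric])

lemma metric_origin: "metric 0 (vt, vx, vy, vz) (wt, wx, wy, wz) = vt * wz + vz * wt + vx * wx + vy * wy"
  by simp

lemma isometry_at_0_fst:
  assumes f: "isometry_at_0 f A"
  obtains r \<beta>1 \<beta>2 \<nu> p q l p' q' l' m where
    "A (1, 0, 0, 0) = (r, \<beta>1, \<beta>2, \<nu>)" "A (0, 1, 0, 0) = (0, p, q, l)"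
    "A (0, 0, 1, 0) = (0, p', q', l')" "A (0, 0, 0, 1) = (0, 0, 0, m)" "r * m = 1" "r \<in> \<int>"
proof -
  obtain r \<beta>1 \<beta>2 \<nu> where 0: "A (1, 0, 0, 0) = (r, \<beta>1, \<beta>2, \<nu>)" by (metis surj_pair)
  obtain r1 p q l where 1: "A (0, 1, 0, 0) = (r1, p, q, l)" by (metis surj_pair)
  obtain r2 p' q' l' where 2: "A (0, 0, 1, 0) = (r2, p', q', l')" by (metis surj_pair)
  obtain r3 m1 m2 m where 3: "A (0, 0, 0, 1) = (r3, m1, m2, m)" by (metis surj_pair)
  note A = isometry_at_0_expand[OF f, unfolded 0 1 2 3]
  note F = f[unfolded isometry_at_0_def]
  have fst_eq: "fst (A (2 * pi, a, b, \<zeta>)) = fst (f (2 * pi, 0, 0, \<zeta> + (a\<^sup>2 + b\<^sup>2) / (4 * pi)))" for a b \<zeta>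
    using isometry_expo(1)[of f A "(2 * pi, a, b, \<zeta>)"] F unfolding expo_two_pi by simp
  \<comment> \<open>Both vectors of each pair have the same
    \<open>\<zeta> + (a\<^sup>2 + b\<^sup>2) / (4 * pi)\<close>. The three equations kill the
    coefficients of \<open>a\<close>, \<open>b\<close> and \<open>\<zeta>\<close>.\<close>
  have "fst (A (2 * pi, 1, 0, 0)) = fst (A (2 * pi, -1, 0, 0))"
    "fst (A (2 * pi, 0, 1, 0)) = fst (A (2 * pi, 0, -1, 0))"
    "fst (A (2 * pi, 1, 0, 0)) = fst (A (2 * pi, 0, 0, 1 / (4 * pi)))"
    unfolding fst_eq by simp_all
  then have z: "r1 = 0" "r2 = 0" "r3 = 0" unfolding A by simp_all
  \<comment> \<open>\<open>(0, 0, 0, 1)\<close> is a null vector; as the first component of its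
    image is zero, its norm there is the sum of the squares of \<open>m1\<close> and
    \<open>m2\<close>.\<close>
  have "metric 0 (A (0, 0, 0, 1)) (A (0, 0, 0, 1)) = 0"
    unfolding isometry_at_0_metric[OF f] by (simp add: metric_origin)
  then have "m1 = 0" "m2 = 0"
    by (simp_all add: 3 z metric_origin sum_squares_eq_zero_iff)
  moreover have "metric 0 (A (1, 0, 0, 0)) (A (0, 0, 0, 1)) = 1"
    unfolding isometry_at_0_metric[OF f] by (simp add: metric_origin)
  ultimately have rm: "r * m = 1" by (simp add: 0 3 z metric_origin)
  have pq: "p * p + q * q = 1"
  proof -
    have "metric 0 (A (0, 1, 0, 0)) (A (0, 1, 0, 0)) = 1"
      unfolding isometry_at_0_metric[OF f] by (simp add: metric_origin)
    then show ?thesis by (simp add: 1 z metric_origin)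
  qed
  have r0: "r \<noteq> 0" using rm by auto
  define T S C where "T = 2 * pi * r" and "S = sin T" and "C = cos T"
  have T0: "T \<noteq> 0" using r0 by (simp add: T_def)
  \<comment> \<open>Both velocities lead to the same conjugate point, and so do their images at time
    \<open>T\<close>. This says \<open>(p + i q) (S + i (1 - C)) = 0\<close> with
    \<open>p + i q\<close> of modulus one, hence \<open>C = 1\<close>.\<close>
  have "f (expo (2 * pi, 1, 0, 0)) = expo (A (2 * pi, 1, 0, 0))"
    "f (expo (2 * pi, -1, 0, 0)) = expo (A (2 * pi, -1, 0, 0))"
    using isometry_expo(2)[of f A "(2 * pi, 1, 0, 0)"] isometry_expo(2)[of f A "(2 * pi, -1, 0, 0)"] F r0
    by (simp_all add: A z del: expo.simps)
  then have "expo (A (2 * pi, 1, 0, 0)) = expo (A (2 * pi, -1, 0, 0))"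
    unfolding expo_two_pi by simp
  moreover define B1 B2 N where "B1 = 2 * pi * \<beta>1" and "B2 = 2 * pi * \<beta>2" and "N = 2 * pi * \<nu>"
  have "A (2 * pi, 1, 0, 0) = (T, B1 + p, B2 + q, N + l)" "A (2 * pi, -1, 0, 0) = (T, B1 - p, B2 - q, N - l)"
    unfolding A z by (simp_all add: T_def B1_def B2_def N_def)
  ultimately have "(B1 + p) * S - (B2 + q) * (1 - C) = (B1 - p) * S - (B2 - q) * (1 - C)"
    "(B1 + p) * (1 - C) + (B2 + q) * S = (B1 - p) * (1 - C) + (B2 - q) * S"
    using T0 unfolding S_def C_def by (auto simp only: expo.simps prod.inject divide_cancel_right)
  then have "p * S - q * (1 - C) = 0" "p * (1 - C) + q * S = 0"
    by (simp_all add: algebra_simps)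
  with pq have "1 - C = 0" by algebra
  then obtain n :: int where "T = of_int n * 2 * pi"
    unfolding C_def using cos_one_2pi_int[of T] by auto
  then have "r = of_int n" by (simp add: T_def)
  then have "r \<in> \<int>" by simp
  with 0 1 2 3 z \<open>m1 = 0\<close> \<open>m2 = 0\<close> rm show ?thesis using that by simp
qed

lemma isometry_at_0_inv:
  assumes f: "isometry_at_0 f A"
  obtains B where "isometry_at_0 (inv_into UNIV f) B" "\<And>v. B (A v) = v"
proof -
  note F = f[unfolded isometry_at_0_def]
  note b = IsometriesD(1)[OF F[THEN conjunct1]]
  define g where "g = inv_into UNIV f"
  have g: "g \<in> Isometries" unfolding g_def using F Isometries_inv by blast
  have gf: "g (f p) = p" for p unfolding g_def using b by (simp add: bij_is_inj)
  have g0: "g 0 = 0" using gf[of 0] F by simp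
  define B where "B = frechet_derivative g (at 0)"
  have B: "(g has_derivative B) (at 0)" unfolding B_def by (rule IsometriesD(4)[OF g])
  then have "((\<lambda>p. g (f p)) has_derivative (\<lambda>v. B (A v))) (at 0)"
    using F has_derivative_compose[of f A 0 UNIV g B] by simp
  moreover have "((\<lambda>p. g (f p)) has_derivative (\<lambda>v. v)) (at 0)" by (simp add: gf)
  ultimately have "(\<lambda>v. B (A v)) = (\<lambda>v. v)" by (rule has_derivative_unique)
  then have BA: "B (A v) = v" for v by (rule fun_cong)
  have gB: "isometry_at_0 g B" using g g0 B by (simp add: isometry_at_0_def)
  show ?thesis by (rule that[folded g_def, OF gB BA])
qed

text \<open>Besides \<open>r\<close>, the conclusions list the Gram matrix of the images of the
  basis vectors. It leaves an orthogonal block on \<open>w\<close> and the parameters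
  \<open>\<beta>1\<close>, \<open>\<beta>2\<close> free, and determines \<open>l\<close>,
  \<open>l'\<close> and \<open>\<nu>\<close>.\<close>

lemma isometry_at_0_derivative:
  assumes f: "isometry_at_0 f A"
  obtains r \<beta>1 \<beta>2 \<nu> p q l p' q' l' where
    "r = 1 \<or> r = -1" "A (1, 0, 0, 0) = (r, \<beta>1, \<beta>2, \<nu>)" "A (0, 1, 0, 0) = (0, p, q, l)"
    "A (0, 0, 1, 0) = (0, p', q', l')" "A (0, 0, 0, 1) = (0, 0, 0, r)"
    "p * p + q * q = 1" "p' * p' + q' * q' = 1" "p * p' + q * q' = 0"
    "\<beta>1 * p + \<beta>2 * q + r * l = 0" "\<beta>1 * p' + \<beta>2 * q' + r * l' = 0"
    "2 * r * \<nu> + \<beta>1 * \<beta>1 + \<beta>2 * \<beta>2 = 0"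
proof -
  obtain r \<beta>1 \<beta>2 \<nu> p q l p' q' l' m where 0: "A (1, 0, 0, 0) = (r, \<beta>1, \<beta>2, \<nu>)"
    and 1: "A (0, 1, 0, 0) = (0, p, q, l)" and 2: "A (0, 0, 1, 0) = (0, p', q', l')"
    and 3: "A (0, 0, 0, 1) = (0, 0, 0, m)" and rm: "r * m = 1" and r: "r \<in> \<int>"
    by (rule isometry_at_0_fst[OF f])
  obtain B where B: "isometry_at_0 (inv_into UNIV f) B" "\<forall>v. B (A v) = v"
    using isometry_at_0_inv[OF f] by metis
  obtain r' c1 c2 c3 d1 d2 d3 e1 e2 e3 m' where 4: "B (1, 0, 0, 0) = (r', c1, c2, c3)"
    "B (0, 1, 0, 0) = (0, d1, d2, d3)" "B (0, 0, 1, 0) = (0, e1, e2, e3)"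
    "B (0, 0, 0, 1) = (0, 0, 0, m')" and r': "r' \<in> \<int>"
    by (rule isometry_at_0_fst[OF B(1)])
  have "fst (B (A (1, 0, 0, 0))) = r * r'"
    unfolding 0 by (subst isometry_at_0_expand[OF B(1)]) (simp add: 4)
  then have "r * r' = 1" by (simp add: B)
  moreover obtain i j :: int where ij: "r = of_int i" "r' = of_int j"
    using r r' by (auto elim!: Ints_cases)
  ultimately have "of_int (i * j) = (1 :: real)" by simp
  then have "i * j = 1" by linarith
  then have r1: "r = 1 \<or> r = -1" using ij by (auto simp: zmult_eq_1_iff)
  with rm have "m = r" by auto
  note M = isometry_at_0_metric[OF f]
  from M[of "(0, 1, 0, 0)" "(0, 1, 0, 0)"] M[of "(0, 0, 1, 0)" "(0, 0, 1, 0)"]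
    M[of "(0, 1, 0, 0)" "(0, 0, 1, 0)"] M[of "(1, 0, 0, 0)" "(0, 1, 0, 0)"]
    M[of "(1, 0, 0, 0)" "(0, 0, 1, 0)"] M[of "(1, 0, 0, 0)" "(1, 0, 0, 0)"]
  have "p * p + q * q = 1" "p' * p' + q' * q' = 1" "p * p' + q * q' = 0"
    "\<beta>1 * p + \<beta>2 * q + r * l = 0" "\<beta>1 * p' + \<beta>2 * q' + r * l' = 0"
    "2 * r * \<nu> + \<beta>1 * \<beta>1 + \<beta>2 * \<beta>2 = 0"
    unfolding 0 1 2 metric_origin by (simp_all add: algebra_simps)
  with r1 0 1 2 3 \<open>m = r\<close> show ?thesis using that by blast
qed

text \<open>Rigidity: the points \<open>expo u\<close> are dense, and \<open>f (expo u) = expo (A u)\<close>.\<close>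

lemma isometry_at_0_unique:
  assumes f: "isometry_at_0 f A" and h: "isometry_at_0 h A"
  shows "f = h"
proof
  fix p :: point
  obtain t x y z where p: "p = (t, x, y, z)" by (cases p)
  obtain r \<beta>1 \<beta>2 \<nu> c d l c' d' l' where r: "r = 1 \<or> r = -1" and A: "A (1, 0, 0, 0) = (r, \<beta>1, \<beta>2, \<nu>)"
    "A (0, 1, 0, 0) = (0, c, d, l)" "A (0, 0, 1, 0) = (0, c', d', l')" "A (0, 0, 0, 1) = (0, 0, 0, r)"
    by (rule isometry_at_0_derivative[OF f])
  have fst_A: "fst (A u) = r * fst u" for u
    by (cases u) (simp add: isometry_at_0_expand[OF f, unfolded A])
  have eq: "f (t, x, y, z) = h (t, x, y, z)" if "cos t \<noteq> 1" for t
  proof -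
    from expo_surj[OF that] obtain u where u: "fst u \<noteq> 0" "expo u = (t, x, y, z)" by blast
    have "fst (A u) \<noteq> 0" using r u(1) fst_A[of u] by auto
    then have "f (expo u) = expo (A u)" "h (expo u) = expo (A u)"
      using isometry_expo(2)[OF _ _ _ u(1)] f h unfolding isometry_at_0_def by blast+
    then show ?thesis unfolding u(2) by simp
  qed
  show "f p = h p"
  proof (cases "cos t = 1")
    case False
    then show ?thesis using eq p by simp
  next
    case True
    \<comment> \<open>The exceptional \<open>t\<close> is approached by
      \<open>t + 1 / (n + 1)\<close>, where \<open>cos\<close> differs from \<open>1\<close> because
      \<open>0 < 1 / (n + 1) \<le> 1 < pi\<close>.\<close>
    define s where "s = (\<lambda>n. (t + 1 / real (Suc n), x, y, z))"
    have "(\<lambda>n. 1 / real (Suc n)) \<longlonglongrightarrow> 0" by (rule LIMSEQ_Suc[OF lim_1_over_n])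
    then have "s \<longlonglongrightarrow> (t + 0, x, y, z)"
      unfolding s_def by (intro tendsto_intros)
    then have lim: "s \<longlonglongrightarrow> p" by (simp add: p)
    have "sin t = 0" using True cos_square[of t] by simp
    have "f (s n) = h (s n)" for n
    proof -
      define e where "e = 1 / real (Suc n)"
      have e: "0 < e" "e \<le> 1" by (auto simp: e_def)
      have "cos e < cos 0" by (rule cos_monotone_0_pi) (use e pi_gt3 in auto)
      then have "cos (t + e) \<noteq> 1" using True \<open>sin t = 0\<close> by (simp add: cos_add)
      then show ?thesis using eq by (simp add: s_def e_def)
    qed
    moreover have "(\<lambda>n. f (s n)) \<longlonglongrightarrow> f p" "(\<lambda>n. h (s n)) \<longlonglongrightarrow> h p"
      using f h unfolding isometry_at_0_def
      by (blast intro: isCont_tendsto_compose[OF has_derivative_continuous[OF IsometriesD(4)] lim])+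
    ultimately show ?thesis using LIMSEQ_unique by simp
  qed
qed

lemma rot_0: "rot 0 \<theta> 0 = 0" and neg_t_0: "neg_t 0 = 0" and refl_w_0: "refl_w 0 = 0"
  and heis_0: "heis a b (- a) (- b) 0 0 = 0"
  by (simp_all add: origin[symmetric] osc1_def osc2_def)

lemma isometry_at_0_explicit:
  "isometry_at_0 (rot 0 \<theta>) (rot 0 \<theta>)" "isometry_at_0 neg_t neg_t"
  "isometry_at_0 refl_w (refl_w_deriv 0)"
  "isometry_at_0 (heis a b (- a) (- b) 0) (heis_deriv a b (- a) (- b) 0)"
  unfolding isometry_at_0_def
  using rot_has_derivative neg_t_has_derivative refl_w_has_derivative heis_has_derivative
  by (simp_all add: rot_0 neg_t_0 refl_w_0 heis_0 del: rot.simps neg_t.simps refl_w.simps heis.simps)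

text \<open>With a trivial block on \<open>w\<close>, \<open>A\<close> is a null rotation fixing
  \<open>(0, 0, 0, 1)\<close>. The Heisenberg map with
  \<open>a + i b = i (\<beta>1 + i \<beta>2)\<close> and opposite oscillating part fixes the origin
  and has the same derivative there; rigidity identifies the two maps.\<close>

lemma isometry_at_0_heis:
  assumes f: "isometry_at_0 f A"
    and A: "fst (A (1, 0, 0, 0)) = 1" "fst (snd (A (0, 1, 0, 0))) = 1" "fst (snd (snd (A (0, 1, 0, 0)))) = 0"
      "fst (snd (A (0, 0, 1, 0))) = 0" "fst (snd (snd (A (0, 0, 1, 0)))) = 1"
  obtains a b where "f = heis a b (- a) (- b) 0"
proof -
  obtain r \<beta>1 \<beta>2 \<nu> p q l p' q' l' where r: "r = 1 \<or> r = -1" and e: "A (1, 0, 0, 0) = (r, \<beta>1, \<beta>2, \<nu>)"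
    "A (0, 1, 0, 0) = (0, p, q, l)" "A (0, 0, 1, 0) = (0, p', q', l')" "A (0, 0, 0, 1) = (0, 0, 0, r)"
    and m: "\<beta>1 * p + \<beta>2 * q + r * l = 0" "\<beta>1 * p' + \<beta>2 * q' + r * l' = 0"
    "2 * r * \<nu> + \<beta>1 * \<beta>1 + \<beta>2 * \<beta>2 = 0"
    by (rule isometry_at_0_derivative[OF f])
  have A': "r = 1" "p = 1" "q = 0" "p' = 0" "q' = 1" using A e by simp_all
  with m have m': "l = - \<beta>1" "l' = - \<beta>2" "\<nu> = - (\<beta>1 * \<beta>1 + \<beta>2 * \<beta>2) / 2" by simp_all
  have A_eq: "A v = heis_deriv (- \<beta>2) \<beta>1 (- (- \<beta>2)) (- \<beta>1) 0 v" for v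
    by (cases v) (simp add: isometry_at_0_expand[OF f, unfolded e] A' m' origin[symmetric] osc1_def osc2_def field_simps)
  have "isometry_at_0 f (heis_deriv (- \<beta>2) \<beta>1 (- (- \<beta>2)) (- \<beta>1) 0)"
    using f unfolding ext[of A, OF A_eq] .
  from isometry_at_0_unique[OF this isometry_at_0_explicit(4)] show ?thesis using that by blast
qed

text \<open>An orthogonal block of positive determinant is a rotation by some
  \<open>\<theta>\<close>; composing with the opposite rotation makes it trivial.\<close>

lemma isometry_at_0_rot:
  assumes f: "isometry_at_0 f A"
    and A: "fst (A (1, 0, 0, 0)) = 1"
      "fst (snd (A (0, 1, 0, 0))) * fst (snd (snd (A (0, 0, 1, 0))))
        - fst (snd (snd (A (0, 1, 0, 0)))) * fst (snd (A (0, 0, 1, 0))) > 0"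
  obtains a b \<theta> where "f = heis a b (- a) (- b) 0 \<circ> rot 0 \<theta>"
proof -
  obtain r \<beta>1 \<beta>2 \<nu> p q l p' q' l' where r: "r = 1 \<or> r = -1" and e: "A (1, 0, 0, 0) = (r, \<beta>1, \<beta>2, \<nu>)"
    "A (0, 1, 0, 0) = (0, p, q, l)" "A (0, 0, 1, 0) = (0, p', q', l')" "A (0, 0, 0, 1) = (0, 0, 0, r)"
    and m: "p * p + q * q = 1" "p' * p' + q' * q' = 1" "p * p' + q * q' = 0"
    by (rule isometry_at_0_derivative[OF f])
  have det: "p * q' - q * p' > 0" using A(2) by (simp add: e)
  have "(p * q' - q * p')\<^sup>2 = 1" using m by algebra
  with det have det: "p * q' - q * p' = 1" by (simp add: power2_eq_1_iff)
  with m have pq': "p' = - q" "q' = p" by algebra+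
  from m(1) obtain \<theta> where th: "p = cos \<theta>" "q = sin \<theta>"
    using sincos_total_2pi[of p q] by (auto simp: power2_eq_square)
  have *: "cos \<theta> * cos \<theta> + sin \<theta> * sin \<theta> = 1" using cos_square[of \<theta>] by simp
  have r1: "rot 0 (- \<theta>) (1, 0, 0, 0) = (1, 0, 0, 0)" "rot 0 (- \<theta>) (0, 1, 0, 0) = (0, cos \<theta>, - sin \<theta>, 0)"
    "rot 0 (- \<theta>) (0, 0, 1, 0) = (0, sin \<theta>, cos \<theta>, 0)" by simp_all
  have g: "isometry_at_0 (f \<circ> rot 0 (- \<theta>)) (A \<circ> rot 0 (- \<theta>))"
    by (rule isometry_at_0_comp[OF f isometry_at_0_explicit(1)])
  obtain a b where ab: "f \<circ> rot 0 (- \<theta>) = heis a b (- a) (- b) 0"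
    by (rule isometry_at_0_heis[OF g])
      (use A(1) * in \<open>simp_all add: r1 isometry_at_0_expand[OF f, unfolded e] pq' th algebra_simps del: rot.simps\<close>)
  have "f = f \<circ> rot 0 (- \<theta>) \<circ> rot 0 \<theta>" using rot_inverse(2)[of 0 \<theta>] by (simp add: o_assoc[symmetric])
  then show ?thesis using that ab by simp
qed

text \<open>If the block has negative determinant, composition with \<open>refl_w\<close> makes it
  positive, since the derivative of \<open>refl_w\<close> at the origin conjugates
  \<open>w\<close>.\<close>

lemma isometry_at_0_refl:
  assumes f: "isometry_at_0 f A" and A: "fst (A (1, 0, 0, 0)) = 1"
  obtains a b \<theta> g where "f = heis a b (- a) (- b) 0 \<circ> rot 0 \<theta> \<circ> g" "g = id \<or> g = refl_w"
proof -
  obtain r \<beta>1 \<beta>2 \<nu> p q l p' q' l' where r: "r = 1 \<or> r = -1" and e: "A (1, 0, 0, 0) = (r, \<beta>1, \<beta>2, \<nu>)"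
    "A (0, 1, 0, 0) = (0, p, q, l)" "A (0, 0, 1, 0) = (0, p', q', l')" "A (0, 0, 0, 1) = (0, 0, 0, r)"
    and m: "p * p + q * q = 1" "p' * p' + q' * q' = 1" "p * p' + q * q' = 0"
    by (rule isometry_at_0_derivative[OF f])
  have "(p * q' - q * p')\<^sup>2 = 1" using m by algebra
  then consider "p * q' - q * p' > 0" | "p * q' - q * p' < 0"
    by (auto simp: power2_eq_1_iff)
  then show ?thesis
  proof cases
    case 1
    then obtain a b \<theta> where "f = heis a b (- a) (- b) 0 \<circ> rot 0 \<theta>"
      using isometry_at_0_rot[OF f A] by (auto simp: e)
    then show ?thesis using that[of _ _ _ id] by simp
  next
    case 2
    have v: "refl_w_deriv 0 (1, 0, 0, 0) = (1, 0, 0, 0)" "refl_w_deriv 0 (0, 1, 0, 0) = (0, 1, 0, 0)"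
      "refl_w_deriv 0 (0, 0, 1, 0) = (0, 0, - 1, 0)"
      by (simp_all add: origin[symmetric])
    have g: "isometry_at_0 (f \<circ> refl_w) (A \<circ> refl_w_deriv 0)"
      by (rule isometry_at_0_comp[OF f isometry_at_0_explicit(3)])
    obtain a b \<theta> where ab: "f \<circ> refl_w = heis a b (- a) (- b) 0 \<circ> rot 0 \<theta>"
      by (rule isometry_at_0_rot[OF g])
        (use A 2 in \<open>simp_all add: v isometry_at_0_expand[OF f, unfolded e]\<close>)
    have "f = f \<circ> refl_w \<circ> refl_w" using refl_w_inverse by (simp add: o_assoc[symmetric])
    then show ?thesis using that ab by auto
  qed
qed

lemma isometry_cases:
  assumes f: "f \<in> Isometries"
  obtains n a b \<theta> g g' where "f = nmult n \<circ> heis a b (- a) (- b) 0 \<circ> rot 0 \<theta> \<circ> g \<circ> g'"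
    "g = id \<or> g = refl_w" "g' = id \<or> g' = neg_t"
proof -
  define n where "n = f 0"
  have nm: "nmult n \<circ> nmult (- n) = id" "nmult (- n) \<circ> nmult n = id"
    by (rule ext; cases n; auto simp: field_simps)+
  have n0: "nmult (- n) n = 0" by (cases n) (simp add: origin[symmetric])
  define h where "h = nmult (- n) \<circ> f"
  have h: "h \<in> Isometries" "h 0 = 0"
    using f by (auto simp: h_def Isometries_comp n0 n_def[symmetric])
  then obtain A where A: "isometry_at_0 h A"
    using IsometriesD(4)[OF h(1)] unfolding isometry_at_0_def by blast
  have fh: "f = nmult n \<circ> h" using nm by (simp add: h_def o_assoc)
  obtain r \<beta>1 \<beta>2 \<nu> p q l p' q' l' where r: "r = 1 \<or> r = -1" and e: "A (1, 0, 0, 0) = (r, \<beta>1, \<beta>2, \<nu>)"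
    by (rule isometry_at_0_derivative[OF A])
  from r show ?thesis
  proof
    assume "r = 1"
    then have "fst (A (1, 0, 0, 0)) = 1" by (simp add: e)
    then obtain a b \<theta> g where "h = heis a b (- a) (- b) 0 \<circ> rot 0 \<theta> \<circ> g" "g = id \<or> g = refl_w"
      using isometry_at_0_refl[OF A] by blast
    then show ?thesis using that[of n a b \<theta> g id] by (simp add: fh o_assoc)
  next
    assume "r = -1"
    have h': "isometry_at_0 (h \<circ> neg_t) (A \<circ> neg_t)"
      by (rule isometry_at_0_comp[OF A isometry_at_0_explicit(2)])
    have "A (- 1, 0, 0, 0) = - A (1, 0, 0, 0)"
      using linear_neg[OF isometry_at_0_linear[OF A], of "(1, 0, 0, 0)"] by simp
    then have "fst ((A \<circ> neg_t) (1, 0, 0, 0)) = 1" by (simp add: e \<open>r = -1\<close>)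
    then obtain a b \<theta> g where g: "h \<circ> neg_t = heis a b (- a) (- b) 0 \<circ> rot 0 \<theta> \<circ> g" "g = id \<or> g = refl_w"
      using isometry_at_0_refl[OF h'] by blast
    have "h = h \<circ> neg_t \<circ> neg_t" using neg_t_inverse by (simp add: o_assoc[symmetric])
    then show ?thesis using that[of n a b \<theta> g neg_t] g by (simp add: fh o_assoc)
  qed
qed

section \<open>The topology of the isometry group\<close>

lemma topspace_compact_open: "topspace compact_open_topology = UNIV"
proof -
  \<comment> \<open>With empty \<open>C\<close>, the subbasic set consists of all maps.\<close>
  have "openin compact_open_topology {f :: point \<Rightarrow> point. f ` {} \<subseteq> {}}"
    unfolding compact_open_topology_def
    by (rule topology_generated_by_Basis) (use compact_empty open_empty in blast)
  then show ?thesis using openin_subset by fastforce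
qed

lemma topspace_Iso_top [simp]: "topspace Iso_top = Isometries"
  by (simp add: Iso_top_def topspace_compact_open)

lemma openin_compact_open: "compact C \<Longrightarrow> open U \<Longrightarrow> openin compact_open_topology {f. f ` C \<subseteq> U}"
  unfolding compact_open_topology_def by (rule topology_generated_by_Basis) blast

lemma continuous_map_Iso_top:
  assumes "\<And>C U. compact C \<Longrightarrow> open U \<Longrightarrow> openin X {a \<in> topspace X. \<Phi> a ` C \<subseteq> U}"
    and "\<And>a. a \<in> topspace X \<Longrightarrow> \<Phi> a \<in> Isometries"
  shows "continuous_map X Iso_top \<Phi>"
proof -
  have "continuous_map X compact_open_topology \<Phi>"
    unfolding compact_open_topology_def
  proof (rule continuous_on_generated_topo)
    fix V :: "(point \<Rightarrow> point) set" assume "V \<in> {{f. f ` C \<subseteq> U} | C U. compact C \<and> open U}"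
    then obtain C U where V: "V = {f. f ` C \<subseteq> U}" "compact C" "open U" by blast
    have "\<Phi> -` V \<inter> topspace X = {a \<in> topspace X. \<Phi> a ` C \<subseteq> U}" using V by auto
    with assms(1)[OF V(2,3)] show "openin X (\<Phi> -` V \<inter> topspace X)" by simp
  next
    show "\<Phi> ` topspace X \<subseteq> \<Union> {{f. f ` C \<subseteq> U} | C U. compact C \<and> open U}"
      using topspace_compact_open
      unfolding compact_open_topology_def topology_generated_by_topspace by simp
  qed
  then show ?thesis
    using assms(2) by (simp add: Iso_top_def continuous_map_in_subtopology Pi_iff image_subset_iff)
qed

text \<open>By the tube lemma, if \<open>\<Phi> a\<close> maps a compact \<open>C\<close> into an
  open \<open>U\<close>, then so does \<open>\<Phi> a'\<close> for all \<open>a'\<close> near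
  \<open>a\<close>.\<close>

lemma continuous_map_Iso_top_jointly:
  fixes \<Phi> :: "'a::topological_space \<Rightarrow> point \<Rightarrow> point"
  assumes cont: "continuous_on UNIV (\<lambda>(a, p). \<Phi> a p)" and iso: "\<And>a. \<Phi> a \<in> Isometries"
  shows "continuous_map euclidean Iso_top \<Phi>"
proof (rule continuous_map_Iso_top)
  fix C U :: "point set" assume C: "compact C" and U: "open U"
  have "open {a. \<Phi> a ` C \<subseteq> U}"
  proof (subst open_subopen, intro ballI)
    fix a assume a: "a \<in> {a. \<Phi> a ` C \<subseteq> U}"
    define W where "W = (\<lambda>(a, p). \<Phi> a p) -` U"
    have W: "open W" unfolding W_def by (rule open_vimage[OF U cont])
    have "{a} \<times> C \<subseteq> W" using a by (auto simp: W_def)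
    from Elementary_Topology.tube_lemma[OF C W this]
    obtain A where A: "a \<in> A" "open A" "A \<times> C \<subseteq> W" by blast
    have "A \<subseteq> {a. \<Phi> a ` C \<subseteq> U}" using A(3) by (auto simp: W_def)
    with A show "\<exists>T. open T \<and> a \<in> T \<and> T \<subseteq> {a. \<Phi> a ` C \<subseteq> U}" by blast
  qed
  then show "openin euclidean {a \<in> topspace euclidean. \<Phi> a ` C \<subseteq> U}" by simp
qed (simp add: iso)

lemma continuous_map_eval: "continuous_map Iso_top euclidean (\<lambda>f. f p)"
proof (unfold continuous_map_def, intro conjI allI impI)
  show "(\<lambda>f. f p) \<in> topspace Iso_top \<rightarrow> topspace euclidean" by simp
  fix U :: "point set" assume "openin euclidean U"
  then have "open U" by simp
  then have "openin Iso_top ({f. f ` {p} \<subseteq> U} \<inter> Isometries)"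
    unfolding Iso_top_def by (intro openin_subtopology_Int openin_compact_open) auto
  moreover have "{f. f ` {p} \<subseteq> U} \<inter> Isometries = {f \<in> Isometries. f p \<in> U}" by auto
  ultimately show "openin Iso_top {f \<in> topspace Iso_top. f p \<in> U}" by simp
qed

lemma isometry_continuous: "f \<in> Isometries \<Longrightarrow> continuous_on UNIV f"
  by (intro continuous_at_imp_continuous_on ballI has_derivative_continuous[OF IsometriesD(4)])

section \<open>Left translations and the identity component\<close>

lemma continuous_map_left_translation:
  assumes g: "g \<in> Isometries"
  shows "continuous_map Iso_top Iso_top (\<lambda>f. g \<circ> f)"
proof (rule continuous_map_Iso_top)
  fix C U :: "point set" assume C: "compact C" and U: "open U"
  have "openin Iso_top ({f. f ` C \<subseteq> g -` U} \<inter> Isometries)"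
    unfolding Iso_top_def
    by (intro openin_subtopology_Int openin_compact_open C open_vimage[OF U isometry_continuous[OF g]])
  moreover have "{f. f ` C \<subseteq> g -` U} \<inter> Isometries = {f \<in> topspace Iso_top. (g \<circ> f) ` C \<subseteq> U}" by auto
  ultimately show "openin Iso_top {f \<in> topspace Iso_top. (g \<circ> f) ` C \<subseteq> U}" by simp
qed (simp add: g Isometries_comp)

lemma Iso0_maximal:
  assumes "connectedin Iso_top S" "f \<in> S" "f \<in> Iso0"
  shows "S \<subseteq> Iso0"
proof -
  have "connected_component_of Iso_top id f" using assms(3) by (simp add: Iso0_def)
  then have "connected_component_of Iso_top id = connected_component_of Iso_top f"
    using connected_component_of_equiv[of Iso_top id f] by blast
  then show ?thesis
    using connected_component_of_maximal[OF assms(1,2)] by (simp only: Iso0_def)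
qed

lemma id_Iso0: "id \<in> Iso0"
  by (simp add: Iso0_def connected_component_of_refl Isometries_id)

lemma connectedin_Iso0: "connectedin Iso_top Iso0"
  unfolding Iso0_def by (rule connectedin_connected_component_of)

lemma Iso0_subset: "Iso0 \<subseteq> Isometries"
  using connectedin_subset_topspace[OF connectedin_Iso0] by simp

text \<open>The translate of \<open>Iso0\<close> by \<open>g\<close> is connected and meets
  \<open>Iso0\<close> in \<open>g \<circ> f\<close>. With \<open>g\<close> the inverse of
  \<open>f\<close> this yields closure under inverses, and with \<open>id\<close> in place of
  \<open>f\<close> closure under products; so continuity of left translations is enough for the
  subgroup property.\<close>

lemma Iso0_left:
  assumes g: "g \<in> Isometries" and f: "f \<in> Iso0" "g \<circ> f \<in> Iso0" and h: "h \<in> Iso0"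
  shows "g \<circ> h \<in> Iso0"
proof -
  have "connectedin Iso_top ((\<circ>) g ` Iso0)"
    by (rule connectedin_continuous_map_image[OF continuous_map_left_translation[OF g] connectedin_Iso0])
  from Iso0_maximal[OF this, of "g \<circ> f"] f h show ?thesis by blast
qed

lemma subgroup_Iso0: "subgroup Iso0 Iso_M"
proof (rule group.subgroupI[OF group_Iso_M])
  fix f assume f: "f \<in> Iso0"
  then have F: "f \<in> Isometries" using Iso0_subset by blast
  have "inv_into UNIV f \<circ> f = id" using IsometriesD(1)[OF F] by (simp add: bij_is_inj)
  then show "inv\<^bsub>Iso_M\<^esub> f \<in> Iso0"
    using Iso0_left[OF Isometries_inv[OF F] f _ id_Iso0] by (simp add: Iso_M_inv[OF F] id_Iso0)
next
  fix f g assume "f \<in> Iso0" "g \<in> Iso0"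
  then show "f \<otimes>\<^bsub>Iso_M\<^esub> g \<in> Iso0"
    using Iso0_left[of f id g] Iso0_subset id_Iso0 by auto
qed (use Iso0_subset id_Iso0 in auto)

lemma Iso0_path:
  fixes \<Phi> :: "'a::real_normed_vector \<Rightarrow> point \<Rightarrow> point"
  assumes "continuous_on UNIV (\<lambda>(a, p). \<Phi> a p)" "\<And>a. \<Phi> a \<in> Isometries" "\<Phi> a0 = id"
  shows "\<Phi> a \<in> Iso0"
proof -
  have "connectedin Iso_top (\<Phi> ` UNIV)"
    by (rule connectedin_continuous_map_image[OF continuous_map_Iso_top_jointly[OF assms(1,2)]])
      (simp add: connectedin_iff_connected convex_connected)
  moreover have "id \<in> range \<Phi>" using rangeI[of \<Phi> a0] assms(3) by simp
  ultimately show ?thesis using Iso0_maximal id_Iso0 by blast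
qed

section \<open>Left translations and isometric automorphisms\<close>

lemma nmult_assoc: "nmult a (nmult b c) = nmult (nmult a b) c"
  by (cases a; cases b; cases c) (simp add: field_simps)

lemma nmult_zero [simp]: "nmult 0 p = p" "nmult p 0 = p"
  by (cases p, simp add: zero_prod_def)+

lemma nmult_uminus [simp]: "nmult p (- p) = 0" "nmult (- p) p = 0"
  by (cases p, simp add: zero_prod_def)+

lemma nmult_cancel [simp]: "nmult (- p) (nmult p q) = q" "nmult p (nmult (- p) q) = q"
  by (simp_all only: nmult_assoc nmult_uminus nmult_zero)

lemma nmult_comp: "nmult a \<circ> nmult b = nmult (nmult a b)"
  by (rule ext) (simp add: nmult_assoc)

lemma nmult_0_id: "nmult 0 = id"
  by (rule ext) simp

lemma inv_nmult: "inv_into UNIV (nmult n) = nmult (- n)"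
  by (rule inv_unique_comp) (simp_all add: nmult_comp nmult_0_id)

lemma subgroup_N_trans: "subgroup N_trans Iso_M"
  by (rule group.subgroupI[OF group_Iso_M])
    (auto simp: N_trans_def Iso_M_inv inv_nmult nmult_comp)

lemma transitive_N_trans: "transitive N_trans"
  unfolding transitive_def
proof (intro allI)
  fix p q
  have "nmult (nmult q (- p)) p = q" by (simp add: nmult_assoc[symmetric])
  then show "\<exists>f\<in>N_trans. f p = q" unfolding N_trans_def by blast
qed

lemma N_trans_subset_Iso0: "N_trans \<subseteq> Iso0"
proof -
  have "nmult a p = (fst a + fst p, fst (snd a) + fst (snd p), fst (snd (snd a)) + fst (snd (snd p)),
      snd (snd (snd a)) + snd (snd (snd p))
      + (fst (snd a) * fst (snd (snd p)) - fst (snd (snd a)) * fst (snd p)) / 2)" for a p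
    by (cases a; cases p) simp
  then have "continuous_on UNIV (\<lambda>(a, p). nmult a p)"
    unfolding case_prod_unfold by (simp only:) (intro continuous_intros, auto)
  from Iso0_path[OF this nmult_Isometries nmult_0_id] show ?thesis by (auto simp: N_trans_def)
qed

lemma subgroup_N_trans_Iso0: "subgroup N_trans Iso0_group"
  by (rule group.subgroup_incl[OF group_Iso_M subgroup_N_trans subgroup_Iso0 N_trans_subset_Iso0])

lemma continuous_on_heis:
  fixes a b c d k :: "'a::t2_space \<Rightarrow> real"
  assumes "continuous_on UNIV a" "continuous_on UNIV b" "continuous_on UNIV c"
    "continuous_on UNIV d" "continuous_on UNIV k"
  shows "continuous_on UNIV (\<lambda>(u, p). heis (a u) (b u) (c u) (d u) (k u) p)"
proof -
  have "continuous_on UNIV (\<lambda>q :: 'a \<times> point. g (fst q))" if "continuous_on UNIV g" for g :: "'a \<Rightarrow> real"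
    by (rule continuous_on_compose2[OF that continuous_on_fst[OF continuous_on_id]]) simp
  note * = assms[THEN this]
  show ?thesis
    unfolding heis_expand case_prod_unfold
    by (intro * continuous_intros)
qed

text \<open>Conjugating a shift of \<open>t\<close> by \<open>pi\<close> with the map
  \<open>w \<mapsto> w + exp(i t)\<close> moves \<open>w\<close> by \<open>- 2 exp(i t)\<close>.
  This depends on \<open>t\<close>, while a left translation moves \<open>w\<close> by a
  constant.\<close>

lemma not_normal_N_trans: "\<not> N_trans \<lhd> Iso0_group"
proof
  assume "N_trans \<lhd> Iso0_group"
  let ?h = "heis 0 0 1 0 0" and ?n = "nmult (pi, 0, 0, 0)"
  have "heis 0 0 r 0 0 \<in> Iso0" for r :: real
    by (rule Iso0_path[of "\<lambda>r. heis 0 0 r 0 0" 0]) (intro continuous_on_heis continuous_intros | simp add: heis_zero)+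
  then have h: "?h \<in> carrier Iso0_group" by simp
  have "?h <#\<^bsub>Iso0_group\<^esub> N_trans = N_trans #>\<^bsub>Iso0_group\<^esub> ?h"
    using normal.coset_eq[OF \<open>N_trans \<lhd> Iso0_group\<close>] h by simp
  moreover have "?h \<circ> ?n \<in> ?h <#\<^bsub>Iso0_group\<^esub> N_trans"
    by (auto simp: l_coset_def N_trans_def)
  ultimately obtain m where m: "?h \<circ> ?n = nmult m \<circ> ?h"
    by (auto simp: r_coset_def N_trans_def)
  obtain t x y z where "m = (t, x, y, z)" by (cases m)
  \<comment> \<open>The first point gives \<open>x = -2\<close>, the second
    \<open>x = 2\<close>.\<close>
  with fun_cong[OF m, of "(0, 0, 0, 0)"] fun_cong[OF m, of "(pi, 0, 0, 0)"]
  show False by (simp add: osc1_def osc2_def)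
qed

section \<open>Isometric automorphisms and the semidirect product\<close>

lemma iso_N_group_iff:
  "\<phi> \<in> iso N_group N_group \<longleftrightarrow> bij \<phi> \<and> (\<forall>a b. \<phi> (nmult a b) = nmult (\<phi> a) (\<phi> b))"
  by (auto simp: iso_def hom_def N_group_def simp del: split_paired_All nmult.simps)

lemma H_autD:
  assumes "\<phi> \<in> H_aut"
  shows "\<phi> \<in> Isometries" "\<phi> \<in> iso N_group N_group" "\<phi> (nmult a b) = nmult (\<phi> a) (\<phi> b)"
    "\<phi> \<circ> nmult n = nmult (\<phi> n) \<circ> \<phi>" "\<phi> 0 = 0"
proof -
  show 1: "\<phi> \<in> Isometries" "\<phi> \<in> iso N_group N_group" using assms by (auto simp: H_aut_def Aut_N_def)
  then show hom: "\<phi> (nmult a b) = nmult (\<phi> a) (\<phi> b)" for a b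
    unfolding iso_N_group_iff by blast
  show "\<phi> \<circ> nmult n = nmult (\<phi> n) \<circ> \<phi>"
    by (rule ext) (simp only: o_apply hom)
  have "nmult (\<phi> 0) (\<phi> 0) = \<phi> 0" using hom[of 0 0] by simp
  then have "nmult (- \<phi> 0) (nmult (\<phi> 0) (\<phi> 0)) = 0" by simp
  then show "\<phi> 0 = 0" by (simp add: nmult_assoc)
qed

lemma H_autI: "\<phi> \<in> Isometries \<Longrightarrow> \<phi> \<in> iso N_group N_group \<Longrightarrow> \<phi> \<in> H_aut"
  by (simp add: H_aut_def Aut_N_def Isometries_def)

lemma id_H_aut: "id \<in> H_aut"
  by (rule H_autI) (auto simp: Isometries_id iso_def hom_def N_group_def)

lemma neg_t_H_aut: "neg_t \<in> H_aut"
proof (rule H_autI)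
  have "bij neg_t" using o_bij neg_t_inverse by blast
  then show "neg_t \<in> iso N_group N_group"
    by (auto simp: iso_def hom_def N_group_def field_simps)
qed simp

lemma H_aut_comp: "\<phi> \<in> H_aut \<Longrightarrow> \<psi> \<in> H_aut \<Longrightarrow> \<phi> \<circ> \<psi> \<in> H_aut"
  by (rule H_autI[OF Isometries_comp])
    (use H_autD(1,2) in \<open>simp_all add: iso_N_group_iff bij_comp del: split_paired_All\<close>)

lemma H_aut_inv: "\<phi> \<in> H_aut \<Longrightarrow> inv_into UNIV \<phi> \<in> H_aut"
  using group.iso_set_sym[OF group_N_group H_autD(2)]
  by (intro H_autI[OF Isometries_inv]) (auto dest: H_autD(1) simp: N_group_def)

lemma subgroup_H_aut: "subgroup H_aut Iso_M"
  by (rule group.subgroupI[OF group_Iso_M])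
    (use H_autD(1) H_aut_inv H_aut_comp id_H_aut Iso_M_inv in auto)

lemma Iso_autE:
  assumes "f \<in> Iso_aut"
  obtains n \<phi> where "f = nmult n \<circ> \<phi>" "\<phi> \<in> H_aut"
  using assms by (auto simp: Iso_aut_def)

lemma Iso_autI: "\<phi> \<in> H_aut \<Longrightarrow> nmult n \<circ> \<phi> \<in> Iso_aut"
  unfolding Iso_aut_def by blast

lemma Iso_aut_subset: "Iso_aut \<subseteq> Isometries"
  by (auto elim!: Iso_autE intro!: Isometries_comp dest: H_autD(1))

lemma N_trans_subset_Iso_aut: "N_trans \<subseteq> Iso_aut"
  using Iso_autI[OF id_H_aut] by (auto simp: N_trans_def)

lemma H_aut_subset_Iso_aut: "H_aut \<subseteq> Iso_aut"
  using Iso_autI[of _ 0] by (auto simp: nmult_0_id)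

lemma subgroup_Iso_aut: "subgroup Iso_aut Iso_M"
proof (rule group.subgroupI[OF group_Iso_M])
  show "Iso_aut \<subseteq> carrier Iso_M" "Iso_aut \<noteq> {}"
    using Iso_aut_subset H_aut_subset_Iso_aut id_H_aut by auto
next
  fix f assume "f \<in> Iso_aut"
  then obtain n \<phi> where f: "f = nmult n \<circ> \<phi>" "\<phi> \<in> H_aut" by (rule Iso_autE)
  have F: "f \<in> Isometries" using \<open>f \<in> Iso_aut\<close> Iso_aut_subset by blast
  have "inv_into UNIV f = inv_into UNIV \<phi> \<circ> nmult (- n)"
    unfolding f(1) using IsometriesD(1)[OF nmult_Isometries] IsometriesD(1)[OF H_autD(1)[OF f(2)]]
    by (simp add: o_inv_distrib inv_nmult)
  also have "\<dots> = nmult (inv_into UNIV \<phi> (- n)) \<circ> inv_into UNIV \<phi>"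
    by (rule H_autD(4)[OF H_aut_inv[OF f(2)]])
  also have "\<dots> \<in> Iso_aut" by (rule Iso_autI[OF H_aut_inv[OF f(2)]])
  finally show "inv\<^bsub>Iso_M\<^esub> f \<in> Iso_aut" by (simp add: Iso_M_inv[OF F])
next
  fix f g assume "f \<in> Iso_aut" "g \<in> Iso_aut"
  then obtain n \<phi> m \<psi> where f: "f = nmult n \<circ> \<phi>" "\<phi> \<in> H_aut" and g: "g = nmult m \<circ> \<psi>" "\<psi> \<in> H_aut"
    by (auto elim!: Iso_autE)
  have "f \<circ> g = nmult n \<circ> (\<phi> \<circ> nmult m) \<circ> \<psi>" by (simp add: f g o_assoc)
  also have "\<dots> = nmult (nmult n (\<phi> m)) \<circ> (\<phi> \<circ> \<psi>)"
    unfolding H_autD(4)[OF f(2)] by (simp add: nmult_comp[symmetric] o_assoc)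
  also have "\<dots> \<in> Iso_aut" by (rule Iso_autI[OF H_aut_comp[OF f(2) g(2)]])
  finally show "f \<otimes>\<^bsub>Iso_M\<^esub> g \<in> Iso_aut" by simp
qed

text \<open>As \<open>refl_w\<close> fixes the origin, it would be an automorphism itself. But it
  fixes \<open>(pi, 0, 0, 0)\<close> and \<open>(0, 1, 0, 0)\<close> and sends their product
  \<open>(pi, 1, 0, 0)\<close> to \<open>(pi, -1, 0, 0)\<close>.\<close>

lemma refl_w_not_Iso_aut: "refl_w \<notin> Iso_aut"
proof
  assume "refl_w \<in> Iso_aut"
  then obtain n \<phi> where n: "refl_w = nmult n \<circ> \<phi>" "\<phi> \<in> H_aut" by (rule Iso_autE)
  have "n = 0" using fun_cong[OF n(1), of 0] by (simp add: H_autD(5)[OF n(2)] refl_w_0)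
  then have "refl_w = \<phi>" using n(1) by (simp add: nmult_0_id)
  with H_autD(3)[OF n(2), of "(pi, 0, 0, 0)" "(0, 1, 0, 0)"] show False by simp
qed

lemma Iso_aut_psubset: "Iso_aut \<subset> Isometries"
  using Iso_aut_subset refl_w_not_Iso_aut refl_w_Isometries by blast

lemma internal_semidirect_Iso_aut:
  "internal_semidirect (Iso_M\<lparr>carrier := Iso_aut\<rparr>) N_trans H_aut"
  unfolding internal_semidirect_def
proof (intro conjI)
  let ?G = "Iso_M\<lparr>carrier := Iso_aut\<rparr>"
  have N: "subgroup N_trans ?G"
    by (rule group.subgroup_incl[OF group_Iso_M subgroup_N_trans subgroup_Iso_aut N_trans_subset_Iso_aut])
  show "subgroup H_aut ?G"
    by (rule group.subgroup_incl[OF group_Iso_M subgroup_H_aut subgroup_Iso_aut H_aut_subset_Iso_aut])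
  show "N_trans \<lhd> ?G"
  proof (rule group.normalI[OF group.subgroup_imp_group[OF group_Iso_M subgroup_Iso_aut] N], intro ballI)
    fix f assume "f \<in> carrier ?G"
    then obtain n \<phi> where f: "f = nmult n \<circ> \<phi>" "\<phi> \<in> H_aut" by (auto elim: Iso_autE)
    \<comment> \<open>Conjugation by \<open>f\<close> turns the translation by \<open>m\<close> into
      that by the product of \<open>n\<close>, \<open>\<phi> m\<close> and the inverse
      \<open>- n\<close>. Surjectivity of \<open>\<phi>\<close> gives the other inclusion of
      cosets.\<close>
    have l: "f \<circ> nmult m = nmult (nmult (nmult n (\<phi> m)) (- n)) \<circ> f" for m
      by (rule ext) (simp add: f(1) H_autD(3)[OF f(2)] nmult_assoc[symmetric] del: nmult.simps)
    have "\<exists>k. nmult m \<circ> f = f \<circ> nmult k" for m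
    proof -
      have "surj \<phi>" using IsometriesD(1)[OF H_autD(1)[OF f(2)]] bij_is_surj by blast
      then obtain k where "nmult (- n) (nmult m n) = \<phi> k" by (metis surjD)
      then have "nmult (nmult n (\<phi> k)) (- n) = m"
        by (metis nmult_assoc nmult_uminus nmult_zero)
      then show ?thesis using l[of k] by metis
    qed
    then show "N_trans #>\<^bsub>?G\<^esub> f = f <#\<^bsub>?G\<^esub> N_trans"
      using l by (auto simp: r_coset_def l_coset_def N_trans_def)
  qed
  show "N_trans \<inter> H_aut = {\<one>\<^bsub>?G\<^esub>}"
  proof -
    have "f = id" if "f \<in> N_trans" "f \<in> H_aut" for f
    proof -
      from that(1) obtain n where "f = nmult n" unfolding N_trans_def by blast
      then have "n = 0" using H_autD(5)[OF that(2)] by simp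
      then show ?thesis using \<open>f = nmult n\<close> nmult_0_id by simp
    qed
    moreover have "id \<in> N_trans" using nmult_0_id unfolding N_trans_def by (metis rangeI)
    ultimately show ?thesis using id_H_aut by auto
  qed
  show "N_trans <#>\<^bsub>?G\<^esub> H_aut = carrier ?G"
    unfolding set_mult_def N_trans_def Iso_aut_def by (simp del: split_paired_Ex) blast
qed

lemma N_trans_H_stab: "N_trans <#>\<^bsub>Iso_M\<^esub> H_stab = Isometries"
proof
  show "N_trans <#>\<^bsub>Iso_M\<^esub> H_stab \<subseteq> Isometries"
    by (auto simp: set_mult_def N_trans_def H_stab_def intro!: Isometries_comp)
  show "Isometries \<subseteq> N_trans <#>\<^bsub>Iso_M\<^esub> H_stab"
  proof
    fix f assume f: "f \<in> Isometries"
    define n where "n = f 0"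
    have "nmult (- n) \<circ> f \<in> H_stab"
      using f by (simp add: H_stab_def Isometries_comp origin n_def)
    moreover have "f = nmult n \<circ> (nmult (- n) \<circ> f)"
      by (simp add: o_assoc nmult_comp nmult_0_id)
    ultimately show "f \<in> N_trans <#>\<^bsub>Iso_M\<^esub> H_stab"
      unfolding set_mult_def N_trans_def by (simp del: split_paired_Ex) blast
  qed
qed

section \<open>Discrete invariants of an isometry\<close>

text \<open>The invariants use values of \<open>f\<close> at finitely many points rather than
  derivatives, so that they are continuous for the compact-open topology.\<close>

definition t_sign :: "(point \<Rightarrow> point) \<Rightarrow> real" where
  "t_sign f = fst (f (1, 0, 0, 0)) - fst (f (0, 0, 0, 0))"

text \<open>The determinant of the action on \<open>w\<close> over \<open>t = 0\<close>. By the
  classification an isometry acts there by an affine map of the \<open>w\<close>-plane, so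
  differences of values give its linear part exactly.\<close>

definition w_sign :: "(point \<Rightarrow> point) \<Rightarrow> real" where
  "w_sign f =
     (fst (snd (f (0, 1, 0, 0))) - fst (snd (f (0, 0, 0, 0)))) *
     (fst (snd (snd (f (0, 0, 1, 0)))) - fst (snd (snd (f (0, 0, 0, 0))))) -
     (fst (snd (snd (f (0, 1, 0, 0)))) - fst (snd (snd (f (0, 0, 0, 0))))) *
     (fst (snd (f (0, 0, 1, 0))) - fst (snd (f (0, 0, 0, 0))))"

lemma continuous_map_eval_comp:
  assumes "continuous_on UNIV (h :: point \<Rightarrow> real)"
  shows "continuous_map Iso_top euclidean (\<lambda>f. h (f p))"
  using continuous_map_compose[OF continuous_map_eval, of euclidean h p] assms by (simp add: o_def)

lemma continuous_map_signs:
  "continuous_map Iso_top euclidean t_sign" "continuous_map Iso_top euclidean w_sign"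
  unfolding t_sign_def[abs_def] w_sign_def[abs_def]
  by (intro continuous_map_diff continuous_map_real_mult continuous_map_eval_comp continuous_intros)+

text \<open>A left translation is a Heisenberg map times a shift of \<open>t\<close>;
  \<open>rot_heis\<close> carries the shift past the second Heisenberg map, and the two Heisenberg
  maps merge.\<close>

lemma isometry_normal_form:
  assumes f: "f \<in> Isometries"
  obtains a b c d k s \<theta> g g' where "f = heis a b c d k \<circ> rot s \<theta> \<circ> g \<circ> g'"
    "g = id \<or> g = refl_w" "g' = id \<or> g' = neg_t"
proof -
  obtain n a b \<theta> g g' where f: "f = nmult n \<circ> heis a b (- a) (- b) 0 \<circ> rot 0 \<theta> \<circ> g \<circ> g'"
    and g: "g = id \<or> g = refl_w" "g' = id \<or> g' = neg_t"
    by (rule isometry_cases[OF f])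
  obtain s x y z where n: "n = (s, x, y, z)" by (cases n)
  have "nmult n \<circ> heis a b (- a) (- b) 0 \<circ> rot 0 \<theta> =
      heis x y 0 0 z \<circ> (rot s 0 \<circ> heis a b (- a) (- b) 0) \<circ> rot 0 \<theta>"
    by (simp add: nmult_eq n o_assoc)
  also have "\<dots> = (heis x y 0 0 z \<circ> heis a b (osc1 (- a) (- b) (- s)) (osc2 (- a) (- b) (- s)) 0)
      \<circ> (rot s 0 \<circ> rot 0 \<theta>)"
    unfolding rot_heis by (simp add: o_assoc)
  also have "rot s 0 \<circ> rot 0 \<theta> = rot s \<theta>" by (rule ext) (simp add: rot_rot del: rot.simps)
  finally obtain a1 b1 c1 d1 k1 where
    "nmult n \<circ> heis a b (- a) (- b) 0 \<circ> rot 0 \<theta> = heis a1 b1 c1 d1 k1 \<circ> rot s \<theta>"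
    unfolding heis_comp by blast
  with f have "f = heis a1 b1 c1 d1 k1 \<circ> rot s \<theta> \<circ> g \<circ> g'" by simp
  from that[OF this g] show ?thesis .
qed

lemma isometry_signs:
  assumes f: "f \<in> Isometries"
  shows "t_sign f \<in> {1, -1}" "w_sign f \<in> {1, -1}"
    "t_sign f = 1 \<Longrightarrow> w_sign f = 1 \<Longrightarrow> \<exists>a b c d k s \<theta>. f = heis a b c d k \<circ> rot s \<theta>"
proof -
  obtain a b c d k s \<theta> g g' where f: "f = heis a b c d k \<circ> rot s \<theta> \<circ> g \<circ> g'"
    and g: "g = id \<or> g = refl_w" "g' = id \<or> g' = neg_t"
    by (rule isometry_normal_form[OF f])
  have t: "t_sign f = (if g' = id then 1 else -1)"
    using g by (auto simp: f t_sign_def)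
  have w: "w_sign f = (if g = id then 1 else -1) * (if g' = id then 1 else -1)"
    using g cos_square[of \<theta>] by (auto simp: f w_sign_def)
  show "t_sign f \<in> {1, -1}" "w_sign f \<in> {1, -1}" by (auto simp: t w)
  show "\<exists>a b c d k s \<theta>. f = heis a b c d k \<circ> rot s \<theta>" if "t_sign f = 1" "w_sign f = 1"
  proof -
    have "g' = id" "g = id" using that unfolding t w by (auto split: if_splits)
    then have "f = heis a b c d k \<circ> rot s \<theta>" using f by simp
    then show ?thesis by blast
  qed
qed

text \<open>A connected image containing both \<open>-1\<close> and \<open>1\<close> would contain
  \<open>0\<close>.\<close>

lemma connected_sign_const:
  assumes S: "connectedin Iso_top S" and h: "continuous_map Iso_top euclidean h"
    and sg: "\<And>f. f \<in> S \<Longrightarrow> h f \<in> {1, -1::real}" and f: "f \<in> S" "g \<in> S"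
  shows "h f = h g"
proof (rule ccontr)
  assume ne: "h f \<noteq> h g"
  have "connected (h ` S)"
    using connectedin_continuous_map_image[OF h S] by (simp add: connectedin_iff_connected)
  moreover have "-1 \<in> h ` S" "1 \<in> h ` S"
    using ne sg[OF f(1)] sg[OF f(2)] f by (auto simp: image_iff) metis+
  ultimately have "{-1..1} \<subseteq> h ` S" by (rule connected_contains_Icc)
  then have "0 \<in> h ` S" by auto
  then show False using sg by fastforce
qed

text \<open>\<open>id\<close> and \<open>neg_t\<close> both lie in \<open>H_aut\<close> and are
  separated by \<open>t_sign\<close>.\<close>

lemma not_connected_H_aut: "\<not> connectedin Iso_top H_aut"
proof
  assume H: "connectedin Iso_top H_aut"
  have "t_sign neg_t = t_sign id"
    by (rule connected_sign_const[OF H continuous_map_signs(1) isometry_signs(1)[OF H_autD(1)] neg_t_H_aut id_H_aut])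
  then show False by (simp add: t_sign_def)
qed

section \<open>Normal nilpotent subgroups\<close>

definition Heis :: "(point \<Rightarrow> point) set" where
  "Heis = {heis a b c d k | a b c d k. True}"

lemma heis_Heis [simp]: "heis a b c d k \<in> Heis"
  unfolding Heis_def by blast

lemma HeisE:
  assumes "f \<in> Heis"
  obtains a b c d k where "f = heis a b c d k"
  using assms by (auto simp: Heis_def)

lemma inv_heis: "inv_into UNIV (heis a b c d k) = heis (- a) (- b) (- c) (- d) (- k)"
  by (rule inv_unique_comp[OF heis_inverse])

lemma subgroup_Heis: "subgroup Heis Iso_M"
proof (rule group.subgroupI[OF group_Iso_M])
  show "Heis \<noteq> {}" using heis_Heis by blast
qed (auto elim!: HeisE simp: Iso_M_inv inv_heis heis_comp)

lemma Heis_normalized_comp: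
  assumes "\<And>h. h \<in> Heis \<Longrightarrow> \<exists>h'\<in>Heis. F \<circ> h = h' \<circ> F"
    and "\<And>h. h \<in> Heis \<Longrightarrow> \<exists>h'\<in>Heis. G \<circ> h = h' \<circ> G" and "h \<in> Heis"
  shows "\<exists>h'\<in>Heis. (F \<circ> G) \<circ> h = h' \<circ> (F \<circ> G)"
proof -
  obtain h' where h': "h' \<in> Heis" "G \<circ> h = h' \<circ> G" using assms(2,3) by blast
  obtain h'' where h'': "h'' \<in> Heis" "F \<circ> h' = h'' \<circ> F" using assms(1) h'(1) by blast
  have "(F \<circ> G) \<circ> h = F \<circ> (G \<circ> h)" by (rule o_assoc[symmetric])
  also have "\<dots> = (F \<circ> h') \<circ> G" by (simp only: h'(2) o_assoc)
  also have "\<dots> = h'' \<circ> (F \<circ> G)" by (simp only: h''(2) o_assoc)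
  finally show ?thesis using h''(1) by blast
qed

text \<open>Conjugation within the Heisenberg group changes only the central parameter, by the
  symplectic form of signature type (area of the first pair minus area of the second).\<close>

lemma heis_heis_commute:
  "heis a b c d k \<circ> heis a' b' c' d' k' =
    heis a' b' c' d' (k' + (a * b' - b * a') - (c * d' - d * c')) \<circ> heis a b c d k"
proof -
  have "k + k' + (a * b' - b * a') / 2 - (c * d' - d * c') / 2 =
      k' + (a * b' - b * a') - (c * d' - d * c') + k + (a' * b - b' * a) / 2 - (c' * d - d' * c) / 2"
    by (simp add: field_simps)
  then show ?thesis unfolding heis_comp by (simp only: add.commute[of a] add.commute[of b] add.commute[of c] add.commute[of d])
qed

text \<open>Each factor of the normal form normalizes \<open>Heis\<close>, by the commutation
  rules.\<close>

lemma Heis_normalized: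
  assumes "f \<in> Isometries" "h \<in> Heis"
  shows "\<exists>h'\<in>Heis. f \<circ> h = h' \<circ> f"
proof -
  have 1: "\<exists>h'\<in>Heis. heis a b c d k \<circ> h = h' \<circ> heis a b c d k" if "h \<in> Heis" for a b c d k h
    using that heis_heis_commute heis_Heis by (elim HeisE) blast
  have 2: "\<exists>h'\<in>Heis. rot s \<theta> \<circ> h = h' \<circ> rot s \<theta>" if "h \<in> Heis" for s \<theta> h
    using that rot_heis heis_Heis by (elim HeisE) blast
  have 3: "\<exists>h'\<in>Heis. g \<circ> h = h' \<circ> g" if "h \<in> Heis" "g = id \<or> g = refl_w" for g h
    using that refl_w_heis heis_Heis by (elim HeisE disjE) (simp, blast)
  have 4: "\<exists>h'\<in>Heis. g \<circ> h = h' \<circ> g" if "h \<in> Heis" "g = id \<or> g = neg_t" for g h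
    using that neg_t_heis heis_Heis by (elim HeisE disjE) (simp, blast)
  obtain a b c d k s \<theta> g g' where f: "f = heis a b c d k \<circ> rot s \<theta> \<circ> g \<circ> g'"
    and g: "g = id \<or> g = refl_w" "g' = id \<or> g' = neg_t"
    by (rule isometry_normal_form[OF assms(1)])
  show ?thesis
    unfolding f by (intro Heis_normalized_comp 1 2 3[OF _ g(1)] 4[OF _ g(2)] assms(2))
qed

lemma normal_Heis: "Heis \<lhd> Iso_M"
proof (unfold group.normal_inv_iff[OF group_Iso_M], intro conjI ballI)
  fix f h assume "f \<in> carrier Iso_M" and h: "h \<in> Heis"
  then have f: "f \<in> Isometries" by simp
  from Heis_normalized[OF f h] obtain h' where h': "h' \<in> Heis" "f \<circ> h = h' \<circ> f" by blast
  have "f \<circ> inv_into UNIV f = id" by (rule surj_iff[THEN iffD1, OF bij_is_surj[OF IsometriesD(1)[OF f]]])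
  then have "f \<circ> h \<circ> inv_into UNIV f = h'" unfolding h'(2) by (simp add: o_assoc[symmetric])
  then show "f \<otimes>\<^bsub>Iso_M\<^esub> h \<otimes>\<^bsub>Iso_M\<^esub> inv\<^bsub>Iso_M\<^esub> f \<in> Heis"
    using h'(1) by (simp add: Iso_M_inv[OF f])
qed (rule subgroup_Heis)

lemma group_Heis: "group (Iso_M\<lparr>carrier := Heis\<rparr>)"
  by (rule group.subgroup_imp_group[OF group_Iso_M subgroup_Heis])

lemma inv_restrict:
  assumes "subgroup K Iso_M" "f \<in> K"
  shows "inv\<^bsub>Iso_M\<lparr>carrier := K\<rparr>\<^esub> f = inv_into UNIV f"
  using group.m_inv_consistent[OF group_Iso_M assms] subgroup.subset[OF assms(1)] assms(2) Iso_M_inv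
  by auto

text \<open>The nilpotency class is two: commutators lie in the group \<open>Z\<close> of pure
  \<open>z\<close>-shifts, and commutators with elements of \<open>Z\<close> are trivial.\<close>

lemma nilpotent_Heis: "nilpotent_group (Iso_M\<lparr>carrier := Heis\<rparr>)"
proof -
  let ?G = "Iso_M\<lparr>carrier := Heis\<rparr>"
  define Z where "Z = {heis 0 0 0 0 k | k. True}"
  have heis_Z: "heis 0 0 0 0 k \<in> Z" for k unfolding Z_def by blast
  have "subgroup Z Iso_M"
  proof (rule group.subgroupI[OF group_Iso_M])
    show "Z \<noteq> {}" using heis_Z by blast
  qed (auto simp: Z_def Iso_M_inv inv_heis heis_comp heis_Z[unfolded Z_def, simplified])
  then have Z: "subgroup Z ?G"
    by (rule group.subgroup_incl[OF group_Iso_M _ subgroup_Heis]) (auto simp: Z_def)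
  have comm: "x \<otimes>\<^bsub>?G\<^esub> y \<otimes>\<^bsub>?G\<^esub> inv\<^bsub>?G\<^esub> x \<otimes>\<^bsub>?G\<^esub> inv\<^bsub>?G\<^esub> y = heis 0 0 0 0 ((a * b' - b * a') - (c * d' - d * c'))"
    if "x = heis a b c d k" "y = heis a' b' c' d' k'" for x y a b c d k a' b' c' d' k'
    using that by (simp add: inv_restrict[OF subgroup_Heis] inv_heis heis_comp)
      (rule arg_cong[of _ _ "heis 0 0 0 0"], simp add: field_simps)
  have in_Z: "x \<otimes>\<^bsub>?G\<^esub> y \<otimes>\<^bsub>?G\<^esub> inv\<^bsub>?G\<^esub> x \<otimes>\<^bsub>?G\<^esub> inv\<^bsub>?G\<^esub> y \<in> Z" if "x \<in> Heis" "y \<in> Heis" for x y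
  proof -
    from that obtain a b c d k a' b' c' d' k' where "x = heis a b c d k" "y = heis a' b' c' d' k'"
      by (elim HeisE)
    from comm[OF this] heis_Z show ?thesis by simp
  qed
  have 1: "lower_central ?G (Suc 0) \<subseteq> Z"
    unfolding lower_central.simps
    by (rule group.generate_subgroup_incl[OF group_Heis _ Z]) (use in_Z in auto)
  have "{x \<otimes>\<^bsub>?G\<^esub> y \<otimes>\<^bsub>?G\<^esub> inv\<^bsub>?G\<^esub> x \<otimes>\<^bsub>?G\<^esub> inv\<^bsub>?G\<^esub> y | x y. x \<in> carrier ?G \<and> y \<in> lower_central ?G (Suc 0)}
      \<subseteq> {\<one>\<^bsub>?G\<^esub>}"
  proof (clarsimp simp del: lower_central.simps)
    fix x y assume "x \<in> Heis" "y \<in> lower_central ?G (Suc 0)"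
    then obtain a b c d k k' where "x = heis a b c d k" "y = heis 0 0 0 0 k'"
      using 1 by (auto elim!: HeisE simp: Z_def)
    from comm[OF this] show "x \<circ> y \<circ> inv\<^bsub>?G\<^esub> x \<circ> inv\<^bsub>?G\<^esub> y = id"
      by (simp add: heis_zero)
  qed
  then have "lower_central ?G (Suc (Suc 0)) \<subseteq> {\<one>\<^bsub>?G\<^esub>}"
    unfolding lower_central.simps(2)[of ?G "Suc 0"]
    by (rule group.generate_subgroup_incl[OF group_Heis _ group.triv_subgroup[OF group_Heis]])
  moreover have "\<one>\<^bsub>?G\<^esub> \<in> lower_central ?G (Suc (Suc 0))"
    unfolding lower_central.simps(2)[of ?G "Suc 0"] by (rule generate.one)
  ultimately have "lower_central ?G (Suc (Suc 0)) = {\<one>\<^bsub>?G\<^esub>}" by blast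
  then show ?thesis using group_Heis unfolding nilpotent_group_def by blast
qed

definition heis_c :: "complex \<Rightarrow> complex \<Rightarrow> real \<Rightarrow> point \<Rightarrow> point" where
  "heis_c \<alpha> \<beta> k = heis (Re \<alpha>) (Im \<alpha>) (Re \<beta>) (Im \<beta>) k"

text \<open>Conjugation by \<open>rot\<close> multiplies the complex parameters by
  \<open>cis \<theta>\<close> and \<open>cis (\<theta> - s)\<close>, and conjugation by
  \<open>heis\<close> affects \<open>k\<close> only. The commutator subtracts \<open>1\<close> from
  each multiplier; the central parameter is left open because it does not influence later
  commutators.\<close>

lemma heis_c_commutator:
  assumes f: "f = heis a b c d k0 \<circ> rot s \<theta>"
  shows "\<exists>k'. f \<circ> heis_c \<alpha> \<beta> k \<circ> inv_into UNIV f \<circ> inv_into UNIV (heis_c \<alpha> \<beta> k)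
    = heis_c ((cis \<theta> - 1) * \<alpha>) ((cis (\<theta> - s) - 1) * \<beta>) k'"
proof -
  have F: "f \<in> Isometries" unfolding f by (intro Isometries_comp) simp_all
  have rot: "rot s \<theta> \<circ> heis_c \<alpha> \<beta> k = heis_c (cis \<theta> * \<alpha>) (cis (\<theta> - s) * \<beta>) k \<circ> rot s \<theta>"
    unfolding heis_c_def rot_heis by (simp add: osc1_def osc2_def mult.commute)
  define A B where "A = cis \<theta> * \<alpha>" and "B = cis (\<theta> - s) * \<beta>"
  define k1 where "k1 = k + (a * Im A - b * Re A) - (c * Im B - d * Re B)"
  have "heis a b c d k0 \<circ> heis_c A B k = heis_c A B k1 \<circ> heis a b c d k0"
    unfolding heis_c_def k1_def by (rule heis_heis_commute)
  then have "heis a b c d k0 \<circ> heis_c A B k \<circ> rot s \<theta> = heis_c A B k1 \<circ> f"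
    unfolding f by (simp only: o_assoc)
  moreover have "f \<circ> heis_c \<alpha> \<beta> k = heis a b c d k0 \<circ> heis_c A B k \<circ> rot s \<theta>"
    unfolding f o_assoc[symmetric] rot A_def B_def ..
  ultimately have 1: "f \<circ> heis_c \<alpha> \<beta> k = heis_c A B k1 \<circ> f" by simp
  have "f \<circ> inv_into UNIV f = id" by (rule surj_iff[THEN iffD1, OF bij_is_surj[OF IsometriesD(1)[OF F]]])
  then have "f \<circ> heis_c \<alpha> \<beta> k \<circ> inv_into UNIV f = heis_c A B k1"
    unfolding 1 by (simp add: o_assoc[symmetric])
  then have "f \<circ> heis_c \<alpha> \<beta> k \<circ> inv_into UNIV f \<circ> inv_into UNIV (heis_c \<alpha> \<beta> k)
      = heis_c A B k1 \<circ> inv_into UNIV (heis_c \<alpha> \<beta> k)" by simp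
  moreover have "\<exists>k'. heis_c A B k1 \<circ> inv_into UNIV (heis_c \<alpha> \<beta> k) = heis_c (A - \<alpha>) (B - \<beta>) k'"
    unfolding heis_c_def inv_heis heis_comp by auto
  ultimately show ?thesis by (simp add: A_def B_def algebra_simps)
qed

lemma normal_nilpotent_rotation:
  assumes K: "K \<lhd> Iso_M" and nil: "nilpotent_group (Iso_M\<lparr>carrier := K\<rparr>)"
    and f: "f \<in> K" "f = heis a b c d k \<circ> rot s \<theta>"
  shows "cis \<theta> = 1 \<and> cis s = 1"
proof -
  let ?G = "Iso_M\<lparr>carrier := K\<rparr>"
  have sub: "subgroup K Iso_M" using K normal_imp_subgroup by blast
  then have KI: "K \<subseteq> Isometries" using subgroup.subset by fastforce
  have "\<exists>k'. heis_c ((cis \<theta> - 1) ^ Suc j) ((cis (\<theta> - s) - 1) ^ Suc j) k' \<in> K \<inter> lower_central ?G j" for j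
  proof (induction j)
    case 0
    \<comment> \<open>\<open>heis_c 1 1 0\<close> may lie outside \<open>K\<close>, but by normality
      its commutator with \<open>f\<close> lies in \<open>K\<close>, which is term \<open>0\<close>
      of the lower central series. The parameters \<open>1\<close>, \<open>1\<close> make powers of
      both multipliers visible.\<close>
    obtain k' where k': "f \<circ> heis_c 1 1 0 \<circ> inv_into UNIV f \<circ> inv_into UNIV (heis_c 1 1 0)
        = heis_c ((cis \<theta> - 1) * 1) ((cis (\<theta> - s) - 1) * 1) k'"
      using heis_c_commutator[OF f(2)] by blast
    have h: "heis_c 1 1 0 \<in> Isometries" by (simp add: heis_c_def)
    have "heis_c 1 1 0 \<circ> inv_into UNIV f \<circ> inv_into UNIV (heis_c 1 1 0) \<in> K"
      using normal.inv_op_closed2[OF K, of "heis_c 1 1 0" "inv_into UNIV f"] h f(1)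
        subgroup.m_inv_closed[OF sub f(1)] KI Iso_M_inv by auto
    then have "f \<circ> (heis_c 1 1 0 \<circ> inv_into UNIV f \<circ> inv_into UNIV (heis_c 1 1 0)) \<in> K"
      using subgroup.m_closed[OF sub f(1)] by simp
    then show ?case using k' by (auto simp: o_assoc)
  next
    case (Suc j)
    then obtain k1 where k1: "heis_c ((cis \<theta> - 1) ^ Suc j) ((cis (\<theta> - s) - 1) ^ Suc j) k1 \<in> K \<inter> lower_central ?G j"
      (is "?y \<in> _") by blast
    obtain k' where k': "f \<circ> ?y \<circ> inv_into UNIV f \<circ> inv_into UNIV ?y
        = heis_c ((cis \<theta> - 1) ^ Suc (Suc j)) ((cis (\<theta> - s) - 1) ^ Suc (Suc j)) k'"
      using heis_c_commutator[OF f(2)] unfolding power_Suc[of _ "Suc j"] by blast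
    have "f \<circ> ?y \<circ> inv_into UNIV f \<circ> inv_into UNIV ?y = f \<otimes>\<^bsub>?G\<^esub> ?y \<otimes>\<^bsub>?G\<^esub> inv\<^bsub>?G\<^esub> f \<otimes>\<^bsub>?G\<^esub> inv\<^bsub>?G\<^esub> ?y"
      using k1 f(1) by (simp add: inv_restrict[OF sub])
    moreover have "f \<otimes>\<^bsub>?G\<^esub> ?y \<otimes>\<^bsub>?G\<^esub> inv\<^bsub>?G\<^esub> f \<otimes>\<^bsub>?G\<^esub> inv\<^bsub>?G\<^esub> ?y \<in> lower_central ?G (Suc j)"
      using k1 f(1) unfolding lower_central.simps by (intro generate.incl) auto
    moreover have "f \<otimes>\<^bsub>?G\<^esub> ?y \<otimes>\<^bsub>?G\<^esub> inv\<^bsub>?G\<^esub> f \<otimes>\<^bsub>?G\<^esub> inv\<^bsub>?G\<^esub> ?y \<in> K"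
      using k1 f(1) subgroup.m_closed[OF sub] subgroup.m_inv_closed[OF sub] KI
      by (simp add: inv_restrict[OF sub] Iso_M_inv subset_iff)
    ultimately show ?case using k' by auto
  qed
  moreover obtain j where "lower_central ?G j = {\<one>\<^bsub>?G\<^esub>}" using nil unfolding nilpotent_group_def by blast
  ultimately obtain k' where "heis_c ((cis \<theta> - 1) ^ Suc j) ((cis (\<theta> - s) - 1) ^ Suc j) k' = id" by fastforce
  then have "heis_c ((cis \<theta> - 1) ^ Suc j) ((cis (\<theta> - s) - 1) ^ Suc j) k' = heis 0 0 0 0 0"
    using heis_zero by simp
  then have "(cis \<theta> - 1) ^ Suc j = 0 \<and> (cis (\<theta> - s) - 1) ^ Suc j = 0"
    unfolding heis_c_def by (auto dest!: heis_inject simp: complex_eq_iff simp del: power_Suc)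
  then have 1: "cis \<theta> = 1" "cis (\<theta> - s) = 1" by auto
  have "cis s = cis \<theta> * inverse (cis (\<theta> - s))" by (simp add: cis_mult)
  then show ?thesis using 1 by simp
qed

lemma normal_nilpotent_subset_Heis:
  assumes K: "K \<lhd> Iso_M" and nil: "nilpotent_group (Iso_M\<lparr>carrier := K\<rparr>)"
    and conn: "connectedin Iso_top K"
  shows "K \<subseteq> Heis"
proof -
  have sub: "subgroup K Iso_M" using K normal_imp_subgroup by blast
  then have KI: "K \<subseteq> Isometries" using subgroup.subset by fastforce
  have id: "id \<in> K" using subgroup.one_closed[OF sub] by simp
  \<comment> \<open>Connectedness fixes both signs at their values on \<open>id\<close> and so
    excludes the two reflections.\<close>
  have form: "\<exists>a b c d k s \<theta>. f = heis a b c d k \<circ> rot s \<theta> \<and> cis \<theta> = 1 \<and> cis s = 1" if f: "f \<in> K" for f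
  proof -
    have "t_sign f = t_sign id"
      by (rule connected_sign_const[OF conn continuous_map_signs(1) _ f id]) (use KI isometry_signs in blast)
    moreover have "w_sign f = w_sign id"
      by (rule connected_sign_const[OF conn continuous_map_signs(2) _ f id]) (use KI isometry_signs in blast)
    moreover have "t_sign id = 1" "w_sign id = 1" by (simp_all add: t_sign_def w_sign_def)
    ultimately obtain a b c d k s \<theta> where *: "f = heis a b c d k \<circ> rot s \<theta>"
      using isometry_signs(3)[of f] subsetD[OF KI f] by metis
    then show ?thesis using normal_nilpotent_rotation[OF K nil f *] by blast
  qed
  have cos: "cos (fst (f (0, 0, 0, 0))) = 1" if "f \<in> K" for f
    using form[OF that] by (auto simp: complex_eq_iff)
  \<comment> \<open>The \<open>t\<close>-shifts of elements of \<open>K\<close> form a connected set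
    that contains \<open>0\<close> and on which \<open>cos\<close> equals \<open>1\<close>. A
    nonzero shift is at least \<open>2 * pi\<close> in modulus, so \<open>pi\<close> or
    \<open>- pi\<close> would belong to the set.\<close>
  have zero: "fst (f (0, 0, 0, 0)) = 0" if f: "f \<in> K" for f
  proof (rule ccontr)
    define T where "T = (\<lambda>f :: point \<Rightarrow> point. fst (f (0, 0, 0, 0)))"
    assume "fst (f (0, 0, 0, 0)) \<noteq> 0"
    then have ne: "T f \<noteq> 0" by (simp add: T_def)
    have "continuous_map Iso_top euclidean T"
      unfolding T_def by (intro continuous_map_eval_comp continuous_intros)
    then have con: "connected (T ` K)"
      using connectedin_continuous_map_image conn by (fastforce simp: connectedin_iff_connected)
    have 0: "0 \<in> T ` K" using id by (force simp: T_def)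
    obtain n :: int where n: "T f = of_int n * 2 * pi"
      using cos[OF f] cos_one_2pi_int[of "T f"] by (auto simp: T_def)
    have "pi \<in> T ` K \<or> - pi \<in> T ` K"
    proof (cases "n > 0")
      case True
      then have "1 * pi \<le> (of_int n * 2) * pi" by (intro mult_right_mono) auto
      then have "pi \<in> {0..T f}" by (simp add: n)
      then show ?thesis using connected_contains_Icc[OF con 0, of "T f"] f by blast
    next
      case False
      with ne n have "n < 0" by (cases "n = 0") auto
      then have "(of_int n * 2) * pi \<le> (-1) * pi" by (intro mult_right_mono) auto
      then have "- pi \<in> {T f..0}" by (simp add: n)
      then show ?thesis using connected_contains_Icc[OF con _ 0, of "T f"] f by blast
    qed
    moreover have "cos r = 1" if "r \<in> T ` K" for r using that cos by (auto simp: T_def)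
    ultimately have "cos pi = 1 \<or> cos (- pi) = 1" by blast
    then show False by simp
  qed
  show ?thesis
  proof
    fix f assume f: "f \<in> K"
    then obtain a b c d k s \<theta> where *: "f = heis a b c d k \<circ> rot s \<theta>" "cis \<theta> = 1"
      using form by blast
    have "s = 0" using zero[OF f] * by simp
    moreover have "cos \<theta> = 1" "sin \<theta> = 0" using *(2) by (auto simp: complex_eq_iff)
    ultimately have "rot s \<theta> = id" by (auto simp: fun_eq_iff)
    then show "f \<in> Heis" using * by simp
  qed
qed

section \<open>The Lie group structure of the nilradical\<close>

definition low :: "nat \<Rightarrow> (nat \<Rightarrow> real) \<Rightarrow> nat \<Rightarrow> real" where
  "low n u = (\<lambda>i. if i < n then u i else 0)"

definition high :: "nat \<Rightarrow> (nat \<Rightarrow> real) \<Rightarrow> nat \<Rightarrow> real" where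
  "high n u = (\<lambda>i. u (i + n))"

lemma low_Rn: "low n u \<in> Rn n"
  by (simp add: low_def topspace_Euclidean_space)

lemma high_Rn: "u \<in> Rn (n + m) \<Longrightarrow> high n u \<in> Rn m"
  by (simp add: high_def topspace_Euclidean_space)

text \<open>When both charts are global, the product chart is a bijection onto the full model space,
  and \<open>low\<close> and \<open>high\<close> recover the coordinates of the factors.\<close>

lemma prod_chart_global:
  assumes \<phi>: "bij_betw \<phi> A (Rn n)" and \<psi>: "bij_betw \<psi> B (Rn m)"
  shows "snd (prod_chart n (A, \<phi>) (B, \<psi>)) ` (A \<times> B) = Rn (n + m)"
    and "u \<in> Rn (n + m) \<Longrightarrow> inv_into (A \<times> B) (snd (prod_chart n (A, \<phi>) (B, \<psi>))) u
      = (inv_into A \<phi> (low n u), inv_into B \<psi> (high n u))"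
proof -
  let ?c = "snd (prod_chart n (A, \<phi>) (B, \<psi>))"
  have c: "?c (p, q) = (\<lambda>i. if i < n then \<phi> p i else \<psi> q (i - n))" for p q
    by (simp add: prod_chart_def cong: if_cong)
  have mem: "?c (p, q) \<in> Rn (n + m)" if "p \<in> A" "q \<in> B" for p q
  proof -
    have "\<psi> q \<in> Rn m" using \<psi> that by (auto simp: bij_betw_def)
    then show ?thesis by (auto simp: c topspace_Euclidean_space)
  qed
  have split: "low n (?c (p, q)) = \<phi> p" "high n (?c (p, q)) = \<psi> q" if "p \<in> A" "q \<in> B" for p q
  proof -
    have "\<phi> p \<in> Rn n" using \<phi> that by (auto simp: bij_betw_def)
    then show "low n (?c (p, q)) = \<phi> p" by (auto simp: c low_def topspace_Euclidean_space fun_eq_iff)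
    show "high n (?c (p, q)) = \<psi> q" by (simp add: c high_def)
  qed
  have inj: "inj_on ?c (A \<times> B)"
  proof (rule inj_onI, clarify)
    fix p q p' q' assume m: "p \<in> A" "q \<in> B" "p' \<in> A" "q' \<in> B" and "?c (p, q) = ?c (p', q')"
    then have "\<phi> p = \<phi> p'" "\<psi> q = \<psi> q'" using split by metis+
    then show "p = p' \<and> q = q'" using \<phi> \<psi> m by (auto simp: bij_betw_def dest: inj_onD)
  qed
  have inv: "(inv_into A \<phi> (low n u), inv_into B \<psi> (high n u)) \<in> A \<times> B"
    "?c (inv_into A \<phi> (low n u), inv_into B \<psi> (high n u)) = u" if u: "u \<in> Rn (n + m)" for u
  proof -
    have "low n u \<in> \<phi> ` A" "high n u \<in> \<psi> ` B"
      using \<phi> \<psi> low_Rn high_Rn[OF u] by (auto simp: bij_betw_def)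
    then show "(inv_into A \<phi> (low n u), inv_into B \<psi> (high n u)) \<in> A \<times> B"
      "?c (inv_into A \<phi> (low n u), inv_into B \<psi> (high n u)) = u"
      by (auto simp: inv_into_into f_inv_into_f c fun_eq_iff low_def high_def)
  qed
  show "?c ` (A \<times> B) = Rn (n + m)"
  proof
    show "?c ` (A \<times> B) \<subseteq> Rn (n + m)" using mem by auto
    show "Rn (n + m) \<subseteq> ?c ` (A \<times> B)"
      using inv by (metis image_eqI subsetI)
  qed
  show "inv_into (A \<times> B) ?c u = (inv_into A \<phi> (low n u), inv_into B \<psi> (high n u))" if "u \<in> Rn (n + m)"
    by (rule inv_into_f_eq[OF inj inv(1)[OF that] inv(2)[OF that]])
qed

section \<open>Global coordinates and topology of the Heisenberg group\<close>

definition heis_of :: "(nat \<Rightarrow> real) \<Rightarrow> point \<Rightarrow> point" where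
  "heis_of u = heis (u 0) (u 1) (u 2) (u 3) (u 4)"

definition heis_coords :: "(point \<Rightarrow> point) \<Rightarrow> nat \<Rightarrow> real" where
  "heis_coords = inv_into (Rn 5) heis_of"

text \<open>Pulling the topology back from R^5 makes \<open>heis_coords\<close> a homeomorphism by
  construction. The relation to the compact-open topology then reduces to continuity of the
  inclusion.\<close>

definition Heis_top :: "(point \<Rightarrow> point) topology" where
  "Heis_top = pullback_topology Heis heis_coords (Euclidean_space 5)"

lemma less_5: "i < 5 \<longleftrightarrow> i = 0 \<or> i = 1 \<or> i = 2 \<or> i = 3 \<or> i = (4::nat)"
  by auto

lemma heis_of_Heis [simp]: "heis_of u \<in> Heis"
  by (simp add: heis_of_def)

lemma inj_heis_of: "inj_on heis_of (Rn 5)"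
proof (rule inj_onI)
  fix u v assume u: "u \<in> Rn 5" "v \<in> Rn 5" and "heis_of u = heis_of v"
  then have "\<forall>i<5. u i = v i"
    unfolding heis_of_def less_5 by (auto dest!: heis_inject)
  moreover have "u i = v i" if "\<not> i < 5" for i
    using u that by (auto simp: topspace_Euclidean_space)
  ultimately show "u = v" by blast
qed

lemma heis_of_image: "heis_of ` Rn 5 = Heis"
proof
  show "Heis \<subseteq> heis_of ` Rn 5"
  proof
    fix f assume "f \<in> Heis"
    then obtain a b c d k where f: "f = heis a b c d k" by (rule HeisE)
    define u :: "nat \<Rightarrow> real" where "u = (\<lambda>i. if i = 0 then a else if i = 1 then b else
      if i = 2 then c else if i = 3 then d else if i = 4 then k else 0)"
    have "u \<in> Rn 5" by (auto simp: u_def topspace_Euclidean_space)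
    moreover have "f = heis_of u" by (simp add: u_def f heis_of_def)
    ultimately show "f \<in> heis_of ` Rn 5" by blast
  qed
qed auto

lemma heis_coords_Rn: "f \<in> Heis \<Longrightarrow> heis_coords f \<in> Rn 5"
  unfolding heis_coords_def heis_of_image[symmetric] by (rule inv_into_into)

lemma heis_of_coords [simp]: "f \<in> Heis \<Longrightarrow> heis_of (heis_coords f) = f"
  unfolding heis_coords_def heis_of_image[symmetric] by (rule f_inv_into_f[of _ heis_of])

lemma heis_coords_of [simp]: "u \<in> Rn 5 \<Longrightarrow> heis_coords (heis_of u) = u"
  unfolding heis_coords_def by (rule inv_into_f_f[OF inj_heis_of])

lemma bij_heis_coords: "bij_betw heis_coords Heis (Rn 5)"
  by (rule bij_betwI[where g = heis_of]) (auto simp: heis_coords_Rn)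

lemma bij_coords: "bij_betw coords UNIV (Rn 4)"
  by (simp add: bij_betw_def inj_coords range_coords)

lemma inv_heis_coords: "u \<in> Rn 5 \<Longrightarrow> inv_into Heis heis_coords u = heis_of u"
  by (rule inv_into_f_eq) (use bij_heis_coords in \<open>auto simp: bij_betw_def\<close>)

lemma topspace_Heis_top [simp]: "topspace Heis_top = Heis"
  using heis_coords_Rn by (auto simp: Heis_top_def topspace_pullback_topology)

lemma continuous_map_heis_coords: "continuous_map Heis_top (Euclidean_space 5) heis_coords"
  unfolding Heis_top_def using continuous_map_pullback[OF continuous_map_id, of Heis heis_coords] by simp

lemma continuous_map_into_Heis_top:
  assumes "continuous_map T (Euclidean_space 5) (\<lambda>x. heis_coords (g x))" "\<And>x. x \<in> topspace T \<Longrightarrow> g x \<in> Heis"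
  shows "continuous_map T Heis_top g"
  unfolding Heis_top_def by (rule continuous_map_pullback') (use assms in \<open>auto simp: o_def\<close>)

lemma homeomorphic_map_heis_coords: "homeomorphic_map Heis_top (Euclidean_space 5) heis_coords"
proof -
  have "continuous_map (Euclidean_space 5) Heis_top heis_of"
    by (rule continuous_map_into_Heis_top) (rule continuous_map_eq[OF continuous_map_id], simp_all)
  then have "homeomorphic_maps Heis_top (Euclidean_space 5) heis_coords heis_of"
    by (simp add: homeomorphic_maps_def continuous_map_heis_coords)
  then show ?thesis by (rule homeomorphic_maps_imp_map)
qed

lemma homeomorphic_Heis_top: "Heis_top homeomorphic_space Euclidean_space 5"
  using homeomorphic_map_heis_coords homeomorphic_map_imp_homeomorphic_space by blast

lemma Euclidean_space_eq: "Euclidean_space n = subtopology euclidean (Rn n)"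
  by (simp add: Euclidean_space_def topspace_Euclidean_space euclidean_product_topology)

lemma second_countable_euclidean: "second_countable (euclidean :: 'a::second_countable_topology topology)"
proof -
  obtain B :: "'a set set" where B: "countable B" "topological_basis B" using ex_countable_basis by blast
  have "\<exists>V\<in>B. x \<in> V \<and> V \<subseteq> U" if "open U" "x \<in> U" for U x
    using topological_basisE[OF B(2) that] by metis
  then show ?thesis
    using B topological_basis_open unfolding second_countable_def open_openin[symmetric] by blast
qed

lemma smooth_manifold_Heis: "smooth_manifold Heis_top 5 {(Heis, heis_coords)}"
  unfolding smooth_manifold_def
proof (intro conjI)
  show "Hausdorff_space Heis_top"
    using homeomorphic_Hausdorff_space[OF homeomorphic_Heis_top] Hausdorff_Euclidean_space by blast
  show "second_countable Heis_top"
    unfolding homeomorphic_space_second_countability[OF homeomorphic_Heis_top]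
    by (subst Euclidean_space_eq) (rule second_countable_subtopology[OF second_countable_euclidean])
  show "topspace Heis_top = (\<Union>c\<in>{(Heis, heis_coords)}. fst c)" by simp
  have im: "heis_coords ` Heis = Rn 5" using bij_heis_coords by (simp add: bij_betw_def)
  show "\<forall>(U, \<phi>)\<in>{(Heis, heis_coords)}. openin Heis_top U \<and> openin (Euclidean_space 5) (\<phi> ` U) \<and>
      homeomorphic_map (subtopology Heis_top U) (subtopology (Euclidean_space 5) (\<phi> ` U)) \<phi>"
    using homeomorphic_map_heis_coords subtopology_topspace[of Heis_top] openin_topspace[of Heis_top]
    by (simp add: im)
  have "smooth_on 5 (Rn 5) (\<lambda>u. heis_coords (inv_into Heis heis_coords u) j)" for j
    by (rule smooth_on_trig_poly[OF trig_poly.coord[of j]]) (simp add: inv_heis_coords)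
  then show "\<forall>c\<in>{(Heis, heis_coords)}. \<forall>d\<in>{(Heis, heis_coords)}. smooth_in_charts 5 c 5 d (\<lambda>p. p)"
    by (simp add: smooth_in_charts_def im)
qed

definition heis_mult :: "(nat \<Rightarrow> real) \<Rightarrow> (nat \<Rightarrow> real) \<Rightarrow> nat \<Rightarrow> real" where
  "heis_mult u v i = (if i < 5 then u i + v i +
     (if i = 4 then (u 0 * v 1 - u 1 * v 0) / 2 - (u 2 * v 3 - u 3 * v 2) / 2 else 0) else 0)"

lemma heis_of_mult: "heis_of u \<circ> heis_of v = heis_of (heis_mult u v)"
  by (simp add: heis_of_def heis_comp heis_mult_def add_diff_eq)

lemma heis_coords_mult:
  assumes "f \<in> Heis" "g \<in> Heis"
  shows "heis_coords (f \<circ> g) = heis_mult (heis_coords f) (heis_coords g)"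
proof -
  \<comment> \<open>\<open>heis_mult\<close> is zero from index \<open>5\<close> on, as membership
    in \<open>Rn 5\<close> demands.\<close>
  have "heis_mult (heis_coords f) (heis_coords g) \<in> Rn 5"
    by (simp add: heis_mult_def topspace_Euclidean_space)
  then have "heis_coords (heis_of (heis_coords f) \<circ> heis_of (heis_coords g)) = heis_mult (heis_coords f) (heis_coords g)"
    unfolding heis_of_mult by simp
  then show ?thesis using assms by simp
qed

lemma Heis_comp: "f \<in> Heis \<Longrightarrow> g \<in> Heis \<Longrightarrow> f \<circ> g \<in> Heis"
  using subgroup.m_closed[OF subgroup_Heis, of f g] by simp

lemma Heis_inv: "f \<in> Heis \<Longrightarrow> inv_into UNIV f \<in> Heis"
  by (auto elim!: HeisE simp: inv_heis)

text \<open>The central correction in the product is alternating and vanishes on parameters paired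
  with their negatives, so inversion is linear in coordinates.\<close>

lemma heis_coords_inv:
  assumes "f \<in> Heis"
  shows "heis_coords (inv_into UNIV f) = (\<lambda>i. - heis_coords f i)"
proof -
  have "(\<lambda>i. - heis_coords f i) \<in> Rn 5"
    using heis_coords_Rn[OF assms] by (simp add: topspace_Euclidean_space)
  moreover have "heis_of (\<lambda>i. - heis_coords f i) = inv_into UNIV (heis_of (heis_coords f))"
    by (simp add: heis_of_def inv_heis)
  ultimately show ?thesis using assms heis_coords_of by fastforce
qed

lemma continuous_map_heis_coord: "continuous_map Heis_top euclidean (\<lambda>f. heis_coords f i)"
proof -
  have "continuous_map (Euclidean_space 5) euclidean (\<lambda>u. u i)"
    unfolding continuous_map_Euclidean_space_iff
    by (rule continuous_on_subset[OF continuous_on_product_coordinates]) simp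
  from continuous_map_compose[OF continuous_map_heis_coords this] show ?thesis by (simp add: o_def)
qed

lemma continuous_map_into_Euclidean_space:
  assumes "\<And>x. x \<in> topspace T \<Longrightarrow> f x \<in> Rn n" "\<And>i. i < n \<Longrightarrow> continuous_map T euclideanreal (\<lambda>x. f x i)"
  shows "continuous_map T (Euclidean_space n) f"
proof (rule continuous_map_eq)
  show "continuous_map T (Euclidean_space n) (\<lambda>x i. if i < n then f x i else 0)"
    using assms(2) by (simp add: continuous_map_componentwise_Euclidean_space)
  show "(\<lambda>i. if i < n then f x i else 0) = f x" if "x \<in> topspace T" for x
    using assms(1)[OF that] by (auto simp: topspace_Euclidean_space)
qed

lemma smooth_map_mult_Heis:
  "smooth_map (prod_topology Heis_top Heis_top) (5 + 5) (prod_atlas 5 {(Heis, heis_coords)} {(Heis, heis_coords)})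
    Heis_top 5 {(Heis, heis_coords)} (\<lambda>(f, g). f \<circ> g)"
  unfolding smooth_map_def
proof
  have eq: "heis_coords ((\<lambda>(f, g). f \<circ> g) x) = heis_mult (heis_coords (fst x)) (heis_coords (snd x))"
    if "x \<in> topspace (prod_topology Heis_top Heis_top)" for x
    using that heis_coords_mult by auto
  have 1: "continuous_map (prod_topology Heis_top Heis_top) euclidean (\<lambda>x. heis_coords (fst x) i)" for i
    using continuous_map_compose[OF continuous_map_fst continuous_map_heis_coord] by (simp add: o_def)
  have 2: "continuous_map (prod_topology Heis_top Heis_top) euclidean (\<lambda>x. heis_coords (snd x) i)" for i
    using continuous_map_compose[OF continuous_map_snd continuous_map_heis_coord] by (simp add: o_def)
  show "continuous_map (prod_topology Heis_top Heis_top) Heis_top (\<lambda>(f, g). f \<circ> g)"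
  proof (rule continuous_map_into_Heis_top)
    have "continuous_map (prod_topology Heis_top Heis_top) (Euclidean_space 5)
        (\<lambda>x. heis_mult (heis_coords (fst x)) (heis_coords (snd x)))"
    proof (rule continuous_map_into_Euclidean_space)
      fix i :: nat assume "i < 5"
      show "continuous_map (prod_topology Heis_top Heis_top) euclideanreal
          (\<lambda>x. heis_mult (heis_coords (fst x)) (heis_coords (snd x)) i)"
      proof (cases "i = 4")
        case True
        then show ?thesis
          unfolding heis_mult_def
          by (simp, intro continuous_map_add continuous_map_diff continuous_map_real_divide
              continuous_map_real_mult 1 2 continuous_map_const[THEN iffD2] disjI2) simp_all
      next
        case False
        with \<open>i < 5\<close> show ?thesis
          unfolding heis_mult_def by (simp, intro continuous_map_add 1 2)
      qed
    qed (simp add: heis_mult_def topspace_Euclidean_space)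
    then show "continuous_map (prod_topology Heis_top Heis_top) (Euclidean_space 5)
        (\<lambda>x. heis_coords ((\<lambda>(f, g). f \<circ> g) x))"
      by (rule continuous_map_eq) (simp add: eq)
  qed (auto simp: Heis_comp)
  have "smooth_on (5 + 5) (Rn (5 + 5)) (\<lambda>u. heis_coords ((\<lambda>(f, g). f \<circ> g)
      (inv_into (Heis \<times> Heis) (snd (prod_chart 5 (Heis, heis_coords) (Heis, heis_coords))) u)) j)" if "j < 5" for j
  proof (rule smooth_on_trig_poly)
    show "trig_poly (\<lambda>u. heis_mult (low 5 u) (high 5 u) j)"
      using that unfolding less_5
      by (elim disjE; simp add: heis_mult_def low_def high_def; intro trig_poly_intros)
    show "heis_coords ((\<lambda>(f, g). f \<circ> g)
        (inv_into (Heis \<times> Heis) (snd (prod_chart 5 (Heis, heis_coords) (Heis, heis_coords))) u)) j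
        = heis_mult (low 5 u) (high 5 u) j" if u: "u \<in> Rn (5 + 5)" for u
      using low_Rn[of 5 u] high_Rn[OF u]
      by (simp add: prod_chart_global(2)[OF bij_heis_coords bij_heis_coords u] inv_heis_coords heis_coords_mult)
  qed
  moreover have "{p \<in> fst (prod_chart 5 (Heis, heis_coords) (Heis, heis_coords)). (\<lambda>(f, g). f \<circ> g) p \<in> Heis} = Heis \<times> Heis"
    by (auto simp: prod_chart_def Heis_comp)
  moreover have "fst (prod_chart 5 (Heis, heis_coords) (Heis, heis_coords)) = Heis \<times> Heis"
    by (simp add: prod_chart_def)
  ultimately show "\<forall>c\<in>prod_atlas 5 {(Heis, heis_coords)} {(Heis, heis_coords)}. \<forall>d\<in>{(Heis, heis_coords)}.
      smooth_in_charts (5 + 5) c 5 d (\<lambda>(f, g). f \<circ> g)"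
    by (simp add: prod_atlas_def smooth_in_charts_def prod_chart_global(1)[OF bij_heis_coords bij_heis_coords])
qed

text \<open>\<open>iv\<close> is left general since the inverse of the restricted group is known to
  agree with \<open>inv_into UNIV\<close> on \<open>Heis\<close> only.\<close>

lemma smooth_map_inv_Heis:
  assumes iv: "\<And>f. f \<in> Heis \<Longrightarrow> iv f = inv_into UNIV f"
  shows "smooth_map Heis_top 5 {(Heis, heis_coords)} Heis_top 5 {(Heis, heis_coords)} iv"
  unfolding smooth_map_def
proof
  have eq: "heis_coords (iv f) = (\<lambda>i. - heis_coords f i)" if "f \<in> Heis" for f
    using that by (simp add: iv heis_coords_inv)
  show "continuous_map Heis_top Heis_top iv"
  proof (rule continuous_map_into_Heis_top)
    show "continuous_map Heis_top (Euclidean_space 5) (\<lambda>f. heis_coords (iv f))"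
    proof (rule continuous_map_into_Euclidean_space)
      fix i :: nat
      have "continuous_map Heis_top euclideanreal (\<lambda>f. - heis_coords f i)"
        by (intro continuous_map_minus continuous_map_heis_coord)
      then show "continuous_map Heis_top euclideanreal (\<lambda>f. heis_coords (iv f) i)"
        by (rule continuous_map_eq) (simp add: eq)
    qed (simp add: iv Heis_inv heis_coords_Rn)
  qed (simp add: iv Heis_inv)
  have "smooth_on 5 (Rn 5) (\<lambda>u. heis_coords (iv (inv_into Heis heis_coords u)) j)" for j
    by (rule smooth_on_trig_poly[OF trig_poly_minus[OF trig_poly.coord[of j]]])
      (simp add: inv_heis_coords eq)
  moreover have "{p \<in> Heis. iv p \<in> Heis} = Heis" by (auto simp: iv Heis_inv)
  moreover have "heis_coords ` Heis = Rn 5" using bij_heis_coords by (simp add: bij_betw_def)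
  ultimately show "\<forall>c\<in>{(Heis, heis_coords)}. \<forall>d\<in>{(Heis, heis_coords)}. smooth_in_charts 5 c 5 d iv"
    by (simp add: smooth_in_charts_def)
qed

lemma lie_group_Heis: "lie_group (Iso_M\<lparr>carrier := Heis\<rparr>) Heis_top 5 {(Heis, heis_coords)}"
  unfolding lie_group_def
proof (intro conjI)
  show "smooth_map (prod_topology Heis_top Heis_top) (5 + 5) (prod_atlas 5 {(Heis, heis_coords)} {(Heis, heis_coords)})
      Heis_top 5 {(Heis, heis_coords)} (\<lambda>(f, g). f \<otimes>\<^bsub>Iso_M\<lparr>carrier := Heis\<rparr>\<^esub> g)"
    using smooth_map_mult_Heis by simp
  show "smooth_map Heis_top 5 {(Heis, heis_coords)} Heis_top 5 {(Heis, heis_coords)}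
      (\<lambda>f. inv\<^bsub>Iso_M\<lparr>carrier := Heis\<rparr>\<^esub> f)"
    by (rule smooth_map_inv_Heis) (rule inv_restrict[OF subgroup_Heis])
qed (simp_all add: group_Heis smooth_manifold_Heis)

lemma continuous_on_heis_of: "continuous_on UNIV (\<lambda>(u, p). heis_of u p)"
  unfolding heis_of_def by (rule continuous_on_heis) (rule continuous_on_product_coordinates)+

lemma continuous_map_heis_coords_euclidean: "continuous_map Heis_top euclidean heis_coords"
  using continuous_map_heis_coords
  by (subst (asm) Euclidean_space_eq) (simp only: continuous_map_in_subtopology)

lemma continuous_map_Heis_Iso_top: "continuous_map Heis_top Iso_top (\<lambda>f. f)"
proof (rule continuous_map_eq)
  have "continuous_map euclidean Iso_top heis_of"
    by (rule continuous_map_Iso_top_jointly[OF continuous_on_heis_of]) (simp add: heis_of_def)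
  from continuous_map_compose[OF continuous_map_heis_coords_euclidean this]
  show "continuous_map Heis_top Iso_top (heis_of \<circ> heis_coords)" .
qed simp

text \<open>The product chart lists five group parameters and then the point, so \<open>t\<close> is
  entry \<open>5\<close>; sine and cosine are applied to this entry alone.\<close>

lemma smooth_map_action_Heis:
  "smooth_map (prod_topology Heis_top euclidean) (5 + 4) (prod_atlas 5 {(Heis, heis_coords)} M_atlas)
    euclidean 4 M_atlas (\<lambda>(f, p). f p)"
  unfolding smooth_map_def
proof
  have "continuous_map (prod_topology Heis_top euclidean) (prod_topology euclidean euclidean)
      (\<lambda>x. (heis_coords (fst x), snd x :: point))"
    by (intro continuous_map_pairedI continuous_map_snd
        continuous_map_compose[OF continuous_map_fst continuous_map_heis_coords_euclidean, unfolded o_def])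
  moreover have "continuous_map (prod_topology euclidean euclidean) euclidean (\<lambda>(u, p). heis_of u p)"
    using continuous_on_heis_of by simp
  ultimately have "continuous_map (prod_topology Heis_top euclidean) euclidean
      ((\<lambda>(u, p). heis_of u p) \<circ> (\<lambda>x. (heis_coords (fst x), snd x)))"
    by (rule continuous_map_compose)
  then show "continuous_map (prod_topology Heis_top euclidean) euclidean (\<lambda>(f, p). f p)"
    by (rule continuous_map_eq) auto
  have "smooth_on (5 + 4) (Rn (5 + 4)) (\<lambda>u. coords ((\<lambda>(f, p). f p)
      (inv_into (Heis \<times> UNIV) (snd (prod_chart 5 (Heis, heis_coords) (UNIV, coords))) u)) j)" if "j < 4" for j
  proof (rule smooth_on_trig_poly)
    show "trig_poly (\<lambda>u. coords (heis_of (low 5 u) (of_coords (high 5 u))) j)"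
      using that unfolding less_4
      by (elim disjE; simp add: heis_of_def of_coords_def low_def high_def osc1_def osc2_def;
          intro trig_poly_intros)
    show "coords ((\<lambda>(f, p). f p)
        (inv_into (Heis \<times> UNIV) (snd (prod_chart 5 (Heis, heis_coords) (UNIV, coords))) u)) j
        = coords (heis_of (low 5 u) (of_coords (high 5 u))) j" if u: "u \<in> Rn (5 + 4)" for u
      using low_Rn[of 5 u] high_Rn[OF u]
      by (simp add: prod_chart_global(2)[OF bij_heis_coords bij_coords u] inv_heis_coords inv_coords)
  qed
  moreover have "fst (prod_chart 5 (Heis, heis_coords) (UNIV, coords)) = Heis \<times> UNIV"
    by (simp add: prod_chart_def)
  ultimately show "\<forall>c\<in>prod_atlas 5 {(Heis, heis_coords)} M_atlas. \<forall>d\<in>M_atlas.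
      smooth_in_charts (5 + 4) c 4 d (\<lambda>(f, p). f p)"
    by (simp add: prod_atlas_def M_atlas_def smooth_in_charts_def prod_chart_global(1)[OF bij_heis_coords bij_coords])
qed

lemma connected_lie_subgroup_Heis: "connected_lie_subgroup Heis"
proof -
  have "connected_space Heis_top"
    using homeomorphic_connected_space[OF homeomorphic_Heis_top] connected_Euclidean_space by blast
  then show ?thesis
    unfolding connected_lie_subgroup_def
    using subgroup_Heis lie_group_Heis continuous_map_Heis_Iso_top smooth_map_action_Heis by blast
qed

lemma nilradical_Heis: "is_nilradical Heis"
  unfolding is_nilradical_def
proof (intro conjI allI impI)
  show "connected_normal_nilpotent Heis"
    by (simp add: connected_normal_nilpotent_def connected_lie_subgroup_Heis normal_Heis nilpotent_Heis)
  fix K assume "connected_normal_nilpotent K"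
  then have K: "K \<lhd> Iso_M" "nilpotent_group (Iso_M\<lparr>carrier := K\<rparr>)" and "connected_lie_subgroup K"
    by (simp_all add: connected_normal_nilpotent_def)
  then obtain X n A where X: "lie_group (Iso_M\<lparr>carrier := K\<rparr>) X n A" "connected_space X"
    "continuous_map X Iso_top (\<lambda>f. f)"
    unfolding connected_lie_subgroup_def by blast
  have "topspace X = K" using X(1) by (simp add: lie_group_def)
  moreover have "connectedin X (topspace X)" using X(2) by (simp only: connectedin_topspace)
  \<comment> \<open>\<open>X\<close> may be finer than the subspace topology; \<open>K\<close> is
    connected in \<open>Iso_top\<close> as the image of \<open>X\<close> under the continuous
    inclusion.\<close>
  ultimately have "connectedin Iso_top K"
    using connectedin_continuous_map_image[OF X(3), of K] by simp
  then show "K \<subseteq> Heis" by (rule normal_nilpotent_subset_Heis[OF K])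
qed

text \<open>Orbits of the nilradical stay in the slices of constant \<open>t\<close>. This refutes
  transitivity, and also the inclusion of \<open>N_trans\<close>, whose elements can shift
  \<open>t\<close>.\<close>

lemma Heis_fst: "f \<in> Heis \<Longrightarrow> fst (f p) = fst p"
  by (cases p) (auto elim!: HeisE)

theorem mainTheorem1:
  shows
    "group Iso_M \<and> subgroup Iso0 Iso_M \<and> subgroup N_trans Iso_M \<and>
     (transitive N_trans \<and> subgroup N_trans Iso0_group \<and> \<not> N_trans \<lhd> Iso0_group) \<and>
     (\<exists>R. is_nilradical R \<and> \<not> N_trans \<subseteq> R \<and> \<not> transitive R) \<and>
     (Iso_aut \<subset> Isometries \<and>
      subgroup Iso_aut Iso_M \<and> internal_semidirect (Iso_M\<lparr>carrier := Iso_aut\<rparr>) N_trans H_aut \<and>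
      N_trans <#>\<^bsub>Iso_M\<^esub> H_stab = Isometries) \<and>
     \<not> connectedin Iso_top H_aut"
proof -
  have "\<not> N_trans \<subseteq> Heis"
  proof
    assume "N_trans \<subseteq> Heis"
    then have "nmult (1, 0, 0, 0) \<in> Heis" unfolding N_trans_def by blast
    from Heis_fst[OF this, of "(0, 0, 0, 0)"] show False by simp
  qed
  moreover have "\<not> transitive Heis"
  proof
    assume "transitive Heis"
    then obtain f where "f \<in> Heis" "f (0, 0, 0, 0) = (1, 0, 0, 0)" unfolding transitive_def by blast
    with Heis_fst[of f "(0, 0, 0, 0)"] show False by simp
  qed
  ultimately have "\<exists>R. is_nilradical R \<and> \<not> N_trans \<subseteq> R \<and> \<not> transitive R"
    using nilradical_Heis by blast
  then show ?thesis
    using group_Iso_M subgroup_Iso0 subgroup_N_trans transitive_N_trans subgroup_N_trans_Iso0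
      not_normal_N_trans Iso_aut_psubset subgroup_Iso_aut internal_semidirect_Iso_aut N_trans_H_stab
      not_connected_H_aut by blast
qed

end
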